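(* For every $D\in\mathbb{N}$ there exists a constant $C(D)$, depending only on $D$, such that for every connected infinite penny graph $G=(V,E,F)$ with $\sup_{\sigma\in F}\deg(\sigma)=D$ and for any $k\geq 1$, $$\dim\mathcal{P}^{k}(G)\leq C(D)\, k^2.$$
   Context: Penny graphs. Let $\{C_i\}_{i=1}^\infty$ be an infinite collection of circles of radius $\frac12$ in $\mathbb{R}^2$ bounding open disks that are pairwise disjoint. The penny graph of this configuration is the graph $(V,E)$ with one vertex $v_i$ for each circle $C_i$, and $\{v_i,v_j\}\in E$ if and only if $C_i$ and $C_j$ are tangent. Placing $v_i$ at the center of $C_i$ and each edge as the straight segment joining the two centers embeds $(V,E)$ in $\mathbb{R}^2$; vertices and edges are identified with their images. The set $F$ of faces consists of the connected components of the complement in $\mathbb{R}^2$ of the embedded graph, and $G=(V,E,F)$ is called an infinite penny graph. It is connected if $(V,E)$ is connected. For $\sigma\in F$, the facial degree $\deg(\sigma)\in\mathbb{N}\cup\{\infty\}$ is the number of interior angles (corners) of the polygonal domain $\sigma$ (counted with multiplicity, i.e. along the boundary walk, which may have self-intersections). Ancient solutions. The combinatorial Laplacian is $\Delta f(x)=\sum_{y\sim x}(f(y)-f(x))$ for $f:V\to\mathbb{R}$, the sum being over neighbours $y$ of $x$. A function $u:V\times(-\infty,0]\to\mathbb{R}$ is an ancient solution to the heat equation if $u(x,\cdot)\in C^1((-\infty,0])$ for every $x\in V$ and $\partial_t u(x,t)=\Delta u(x,t)$ for all $x\in V$, $t\leq 0$ (with $\Delta$ acting in the variable $x$). Let $d$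 be the combinatorial graph distance and fix $x_0\in V$. Then $$\mathcal{P}^k(G)=\{\text{ancient solutions } u:\ \exists C\ \ |u(x,t)|\leq C(1+d(x,x_0)+\sqrt{|t|})^k\ \ \forall x\in V,\ t\leq 0\}$$ (a real vector space, independent of $x_0$). *)

theory Defs
  imports "HOL-Analysis.Analysis" "HOL-Library.Function_Algebras" "HOL-Library.Extended_Nat"
begin

text \<open>
  Pointwise real vector space structure on function spaces, so that \<^const>\<open>span\<close> and
  \<^const>\<open>dim\<close> apply to spaces of functions of space and time.
\<close>

instantiation "fun" :: (type, scaleR) scaleR
begin

definition scaleR_fun_def: "a *\<^sub>R f = (\<lambda>x. a *\<^sub>R f x)"

instance ..

end

instance "fun" :: (type, real_vector) real_vector
  by standard (auto simp: scaleR_fun_def fun_eq_iff scaleR_add_right scaleR_add_left)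

text \<open>
  The Euclidean plane is the type \<^typ>\<open>complex\<close>.  A configuration is the sequence
  \<open>c\<close> of the centres; the vertex \<open>v\<^sub>i\<close> is the index \<open>i\<close>, placed at the point \<open>c i\<close>.
\<close>

definition penny_configuration :: "(nat \<Rightarrow> complex) \<Rightarrow> bool" where
  "penny_configuration c \<longleftrightarrow> disjoint_family (\<lambda>i. ball (c i) (1/2))"

text \<open>
  Two circles are tangent if they meet in exactly one point.  A circle meets itself in more
  than one point, so there are no loops.
\<close>

definition penny_edges :: "(nat \<Rightarrow> complex) \<Rightarrow> (nat \<times> nat) set" where
  "penny_edges c = {(i, j). \<exists>p. sphere (c i) (1/2) \<inter> sphere (c j) (1/2) = {p}}"

definition penny_connected :: "(nat \<Rightarrow> complex) \<Rightarrow> bool" where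
  "penny_connected c \<longleftrightarrow> (\<forall>i j. (i, j) \<in> (penny_edges c)\<^sup>*)"

definition embedded_graph :: "(nat \<Rightarrow> complex) \<Rightarrow> complex set" where
  "embedded_graph c = range c \<union> (\<Union>(i, j)\<in>penny_edges c. closed_segment (c i) (c j))"

definition penny_faces :: "(nat \<Rightarrow> complex) \<Rightarrow> complex set set" where
  "penny_faces c = components (- embedded_graph c)"

text \<open>
  Edges have length 1 and distinct vertices are at distance at least 1, so the only part of the
  embedded graph inside the open disc of radius 1/2 about a vertex is the star of radii along the
  edges at that vertex.  The corners of a face at the vertex are therefore the sectors of this
  disc contained in the face, that is, the connected components of the intersection of the face
  with the disc.  A vertex which the boundary walk of the face visits several times contributes one
  sector for each visit; a vertex of degree 1 contributes one sector, of angle \<open>2\<pi>\<close>.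
\<close>

definition face_corners :: "(nat \<Rightarrow> complex) \<Rightarrow> complex set \<Rightarrow> (nat \<times> complex set) set" where
  "face_corners c \<sigma> = (SIGMA i:UNIV. components (\<sigma> \<inter> ball (c i) (1/2)))"

definition facial_degree :: "(nat \<Rightarrow> complex) \<Rightarrow> complex set \<Rightarrow> enat" where
  "facial_degree c \<sigma> =
     (if finite (face_corners c \<sigma>) then enat (card (face_corners c \<sigma>)) else \<infinity>)"

text \<open>Meaningful for vertices in the same connected component.\<close>

definition graph_dist :: "(nat \<Rightarrow> complex) \<Rightarrow> nat \<Rightarrow> nat \<Rightarrow> nat" where
  "graph_dist c i j = (LEAST n. (i, j) \<in> penny_edges c ^^ n)"

text \<open>The sum is finite: in a penny graph every vertex has at most 6 neighbours.\<close>

definition laplacian :: "(nat \<Rightarrow> complex) \<Rightarrow> (nat \<Rightarrow> real) \<Rightarrow> nat \<Rightarrow> real" where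
  "laplacian c f x = (\<Sum>y | (x, y) \<in> penny_edges c. f y - f x)"

text \<open>Continuously differentiable on \<open>(-\<infinity>, 0]\<close>, with the one-sided derivative at 0.\<close>

definition C1_past :: "(real \<Rightarrow> real) \<Rightarrow> bool" where
  "C1_past f \<longleftrightarrow> (\<exists>f'. continuous_on {..0} f' \<and>
     (\<forall>t\<le>0. (f has_real_derivative f' t) (at t within {..0})))"

definition ancient_solution :: "(nat \<Rightarrow> complex) \<Rightarrow> (nat \<Rightarrow> real \<Rightarrow> real) \<Rightarrow> bool" where
  "ancient_solution c u \<longleftrightarrow> (\<forall>x. C1_past (u x)) \<and>
     (\<forall>x. \<forall>t\<le>0. (u x has_real_derivative laplacian c (\<lambda>y. u y t) x) (at t within {..0}))"

text \<open>
  A function on \<open>V \<times> (-\<infinity>, 0]\<close> is represented by its unique extension by 0 to positive times.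
\<close>

definition ancient_poly ::
    "(nat \<Rightarrow> complex) \<Rightarrow> nat \<Rightarrow> real \<Rightarrow> (nat \<Rightarrow> real \<Rightarrow> real) set" where
  "ancient_poly c x0 k = {u. ancient_solution c u \<and> (\<forall>x. \<forall>t>0. u x t = 0) \<and>
     (\<exists>C. \<forall>x. \<forall>t\<le>0. \<bar>u x t\<bar> \<le> C * (1 + real (graph_dist c x x0) + sqrt \<bar>t\<bar>) powr k)}"

end

theory Submission
  imports Defs
begin

text \<open>
  Seen from far away, a connected penny graph whose faces have at most \<open>D\<close> corners
  looks like the lattice \<open>\<int>\<^sup>2\<close>, and the bound is proved for every graph with
  this property.

  Geometry. The embedded graph is closed and connected, so the frontier of each face is connected:
  this is the unicoherence of the plane. The frontier is a union of edges whose endpoints are at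
  most \<open>D\<close> in number, because each of them carries a corner of the face. Hence these
  vertices are joined to one another, by way of frontier vertices, by at most
  \<open>D\<^sup>2\<close> edges, and the face has bounded diameter. Walking along a straight
  segment from face to face then shows that two vertices at bounded Euclidean distance are at
  bounded graph distance. In a square grid whose mesh depends on \<open>D\<close> only, every cell
  contains a bounded positive number of vertices, and vertices of adjacent cells are joined by short
  paths. This is the locale \<open>rough_lattice\<close> (\<open>penny_rough_lattice\<close>); all
  that follows uses nothing else.

  Time. For an ancient solution the weighted sums of \<open>u\<^sup>2\<close>,
  \<open>(\<Delta>u)\<^sup>2\<close> and \<open>(\<Delta>\<^sup>2u)\<^sup>2\<close>, with the
  elapsed time as weight, form a functional that hardly increases
  (\<open>parabolic_mean_bound\<close>). On a parabolic cylinder of size \<open>r\<close> this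
  bounds \<open>\<Delta>\<^sup>2u\<close> by a multiple of \<open>sup \<bar>u\<bar> / r\<close>:
  each \<open>\<Delta>\<close>, being dominated by a gradient, gains a factor \<open>1/r\<close>,
  and passing from a sum of squares over the \<open>O(r\<^sup>2)\<close> vertices of a box to a
  single value costs one factor \<open>r\<close>. So \<open>\<Delta>\<^sup>2\<close> lowers the
  growth exponent by one, \<open>\<Delta>\<close> is nilpotent of order \<open>2k + 2\<close> on the
  solutions of growth \<open>k\<close>, and since the kernel of \<open>\<Delta>\<close> consists of
  harmonic functions of growth \<open>k\<close> that do not depend on time, the dimension is at most
  \<open>2k + 2\<close> times that of the space of these harmonic functions
  (\<open>ancient_spanned_by_harmonic\<close>).

  Space. It remains to see that harmonic functions of growth \<open>k\<close> form a space of
  dimension \<open>O(k)\<close> (\<open>harmonic_spanned\<close>). Cover the square annulus of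
  radius \<open>R\<close> and width \<open>R/k\<close> by squares of side \<open>R/(kq)\<close>;
  there are \<open>O(k q\<^sup>2)\<close> of them, and this count is linear in \<open>k\<close> only
  because the box surrounded by the annulus is left uncovered. If a harmonic function has mean zero
  on each square, the inequalities of Caccioppoli and Poincare bound its energy within
  \<open>R\<close> by \<open>O(1/q\<^sup>2)\<close> times its energy within \<open>(1 + 3/k)
  R\<close> (\<open>shell_energy_decay\<close>). Hence at each of \<open>J\<close> successive scales
  the energy drops by a large constant factor on a subspace of codimension \<open>m = O(k)\<close>,
  while polynomial growth allows in all a factor exponential in \<open>J\<close> with a base that
  does not depend on \<open>k\<close>. These subspaces vary with the scale, so no single function
  need lie in many of them. A counting argument deals with this: take \<open>N\<close> functions
  dual to \<open>N\<close> points and their \<open>3^(J N)\<close> combinations with coefficients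
  \<open>0, \<dots>, 3^J - 1\<close>. Descending one scale costs, by the pigeonhole principle, a
  factor \<open>K^m\<close> in the number of combinations and brings the rest closer together
  (\<open>entropy_step\<close>). If \<open>3^N > K^m\<close>, two different combinations survive all
  scales and are so close that they differ by less than 1 at the \<open>N\<close> points, where
  their values are integers: a contradiction.
\<close>

section \<open>Spanning sets and dual points\<close>

text \<open>
  A form of ``dimension at most \<open>n\<close>'' that also says that the dimension is finite:
  \<^const>\<open>dim\<close> alone does not.
\<close>

definition spanned_by :: "nat \<Rightarrow> 'a::real_vector set \<Rightarrow> bool" where
  "spanned_by n W \<longleftrightarrow> (\<exists>B. finite B \<and> card B \<le> n \<and> W \<subseteq> span B)"

lemma spanned_by_mono: "spanned_by n W \<Longrightarrow> V \<subseteq> W \<Longrightarrow> n \<le> n' \<Longrightarrow> spanned_by n' V"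
  unfolding spanned_by_def by (meson order_trans)

lemma spanned_by_kernel_image:
  fixes T :: "'a::real_vector \<Rightarrow> 'b::real_vector"
  assumes W: "subspace W" and T: "linear T"
    and img: "spanned_by n (T ` W)" and ker: "spanned_by h {w \<in> W. T w = 0}"
  shows "spanned_by (n + h) W"
proof -
  obtain B where B: "finite B" "card B \<le> n" "T ` W \<subseteq> span B"
    using img unfolding spanned_by_def by blast
  obtain K where K: "finite K" "card K \<le> h" "{w \<in> W. T w = 0} \<subseteq> span K"
    using ker unfolding spanned_by_def by blast
  obtain B' where B': "B' \<subseteq> T ` W" "independent B'" "T ` W \<subseteq> span B'"
    using maximal_independent_subset[of "T ` W"] by blast
  have finB': "finite B'" and cardB': "card B' \<le> n"
    using independent_span_bound[OF B(1) B'(2) order_trans[OF B'(1) B(3)]] B(2) by auto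
  obtain g where g: "\<And>b. b \<in> B' \<Longrightarrow> g b \<in> W \<and> T (g b) = b"
    using B'(1) by (metis image_iff subset_iff)
  have "W \<subseteq> span (g ` B' \<union> K)"
  proof
    fix w assume w: "w \<in> W"
    then have "T w \<in> span B'" using B'(3) by blast
    then obtain a where a: "T w = (\<Sum>b\<in>B'. a b *\<^sub>R b)"
      using finB' by (auto simp: span_finite)
    define z where "z = (\<Sum>b\<in>B'. a b *\<^sub>R g b)"
    have zW: "z \<in> W" unfolding z_def using g W by (intro subspace_sum) (auto intro: subspace_scale)
    have "T z = T w"
      unfolding z_def a using g by (simp add: linear_sum[OF T] linear_scale[OF T])
    then have "w - z \<in> {w \<in> W. T w = 0}"
      using w zW W by (simp add: linear_diff[OF T] subspace_diff)
    then have "w - z \<in> span K" using K by blast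
    then have 1: "w - z \<in> span (g ` B' \<union> K)" by (meson span_mono subsetD sup_ge2)
    have "z \<in> span (g ` B')"
      unfolding z_def by (intro span_sum span_scale span_base) auto
    then have 2: "z \<in> span (g ` B' \<union> K)" by (meson span_mono subsetD sup_ge1)
    show "w \<in> span (g ` B' \<union> K)" using span_add[OF 1 2] by simp
  qed
  moreover have "card (g ` B' \<union> K) \<le> n + h"
    using card_Un_le[of "g ` B'" K] card_image_le[OF finB', of g] cardB' K(2) by linarith
  ultimately show ?thesis unfolding spanned_by_def using finB' K(1)
    by (intro exI[of _ "g ` B' \<union> K"]) simp
qed

lemma sum_fun_apply: "(\<Sum>i\<in>A. f i) x = (\<Sum>i\<in>A. f i x)"
  by (induction A rule: infinite_finite_induct) auto

lemma scaleR_fun_apply: "(a *\<^sub>R f) x = a *\<^sub>R f x"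
  by (simp add: scaleR_fun_def)

text \<open>
  As long as the functions found so far do not span \<open>W\<close>, some element of
  \<open>W\<close> vanishes at all the points chosen so far without vanishing identically; it
  provides the next point.
\<close>

lemma dual_points_of_not_spanned:
  fixes W :: "('v \<Rightarrow> real) set"
  assumes W: "subspace W" and "\<not> spanned_by n W"
  shows "\<exists>x f. (\<forall>i\<le>n. f i \<in> W) \<and> (\<forall>i\<le>n. \<forall>j\<le>n. f i (x j) = (if i = j then 1 else (0::real)))"
  using assms(2)
proof -
  have "\<exists>x f. (\<forall>i<m. f i \<in> W) \<and> (\<forall>i<m. \<forall>j<m. f i (x j) = (if i = j then 1 else (0::real)))"
    if "m \<le> Suc n" for m
    using that
  proof (induction m)
    case 0
    then show ?case by simp
  next
    case (Suc m)
    then have "m \<le> Suc n" by simp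
    from Suc.IH[OF this] obtain x f where f: "\<And>i. i < m \<Longrightarrow> f i \<in> W"
      and fx: "\<And>i j. i < m \<Longrightarrow> j < m \<Longrightarrow> f i (x j) = (if i = j then 1 else (0::real))"
      by metis
    have "card (f ` {..<m}) \<le> n" using card_image_le[of "{..<m}" f] Suc.prems by simp
    then have "\<not> W \<subseteq> span (f ` {..<m})"
      using assms(2) unfolding spanned_by_def by blast
    then obtain w where w: "w \<in> W" "w \<notin> span (f ` {..<m})" by blast
    define s where "s = (\<Sum>i<m. w (x i) *\<^sub>R f i)"
    have s: "s \<in> span (f ` {..<m})" unfolding s_def by (intro span_sum span_scale span_base) auto
    have sW: "s \<in> W" unfolding s_def using f W by (intro subspace_sum subspace_scale) auto
    have "w - s \<noteq> 0" using w(2) s by auto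
    then obtain p where p: "(w - s) p \<noteq> 0" by (auto simp: fun_eq_iff)
    have sx: "s (x j) = w (x j)" if "j < m" for j
      unfolding s_def using that by (simp add: sum_fun_apply scaleR_fun_apply fx if_distrib cong: if_cong)
    define h where "h = (1 / (w - s) p) *\<^sub>R (w - s)"
    have hp: "h p = 1" using p by (simp add: h_def scaleR_fun_apply)
    have hx: "h (x j) = 0" if "j < m" for j using sx[OF that] by (simp add: h_def scaleR_fun_apply)
    have hW: "h \<in> W" unfolding h_def using w(1) sW W by (intro subspace_scale subspace_diff) auto
    define f' where "f' i = (if i = m then h else f i - f i p *\<^sub>R h)" for i
    define x' where "x' = x(m := p)"
    have "f' i \<in> W" if "i < Suc m" for i
      using that f W hW by (auto simp: f'_def less_Suc_eq intro!: subspace_diff subspace_scale)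
    moreover have "f' i (x' j) = (if i = j then 1 else 0)" if "i < Suc m" "j < Suc m" for i j
      using that by (auto simp: f'_def x'_def less_Suc_eq hp hx fx scaleR_fun_apply)
    ultimately show ?case by blast
  qed
  from this[of "Suc n"] show ?thesis by (simp add: less_Suc_eq_le)
qed

section \<open>Pigeonhole principle for quadratic forms\<close>

text \<open>
  The process is carried out for an arbitrary bilinear form that is positive on the span in
  question, because the energy forms of an increasing family of regions have to be compared on one
  and the same space.
\<close>

lemma gram_schmidt:
  fixes b :: "'a::real_vector \<Rightarrow> 'a \<Rightarrow> real"
  assumes bil: "bilinear b" and sym: "\<And>f g. b f g = b g f"
    and fin: "finite F" and pos: "\<And>f. f \<in> span F \<Longrightarrow> f \<noteq> 0 \<Longrightarrow> b f f > 0"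
  shows "\<exists>U. finite U \<and> card U \<le> card F \<and> U \<subseteq> span F \<and> F \<subseteq> span U \<and>
            (\<forall>e\<in>U. \<forall>e'\<in>U. b e e' = (if e = e' then 1 else 0))"
  using fin pos
proof (induction F rule: finite_induct)
  case empty
  show ?case by (rule exI[of _ "{}"]) auto
next
  case (insert f F)
  have "span F \<subseteq> span (insert f F)" by (simp add: span_mono subset_insertI)
  then have "\<And>h. h \<in> span F \<Longrightarrow> h \<noteq> 0 \<Longrightarrow> b h h > 0" using insert.prems by blast
  from insert.IH[OF this] obtain U where U: "finite U" "card U \<le> card F" "U \<subseteq> span F" "F \<subseteq> span U"
    and on: "\<forall>e\<in>U. \<forall>e'\<in>U. b e e' = (if e = e' then 1 else 0)"
    by metis
  have lin: "linear (b x)" "linear (\<lambda>x. b x y)" for x y using bil by (auto simp: bilinear_def)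
  have Usub: "U \<subseteq> span (insert f F)" using U(3) \<open>span F \<subseteq> _\<close> by blast
  define g where "g = f - (\<Sum>e\<in>U. b f e *\<^sub>R e)"
  have gs: "g \<in> span (insert f F)"
    unfolding g_def using Usub by (intro span_diff span_sum span_scale) (auto intro: span_base)
  have sumU: "(\<Sum>e\<in>U. b f e *\<^sub>R e) \<in> span U" by (intro span_sum span_scale span_base)
  have orth: "b g e = 0" if e: "e \<in> U" for e
  proof -
    have "b g e = b f e - (\<Sum>e'\<in>U. b f e' * b e' e)"
      unfolding g_def by (simp add: linear_diff[OF lin(2)] linear_sum[OF lin(2)] linear_scale[OF lin(2)])
    also have "(\<Sum>e'\<in>U. b f e' * b e' e) = (\<Sum>e'\<in>U. if e' = e then b f e' else 0)"
      using on e by (intro sum.cong) auto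
    also have "\<dots> = b f e" using U(1) e by simp
    finally show ?thesis by simp
  qed
  have card: "card (insert f F) = Suc (card F)" using insert by simp
  show ?case
  proof (cases "g = 0")
    case True
    then have "f \<in> span U" using sumU by (simp add: g_def)
    then show ?thesis using U Usub on card by (intro exI[of _ U]) auto
  next
    case False
    define h where "h = (1 / sqrt (b g g)) *\<^sub>R g"
    have bg: "b g g > 0" using insert.prems gs False by blast
    have hh: "b h h = 1"
      using bg by (simp add: h_def linear_scale[OF lin(1)] linear_scale[OF lin(2)] field_simps)
    have he: "b h e = 0" "b e h = 0" if "e \<in> U" for e
      using orth[OF that] sym[of e h] by (simp_all add: h_def linear_scale[OF lin(2)])
    have "f = sqrt (b g g) *\<^sub>R h + (\<Sum>e\<in>U. b f e *\<^sub>R e)"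
      using bg by (simp add: h_def g_def)
    moreover have "\<dots> \<in> span (insert h U)"
      using sumU by (intro span_add span_scale) (auto intro: span_base span_mono[THEN subsetD])
    ultimately have fh: "f \<in> span (insert h U)" by simp
    have "F \<subseteq> span (insert h U)" using U(4) span_mono[of U "insert h U"] by auto
    moreover have "h \<in> span (insert f F)" unfolding h_def using gs by (rule span_scale)
    moreover have "card (insert h U) \<le> card (insert f F)"
      using card U(1,2) by (simp add: card_insert_if)
    ultimately show ?thesis
      using U(1) Usub fh on he hh by (intro exI[of _ "insert h U"]) (auto dest: he)
  qed
qed

text \<open>
  The functionals are represented by vectors, and these are orthonormalised. A vector orthogonal to
  the result is annihilated by every functional, while the number of vectors does not exceed that of
  the functionals.
\<close>

lemma orthonormal_detecting_functionals:
  fixes b :: "'a::real_vector \<Rightarrow> 'a \<Rightarrow> real"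
  assumes bil: "bilinear b" and sym: "\<And>f g. b f g = b g f"
    and fin: "finite F" and pos: "\<And>f. f \<in> span F \<Longrightarrow> f \<noteq> 0 \<Longrightarrow> b f f > 0"
    and L: "finite L" and lin: "\<And>l. l \<in> L \<Longrightarrow> linear l"
  shows "\<exists>U. finite U \<and> card U \<le> card L \<and> U \<subseteq> span F \<and>
            (\<forall>e\<in>U. \<forall>e'\<in>U. b e e' = (if e = e' then 1 else 0)) \<and>
            (\<forall>f\<in>span F. (\<forall>e\<in>U. b f e = 0) \<longrightarrow> (\<forall>l\<in>L. l f = (0::real)))"
proof -
  have blin: "linear (b x)" "linear (\<lambda>x. b x y)" for x y using bil by (auto simp: bilinear_def)
  obtain V where V: "finite V" "V \<subseteq> span F" "F \<subseteq> span V"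
    and on: "\<And>e e'. e \<in> V \<Longrightarrow> e' \<in> V \<Longrightarrow> b e e' = (if e = e' then 1 else 0)"
    using gram_schmidt[OF bil sym fin pos] by metis
  define r where "r l = (\<Sum>v\<in>V. l v *\<^sub>R v)" for l :: "'a \<Rightarrow> real"
  have r: "r l \<in> span F" for l unfolding r_def using V by (intro span_sum span_scale) auto
  have spanV: "span F \<subseteq> span V" using V(3) by (simp add: span_minimal)
  have riesz: "l f = b f (r l)" if "f \<in> span F" "l \<in> L" for f l
  proof -
    have "f \<in> span V" using spanV that(1) by blast
    then obtain a where a: "f = (\<Sum>v\<in>V. a v *\<^sub>R v)"
      using V(1) by (auto simp: span_finite)
    have bv: "b v (r l) = l v" if "v \<in> V" for v
    proof -
      have "b v (r l) = (\<Sum>v'\<in>V. l v' * b v v')"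
        unfolding r_def by (simp add: linear_sum[OF blin(1)] linear_scale[OF blin(1)])
      also have "\<dots> = (\<Sum>v'\<in>V. if v' = v then l v' else 0)"
        using on that by (intro sum.cong) auto
      finally show ?thesis using that V(1) by simp
    qed
    show ?thesis
      unfolding a
      by (simp add: linear_sum[OF blin(2)] linear_scale[OF blin(2)] linear_sum[OF lin[OF that(2)]]
          linear_scale[OF lin[OF that(2)]] bv)
  qed
  have sub: "span (r ` L) \<subseteq> span F" using r by (intro span_minimal) auto
  obtain U where U: "finite U" "card U \<le> card (r ` L)" "U \<subseteq> span (r ` L)" "r ` L \<subseteq> span U"
    "\<forall>e\<in>U. \<forall>e'\<in>U. b e e' = (if e = e' then 1 else 0)"
    using gram_schmidt[OF bil sym finite_imageI[OF L] pos[OF subsetD[OF sub]]] by metis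
  have "l f = 0" if "f \<in> span F" "\<forall>e\<in>U. b f e = 0" "l \<in> L" for f l
  proof -
    have "r l \<in> span U" using U(4) that(3) by blast
    then obtain a where "r l = (\<Sum>v\<in>U. a v *\<^sub>R v)" using U(1) by (auto simp: span_finite)
    then have "b f (r l) = 0"
      using that(2) by (simp add: linear_sum[OF blin(1)] linear_scale[OF blin(1)])
    then show ?thesis using riesz[OF that(1,3)] by simp
  qed
  moreover have "card U \<le> card L" using U(2) card_image_le[OF L, of r] by linarith
  ultimately show ?thesis using U(1,3,5) sub by (intro exI[of _ U]) auto
qed

lemma sum_half_powers_le_3: "(\<Sum>z\<in>{-int M..int M}. (1/2::real) ^ nat \<bar>z\<bar>) \<le> 3"
proof -
  have "(\<Sum>z\<in>{-int M..int M}. (1/2::real) ^ nat \<bar>z\<bar>) = 3 - 2 * (1/2) ^ M"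
  proof (induction M)
    case (Suc M)
    have "{-int (Suc M)..int (Suc M)} = insert (- int (Suc M)) (insert (int (Suc M)) {-int M..int M})"
      by auto
    then show ?case using Suc by (simp add: nat_add_distrib nat_diff_distrib algebra_simps del: of_nat_Suc)
  qed simp
  then show ?thesis by simp
qed

text \<open>
  Give the vector \<open>n\<close> the weight \<open>2^(- \<Sum> \<bar>n s\<bar>)\<close>. The total
  weight factorises over the coordinates and is at most \<open>3\<close> to their number, and every
  vector that is counted has weight at least \<open>2^(-M)\<close>.
\<close>

lemma card_integer_vectors_le:
  assumes "finite S"
  shows "card {n \<in> S \<rightarrow>\<^sub>E {-int M..int M}. (\<Sum>s\<in>S. \<bar>n s\<bar>) \<le> int M} \<le> 2 ^ M * 3 ^ card S"
proof -
  let ?P = "S \<rightarrow>\<^sub>E {-int M..int M}"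
  let ?G = "{n \<in> ?P. (\<Sum>s\<in>S. \<bar>n s\<bar>) \<le> int M}"
  have finP: "finite ?P" using assms by (intro finite_PiE) auto
  have "real (card ?G) * (1/2) ^ M = (\<Sum>n\<in>?G. (1/2) ^ M)" by simp
  also have "\<dots> \<le> (\<Sum>n\<in>?G. \<Prod>s\<in>S. (1/2::real) ^ nat \<bar>n s\<bar>)"
  proof (rule sum_mono)
    fix n assume n: "n \<in> ?G"
    have "(\<Sum>s\<in>S. nat \<bar>n s\<bar>) \<le> M"
    proof -
      have "int (\<Sum>s\<in>S. nat \<bar>n s\<bar>) = (\<Sum>s\<in>S. \<bar>n s\<bar>)" by simp
      then have "int (\<Sum>s\<in>S. nat \<bar>n s\<bar>) \<le> int M" using n by simp
      then show ?thesis by (simp only: of_nat_le_iff)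
    qed
    then have "(1/2::real) ^ M \<le> (1/2) ^ (\<Sum>s\<in>S. nat \<bar>n s\<bar>)" by (intro power_decreasing) auto
    then show "(1/2::real) ^ M \<le> (\<Prod>s\<in>S. (1/2::real) ^ nat \<bar>n s\<bar>)" by (simp add: power_sum)
  qed
  also have "\<dots> \<le> (\<Sum>n\<in>?P. \<Prod>s\<in>S. (1/2::real) ^ nat \<bar>n s\<bar>)"
    using finP by (intro sum_mono2) (auto intro: prod_nonneg)
  also have "\<dots> = (\<Prod>s\<in>S. \<Sum>z\<in>{-int M..int M}. (1/2::real) ^ nat \<bar>z\<bar>)"
    using assms by (subst prod_sum_PiE) auto
  also have "\<dots> \<le> (\<Prod>s\<in>S. 3)"
    using sum_half_powers_le_3[of M] by (intro prod_mono) (auto intro: sum_nonneg)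
  finally have "real (card ?G) \<le> 2 ^ M * 3 ^ card S" by (simp add: field_simps)
  then have "real (card ?G) \<le> real (2 ^ M * 3 ^ card S)" by simp
  then show ?thesis by (simp only: of_nat_le_iff)
qed

lemma pigeonhole_fibre:
  assumes "finite X" "finite Y" "f ` X \<subseteq> Y" "card Y \<le> K"
  shows "\<exists>y. card X \<le> K * card {x \<in> X. f x = y}"
proof (rule ccontr)
  assume *: "\<not> ?thesis"
  show False
  proof (cases "X = {}")
    case False
    have "card X = (\<Sum>y\<in>Y. card {x \<in> X. f x = y})"
      using assms card_image_le by (subst card_eq_sum, subst sum.group[symmetric, of X Y f]) auto
    then have "K * card X = (\<Sum>y\<in>Y. K * card {x \<in> X. f x = y})" by (simp add: sum_distrib_left)
    also have "\<dots> < (\<Sum>y\<in>Y. card X)"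
      using * assms False by (intro sum_strict_mono) (auto simp: not_le)
    also have "\<dots> \<le> K * card X" using assms(4) by simp
    finally show False by simp
  qed (use * in auto)
qed

text \<open>
  One step of descent from the form \<open>b'\<close> to the smaller form \<open>b\<close>, which is
  smaller by the factor \<open>M\<^sup>2\<close> where the functionals vanish. The
  \<open>b'\<close>-orthogonal projection onto the at most \<open>m\<close> directions detecting the
  functionals is the only part of a difference that need not shrink. Its coordinates form a vector
  in a ball, and rounding them to a suitable mesh \<open>\<epsilon>\<close> distributes
  \<open>X\<close> over at most \<open>K^m\<close> classes, where \<open>K\<close> depends on
  \<open>M\<close> alone: since the sum of the squares is bounded, the sum of the absolute values of
  the rounded coordinates is linear in the number of coordinates. Two elements of one class have
  almost the same projection.
\<close>

lemma entropy_step: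
  fixes b b' :: "'a::real_vector \<Rightarrow> 'a \<Rightarrow> real"
  assumes bil: "bilinear b" and bil': "bilinear b'" and sym: "\<And>f g. b f g = b g f"
    and sym': "\<And>f g. b' f g = b' g f"
    and nn: "\<And>f. b f f \<ge> 0" and le: "\<And>f. b f f \<le> b' f f"
    and fin: "finite F" and pos: "\<And>f. f \<in> span F \<Longrightarrow> f \<noteq> 0 \<Longrightarrow> b' f f > 0"
    and L: "finite L" "card L \<le> m" "\<And>l. l \<in> L \<Longrightarrow> linear l"
    and M: "M > 0" and contr: "\<And>f. f \<in> span F \<Longrightarrow> (\<forall>l\<in>L. l f = (0::real)) \<Longrightarrow> b f f \<le> b' f f / (real M)\<^sup>2"
    and X: "finite X" "X \<subseteq> span F" "\<And>x y. x \<in> X \<Longrightarrow> y \<in> X \<Longrightarrow> b' (x - y) (x - y) \<le> \<rho>"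
  shows "\<exists>X'\<subseteq>X. card X \<le> (3 * 2 ^ (M + 1)) ^ m * card X' \<and>
            (\<forall>x\<in>X'. \<forall>y\<in>X'. b (x - y) (x - y) \<le> 4 * \<rho> / (real M)\<^sup>2)"
proof (cases "X = {}")
  case True then show ?thesis by auto
next
  case False
  then obtain x0 where x0: "x0 \<in> X" by blast
  have lin: "linear (b x)" "linear (\<lambda>x. b x y)" "linear (b' x)" "linear (\<lambda>x. b' x y)" for x y
    using bil bil' by (auto simp: bilinear_def)
  have \<rho>0: "\<rho> \<ge> 0" using X(3)[OF x0 x0] by (simp add: linear_0[OF lin(3)])
  obtain U where U: "finite U" "card U \<le> card L" "U \<subseteq> span F"
    and on: "\<And>e e'. e \<in> U \<Longrightarrow> e' \<in> U \<Longrightarrow> b' e e' = (if e = e' then 1 else 0)"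
    and det: "\<And>f. f \<in> span F \<Longrightarrow> (\<forall>e\<in>U. b' f e = 0) \<Longrightarrow> (\<forall>l\<in>L. l f = 0)"
    using orthonormal_detecting_functionals[OF bil' sym' fin pos L(1,3)] by (metis (lifting))
  have Um: "card U \<le> m" using U(2) L(2) by linarith
  define proj where "proj f = (\<Sum>e\<in>U. b' f e *\<^sub>R e)" for f
  have projs: "proj f \<in> span F" for f
    unfolding proj_def using U(3) by (intro span_sum span_scale) auto
  have be: "b' (proj f) e = b' f e" if "e \<in> U" for f e
  proof -
    have "b' (proj f) e = (\<Sum>e'\<in>U. b' f e' * b' e' e)"
      unfolding proj_def by (simp add: linear_sum[OF lin(4)] linear_scale[OF lin(4)])
    also have "\<dots> = (\<Sum>e'\<in>U. if e' = e then b' f e' else 0)"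
      using on that by (intro sum.cong) auto
    finally show ?thesis using that U(1) by simp
  qed
  have bproj: "b' (proj f) (proj f) = (\<Sum>e\<in>U. (b' f e)\<^sup>2)" for f
  proof -
    have "b' (proj f) (proj f) = (\<Sum>e\<in>U. b' f e * b' (proj f) e)"
      by (subst (2) proj_def) (simp add: linear_sum[OF lin(3)] linear_scale[OF lin(3)])
    then show ?thesis by (simp add: be power2_eq_square)
  qed
  have orth: "b' (f - proj f) e = 0" if "e \<in> U" for f e
    using be[OF that] by (simp add: linear_diff[OF lin(4)])
  have split: "b' f f = b' (f - proj f) (f - proj f) + b' (proj f) (proj f)" for f
  proof -
    have 0: "b' (f - proj f) (proj f) = 0"
      by (subst (2) proj_def) (simp add: linear_sum[OF lin(3)] linear_scale[OF lin(3)] orth)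
    have "b' f f = b' ((f - proj f) + proj f) ((f - proj f) + proj f)" by simp
    also have "\<dots> = b' (f - proj f) (f - proj f) + b' (proj f) (proj f) + 2 * b' (f - proj f) (proj f)"
      using sym'[of "proj f" "f - proj f"] by (simp only: linear_add[OF lin(3)] linear_add[OF lin(4)])
    finally show ?thesis using 0 by simp
  qed
  have nn': "b' f f \<ge> 0" for f using nn[of f] le[of f] by linarith
  have two: "b (f + g) (f + g) \<le> 2 * b f f + 2 * b g g" for f g
  proof -
    have "0 \<le> b (f - g) (f - g)" by (rule nn)
    then show ?thesis
      using sym[of f g] by (simp add: linear_add[OF lin(1)] linear_add[OF lin(2)] linear_diff[OF lin(1)] linear_diff[OF lin(2)])
  qed
  have small: "b f f \<le> 2 * b' f f / (real M)\<^sup>2 + 2 * (\<Sum>e\<in>U. (b' f e)\<^sup>2)" if f: "f \<in> span F" for f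
  proof -
    have "f - proj f \<in> span F" using f projs by (rule span_diff)
    then have "b (f - proj f) (f - proj f) \<le> b' (f - proj f) (f - proj f) / (real M)\<^sup>2"
      using contr det orth by blast
    also have "\<dots> \<le> b' f f / (real M)\<^sup>2"
      using split[of f] nn'[of "proj f"] by (intro divide_right_mono) auto
    finally have "b (f - proj f) (f - proj f) \<le> b' f f / (real M)\<^sup>2" .
    moreover have "b (proj f) (proj f) \<le> (\<Sum>e\<in>U. (b' f e)\<^sup>2)" using le bproj by metis
    moreover have "b f f \<le> 2 * b (f - proj f) (f - proj f) + 2 * b (proj f) (proj f)"
      using two[of "f - proj f" "proj f"] by simp
    ultimately show ?thesis by linarith
  qed
  show ?thesis
  proof (cases "\<rho> = 0 \<or> U = {}")
    case True
    have "b (x - y) (x - y) \<le> 4 * \<rho> / (real M)\<^sup>2" if "x \<in> X" "y \<in> X" for x y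
    proof (cases "\<rho> = 0")
      case True
      then show ?thesis using le[of "x - y"] X(3)[OF that] by simp
    next
      case False
      have "b (x - y) (x - y) \<le> 2 * b' (x - y) (x - y) / (real M)\<^sup>2"
        using small[of "x - y"] that X(2) False True by (auto intro: span_diff)
      also have "\<dots> \<le> 2 * \<rho> / (real M)\<^sup>2" using X(3)[OF that] by (intro divide_right_mono) auto
      also have "\<dots> \<le> 4 * \<rho> / (real M)\<^sup>2" using \<rho>0 by (intro divide_right_mono) auto
      finally show ?thesis .
    qed
    moreover have "card X \<le> (3 * 2 ^ (M + 1)) ^ m * card X"
      using one_le_power[of "3 * 2 ^ (M + 1)" m] by simp
    ultimately show ?thesis by (intro exI[of _ X]) auto
  next
    case False
    then have \<rho>pos: "\<rho> > 0" and Une: "U \<noteq> {}" using \<rho>0 by auto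
    define u where "u = card U"
    have upos: "u > 0" using Une U(1) by (simp add: u_def card_gt_0_iff)
    \<comment> \<open>a coordinatewise error of \<open>\<epsilon>\<close> in \<open>u\<close> coordinates adds up to \<open>\<rho> / M\<^sup>2\<close>, the size to which the rest shrinks\<close>
    define \<epsilon> where "\<epsilon> = sqrt (\<rho> / u) / M"
    have \<epsilon>pos: "\<epsilon> > 0" using \<rho>pos upos M by (simp add: \<epsilon>_def)
    have \<epsilon>2: "\<epsilon>\<^sup>2 * u = \<rho> / (real M)\<^sup>2" using \<rho>pos upos M by (simp add: \<epsilon>_def power_divide)
    define N where "N = u * (M + 1)"
    define key where "key x = restrict (\<lambda>e. \<lfloor>b' (x - x0) e / \<epsilon>\<rfloor>) U" for x
    define Y where "Y = {n \<in> U \<rightarrow>\<^sub>E {-int N..int N}. (\<Sum>s\<in>U. \<bar>n s\<bar>) \<le> int N}"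
    have keyY: "key x \<in> Y" if x: "x \<in> X" for x
    proof -
      have s: "(\<Sum>e\<in>U. (b' (x - x0) e)\<^sup>2) \<le> \<rho>"
        using X(3)[OF x x0] split[of "x - x0"] nn'[of "(x - x0) - proj (x - x0)"] bproj[of "x - x0"] by linarith
      have "(\<Sum>e\<in>U. \<bar>b' (x - x0) e\<bar>) \<le> sqrt (u * \<rho>)"
      proof -
        have "(\<Sum>e\<in>U. \<bar>b' (x - x0) e\<bar> * 1)\<^sup>2 \<le> (\<Sum>e\<in>U. \<bar>b' (x - x0) e\<bar>\<^sup>2) * (\<Sum>e\<in>U. 1\<^sup>2)"
          by (rule Cauchy_Schwarz_ineq_sum)
        also have "\<dots> \<le> u * \<rho>"
          using s mult_left_mono[OF s, of u] by (simp add: u_def mult.commute)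
        finally show ?thesis by (simp add: real_le_rsqrt)
      qed
      also have "sqrt (u * \<rho>) = \<epsilon> * (u * M)"
        using \<rho>pos upos M by (simp add: \<epsilon>_def real_sqrt_mult real_sqrt_divide field_simps)
      finally have s1: "(\<Sum>e\<in>U. \<bar>b' (x - x0) e\<bar> / \<epsilon>) \<le> u * M"
        using \<epsilon>pos by (simp add: sum_divide_distrib[symmetric] field_simps)
      have "real_of_int (\<Sum>e\<in>U. \<bar>key x e\<bar>) = (\<Sum>e\<in>U. real_of_int \<bar>\<lfloor>b' (x - x0) e / \<epsilon>\<rfloor>\<bar>)"
        by (simp add: key_def)
      also have "\<dots> \<le> (\<Sum>e\<in>U. \<bar>b' (x - x0) e\<bar> / \<epsilon> + 1)"
      proof (rule sum_mono)
        fix e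
        have "real_of_int \<bar>\<lfloor>y\<rfloor>\<bar> \<le> \<bar>y\<bar> + 1" for y :: real by linarith
        from this[of "b' (x - x0) e / \<epsilon>"]
        show "real_of_int \<bar>\<lfloor>b' (x - x0) e / \<epsilon>\<rfloor>\<bar> \<le> \<bar>b' (x - x0) e\<bar> / \<epsilon> + 1" using \<epsilon>pos by simp
      qed
      also have "\<dots> \<le> real_of_int (int N)" using s1 by (simp add: sum.distrib N_def u_def algebra_simps)
      finally have sN: "(\<Sum>e\<in>U. \<bar>key x e\<bar>) \<le> int N" by (simp only: of_int_le_iff)
      have "\<bar>key x e\<bar> \<le> int N" if "e \<in> U" for e
        using member_le_sum[of e U "\<lambda>e. \<bar>key x e\<bar>"] that U(1) sN by simp
      then show ?thesis using sN by (auto simp: Y_def key_def abs_le_iff minus_le_iff)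
    qed
    have finY: "finite Y" unfolding Y_def using U(1) by (intro finite_subset[OF _ finite_PiE[of U "\<lambda>_. {-int N..int N}"]]) auto
    have "card Y \<le> 2 ^ N * 3 ^ u" unfolding Y_def u_def by (rule card_integer_vectors_le[OF U(1)])
    also have "\<dots> = (3 * 2 ^ (M + 1)) ^ u" by (simp only: N_def power_mult_distrib power_mult[symmetric] mult.commute)
    also have "\<dots> \<le> (3 * 2 ^ (M + 1)) ^ m" using Um by (intro power_increasing) (auto simp: u_def)
    finally obtain y where y: "card X \<le> (3 * 2 ^ (M + 1)) ^ m * card {x \<in> X. key x = y}"
      using pigeonhole_fibre[OF X(1) finY] keyY by blast
    have "b (x - z) (x - z) \<le> 4 * \<rho> / (real M)\<^sup>2" if "x \<in> X" "z \<in> X" "key x = key z" for x z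
    proof -
      have "(b' (x - z) e)\<^sup>2 \<le> \<epsilon>\<^sup>2" if e: "e \<in> U" for e
      proof -
        have "\<lfloor>b' (x - x0) e / \<epsilon>\<rfloor> = \<lfloor>b' (z - x0) e / \<epsilon>\<rfloor>"
          using fun_cong[OF \<open>key x = key z\<close>, of e] e by (simp add: key_def)
        then have "\<bar>b' (x - x0) e / \<epsilon> - b' (z - x0) e / \<epsilon>\<bar> \<le> 1" by linarith
        then have "\<bar>b' (x - x0) e - b' (z - x0) e\<bar> \<le> \<epsilon>"
          using \<epsilon>pos by (simp add: diff_divide_distrib[symmetric])
        moreover have "b' (x - z) e = b' (x - x0) e - b' (z - x0) e"
          by (simp add: linear_diff[OF lin(4)])
        ultimately show ?thesis using \<epsilon>pos by (metis abs_le_square_iff abs_of_pos)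
      qed
      then have "(\<Sum>e\<in>U. (b' (x - z) e)\<^sup>2) \<le> (\<Sum>e\<in>U. \<epsilon>\<^sup>2)" by (intro sum_mono)
      also have "\<dots> = \<rho> / (real M)\<^sup>2" using \<epsilon>2 by (simp add: u_def mult.commute)
      finally have 1: "(\<Sum>e\<in>U. (b' (x - z) e)\<^sup>2) \<le> \<rho> / (real M)\<^sup>2" .
      have "2 * b' (x - z) (x - z) / (real M)\<^sup>2 \<le> 2 * \<rho> / (real M)\<^sup>2"
        using X(3)[OF that(1,2)] by (intro divide_right_mono) auto
      moreover have "x - z \<in> span F" using that X(2) by (auto intro: span_diff)
      ultimately have "b (x - z) (x - z) \<le> 2 * \<rho> / (real M)\<^sup>2 + 2 * (\<rho> / (real M)\<^sup>2)"
        using 1 small[of "x - z"] by linarith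
      then show ?thesis by simp
    qed
    then show ?thesis using y by (intro exI[of _ "{x \<in> X. key x = y}"]) auto
  qed
qed

section \<open>Graphs that look like the square lattice\<close>

definition sup_norm :: "int \<times> int \<Rightarrow> int" where
  "sup_norm p = max \<bar>fst p\<bar> \<bar>snd p\<bar>"

lemma sup_norm_nonneg [simp]: "0 \<le> sup_norm p"
  by (simp add: sup_norm_def)

lemma sup_norm_zero [simp]: "sup_norm 0 = 0"
  by (simp add: sup_norm_def)

lemma sup_norm_triangle: "sup_norm (p - r) \<le> sup_norm (p - q) + sup_norm (q - r)"
proof -
  have "\<bar>fst (p - r)\<bar> \<le> \<bar>fst (p - q)\<bar> + \<bar>fst (q - r)\<bar>" "\<bar>snd (p - r)\<bar> \<le> \<bar>snd (p - q)\<bar> + \<bar>snd (q - r)\<bar>"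
    unfolding fst_diff snd_diff by linarith+
  then show ?thesis unfolding sup_norm_def
    by (intro max.boundedI) (meson add_mono max.cobounded1 max.cobounded2 order_trans)+
qed

lemma sup_norm_diff_le: "sup_norm p \<le> sup_norm (p - q) + sup_norm q"
  using sup_norm_triangle[of p 0 q] by simp

lemma sup_norm_commute: "sup_norm (p - q) = sup_norm (q - p)"
  by (simp add: sup_norm_def abs_minus_commute)

lemma sup_norm_le_iff: "sup_norm p \<le> R \<longleftrightarrow> fst p \<in> {-R..R} \<and> snd p \<in> {-R..R}"
  by (auto simp: sup_norm_def)

lemma box_eq: "{p. sup_norm (p - z) \<le> R} = {fst z - R..fst z + R} \<times> {snd z - R..snd z + R}"
  by (auto simp: sup_norm_le_iff)

lemma finite_box [simp]: "finite {p. sup_norm (p - z) \<le> R}"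
  unfolding box_eq by simp

lemma card_box: "R \<ge> 0 \<Longrightarrow> card {p. sup_norm (p - z) \<le> R} = (2 * nat R + 1)\<^sup>2"
proof -
  assume R: "R \<ge> 0"
  have "card {a - R..a + R} = 2 * nat R + 1" for a using R by auto
  then show ?thesis unfolding box_eq by (simp only: card_cartesian_product power2_eq_square)
qed

definition graph_laplacian :: "('v \<times> 'v) set \<Rightarrow> ('v \<Rightarrow> real) \<Rightarrow> 'v \<Rightarrow> real" where
  "graph_laplacian E f x = (\<Sum>y | (x, y) \<in> E. f y - f x)"

text \<open>
  The vertices are distributed over the cells of a square grid, indexed by pairs of integers, in
  such a way that the graph and the grid are quasi-isometric, with constants \<open>P\<close> and
  \<open>M\<close>.
\<close>

locale rough_lattice =
  fixes E :: "('v \<times> 'v) set" and cell :: "'v \<Rightarrow> int \<times> int" and P M :: nat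
  assumes sym_E: "(x, y) \<in> E \<Longrightarrow> (y, x) \<in> E"
    and cell_adj: "(x, y) \<in> E \<Longrightarrow> sup_norm (cell x - cell y) \<le> 1"
    and finite_fibre: "finite {x. cell x = p}"
    and card_fibre: "card {x. cell x = p} \<le> P"
    and fibre_nonempty: "\<exists>x. cell x = p"
    and short_path: "sup_norm (cell x - cell y) \<le> 1 \<Longrightarrow> \<exists>n\<le>M. (x, y) \<in> E ^^ n"
begin

abbreviation lap :: "('v \<Rightarrow> real) \<Rightarrow> 'v \<Rightarrow> real" where "lap \<equiv> graph_laplacian E"

abbreviation rad :: "'v \<Rightarrow> real" where "rad x \<equiv> real_of_int (sup_norm (cell x))"

definition cell_box :: "int \<times> int \<Rightarrow> int \<Rightarrow> 'v set" where
  "cell_box z R = {x. sup_norm (cell x - z) \<le> R}"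

definition grad2 :: "('v \<Rightarrow> real) \<Rightarrow> 'v \<Rightarrow> real" where
  "grad2 f x = (\<Sum>y | (x, y) \<in> E. (f y - f x)\<^sup>2)"

abbreviation deg :: nat where "deg \<equiv> 9 * P"

lemma box_UN: "cell_box z R = (\<Union>p\<in>{p. sup_norm (p - z) \<le> R}. {x. cell x = p})"
  by (auto simp: cell_box_def)

lemma finite_box_vertices [simp]: "finite (cell_box z R)"
  unfolding box_UN using finite_fibre by auto

lemma card_box_vertices: "R \<ge> 0 \<Longrightarrow> card (cell_box z R) \<le> P * (2 * nat R + 1)\<^sup>2"
proof -
  assume R: "R \<ge> 0"
  have "card (cell_box z R) \<le> (\<Sum>p\<in>{p. sup_norm (p - z) \<le> R}. card {x. cell x = p})"
    unfolding box_UN by (rule card_UN_le) simp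
  also have "\<dots> \<le> (\<Sum>p\<in>{p. sup_norm (p - z) \<le> R}. P)" by (intro sum_mono card_fibre)
  finally show ?thesis using R by (simp add: card_box mult.commute)
qed

lemma nbrs_subset: "{y. (x, y) \<in> E} \<subseteq> cell_box (cell x) 1"
  using cell_adj by (auto simp: cell_box_def sup_norm_commute[of _ "cell x"])

lemma finite_nbrs [simp]: "finite {y. (x, y) \<in> E}"
  by (rule finite_subset[OF nbrs_subset]) simp

lemma card_nbrs: "card {y. (x, y) \<in> E} \<le> deg"
  using card_mono[OF _ nbrs_subset[of x]] card_box_vertices[of 1 "cell x"] by simp

lemma grad2_nonneg [simp]: "0 \<le> grad2 f x"
  unfolding grad2_def by (intro sum_nonneg) auto

text \<open>
  The Laplacian is a bounded operator, so the second derivatives that occur in the continuous theory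
  can always be replaced by gradients, and one type of energy estimate is enough for the heat
  equation.
\<close>

lemma lap_sq_le: "(lap f x)\<^sup>2 \<le> deg * grad2 f x"
proof -
  have "(\<Sum>y | (x, y) \<in> E. (f y - f x) * 1)\<^sup>2 \<le> (\<Sum>y | (x, y) \<in> E. (f y - f x)\<^sup>2) * (\<Sum>y | (x, y) \<in> E. 1\<^sup>2)"
    by (rule Cauchy_Schwarz_ineq_sum)
  then have "(lap f x)\<^sup>2 \<le> grad2 f x * card {y. (x, y) \<in> E}"
    by (simp add: graph_laplacian_def grad2_def)
  also have "\<dots> \<le> grad2 f x * deg" using card_nbrs[of x] by (intro mult_left_mono) (simp_all only: of_nat_le_iff grad2_nonneg)
  finally show ?thesis by (simp add: mult.commute)
qed

lemma lap_add: "lap (\<lambda>x. f x + g x) x = lap f x + lap g x"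
  unfolding graph_laplacian_def by (simp add: sum.distrib[symmetric] algebra_simps)

lemma lap_scale: "lap (\<lambda>x. a * f x) x = a * lap f x"
  unfolding graph_laplacian_def by (simp add: sum_distrib_left algebra_simps)

text \<open>
  Summation by parts over \<open>S\<close> then has no boundary terms.
\<close>

definition interior_support :: "('v \<Rightarrow> real) \<Rightarrow> 'v set \<Rightarrow> bool" where
  "interior_support \<phi> S \<longleftrightarrow> (\<forall>x. \<phi> x \<noteq> 0 \<longrightarrow> x \<in> S \<and> {y. (x, y) \<in> E} \<subseteq> S)"

text \<open>
  The inequality behind both Caccioppoli estimates. For harmonic \<open>f\<close> the left-hand side
  is zero; for a solution of the heat equation it is the derivative of \<open>\<Sum> (\<phi>
  f)\<^sup>2\<close>. Summed over both orientations of an edge, the difference of the two sides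
  becomes minus a sum of two squares.
\<close>

lemma weighted_energy_inequality:
  assumes S: "finite S" and \<phi>: "interior_support \<phi> S"
  shows "(\<Sum>x\<in>S. (\<phi> x)\<^sup>2 * (2 * f x * lap f x)) \<le>
     - (1/2) * (\<Sum>x\<in>S. (\<phi> x)\<^sup>2 * grad2 f x) + 2 * (\<Sum>x\<in>S. (f x)\<^sup>2 * grad2 \<phi> x)"
proof -
  define ES where "ES = Sigma S (\<lambda>x. {y \<in> S. (x, y) \<in> E})"
  have finES: "finite ES" unfolding ES_def using S by auto
  have toES: "(\<Sum>x\<in>S. (\<phi> x)\<^sup>2 * (\<Sum>y | (x, y) \<in> E. h x y)) = (\<Sum>(x, y)\<in>ES. (\<phi> x)\<^sup>2 * h x y)" for h
  proof -
    have "(\<phi> x)\<^sup>2 * (\<Sum>y | (x, y) \<in> E. h x y) = (\<Sum>y\<in>{y \<in> S. (x, y) \<in> E}. (\<phi> x)\<^sup>2 * h x y)" for x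
    proof (cases "\<phi> x = 0")
      case False
      then have "{y. (x, y) \<in> E} = {y \<in> S. (x, y) \<in> E}" using \<phi> by (auto simp: interior_support_def)
      then show ?thesis by (simp add: sum_distrib_left)
    qed simp
    then show ?thesis unfolding ES_def using S by (simp add: sum.Sigma)
  qed
  have swap: "(\<Sum>(x, y)\<in>ES. h x y) = (\<Sum>(x, y)\<in>ES. h y x)" for h :: "'v \<Rightarrow> 'v \<Rightarrow> real"
    by (rule sum.reindex_bij_witness[of _ prod.swap prod.swap]) (auto simp: ES_def sym_E)
  define h where "h x y = (\<phi> x)\<^sup>2 * (2 * f x * (f y - f x)) + (1/2) * ((\<phi> x)\<^sup>2 * (f y - f x)\<^sup>2) - 2 * ((f x)\<^sup>2 * (\<phi> y - \<phi> x)\<^sup>2)" for x y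
  have hh: "h x y + h y x \<le> 0" for x y
  proof -
    have "h x y + h y x = - (((\<phi> x + \<phi> y) * (f y - f x) / 2 + (\<phi> y - \<phi> x) * (f x + f y))\<^sup>2 + 5/4 * ((\<phi> y - \<phi> x) * (f y - f x))\<^sup>2)"
      unfolding h_def by (simp add: field_simps power2_eq_square)
    then show ?thesis using zero_le_power2[of "(\<phi> x + \<phi> y) * (f y - f x) / 2 + (\<phi> y - \<phi> x) * (f x + f y)"]
        zero_le_power2[of "(\<phi> y - \<phi> x) * (f y - f x)"] by linarith
  qed
  have "2 * (\<Sum>(x, y)\<in>ES. h x y) = (\<Sum>(x, y)\<in>ES. h x y + h y x)"
    using swap[of h] by (simp add: sum.distrib case_prod_unfold)
  also have "\<dots> \<le> 0" using hh by (intro sum_nonpos) auto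
  finally have 1: "(\<Sum>(x, y)\<in>ES. h x y) \<le> 0" by simp
  have 2: "(\<Sum>(x, y)\<in>ES. h x y) = (\<Sum>x\<in>S. (\<phi> x)\<^sup>2 * (2 * f x * lap f x)) + (1/2) * (\<Sum>x\<in>S. (\<phi> x)\<^sup>2 * grad2 f x)
      - 2 * (\<Sum>(x, y)\<in>ES. (f x)\<^sup>2 * (\<phi> y - \<phi> x)\<^sup>2)"
  proof -
    have a: "(\<Sum>x\<in>S. (\<phi> x)\<^sup>2 * (2 * f x * lap f x)) = (\<Sum>(x, y)\<in>ES. (\<phi> x)\<^sup>2 * (2 * f x * (f y - f x)))"
      by (simp add: toES[symmetric] graph_laplacian_def sum_distrib_left)
    have b: "(\<Sum>x\<in>S. (\<phi> x)\<^sup>2 * grad2 f x) = (\<Sum>(x, y)\<in>ES. (\<phi> x)\<^sup>2 * (f y - f x)\<^sup>2)"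
      by (simp add: toES[symmetric] grad2_def)
    show ?thesis unfolding a b h_def
      by (simp add: sum.distrib sum_subtractf sum_distrib_left case_prod_unfold)
  qed
  have 3: "(\<Sum>(x, y)\<in>ES. (f x)\<^sup>2 * (\<phi> y - \<phi> x)\<^sup>2) \<le> (\<Sum>x\<in>S. (f x)\<^sup>2 * grad2 \<phi> x)"
  proof -
    have "(\<Sum>(x, y)\<in>ES. (f x)\<^sup>2 * (\<phi> y - \<phi> x)\<^sup>2) = (\<Sum>x\<in>S. \<Sum>y\<in>{y \<in> S. (x, y) \<in> E}. (f x)\<^sup>2 * (\<phi> y - \<phi> x)\<^sup>2)"
      unfolding ES_def using S by (simp add: sum.Sigma)
    also have "\<dots> \<le> (\<Sum>x\<in>S. \<Sum>y | (x, y) \<in> E. (f x)\<^sup>2 * (\<phi> y - \<phi> x)\<^sup>2)"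
      by (intro sum_mono sum_mono2) auto
    finally show ?thesis by (simp add: grad2_def sum_distrib_left)
  qed
  show ?thesis using 1 2 3 by linarith
qed

definition cutoff :: "int \<times> int \<Rightarrow> int \<Rightarrow> int \<Rightarrow> 'v \<Rightarrow> real" where
  "cutoff z R W x = max 0 (min 1 (real_of_int (R + W - sup_norm (cell x - z)) / real_of_int W))"

lemma cutoff_range: "0 \<le> cutoff z R W x" "cutoff z R W x \<le> 1"
  by (auto simp: cutoff_def)

lemma cutoff_one: "W > 0 \<Longrightarrow> x \<in> cell_box z R \<Longrightarrow> cutoff z R W x = 1"
  by (auto simp: cutoff_def cell_box_def field_simps)

lemma cutoff_zero: "W > 0 \<Longrightarrow> sup_norm (cell x - z) \<ge> R + W \<Longrightarrow> cutoff z R W x = 0"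
  by (auto simp: cutoff_def field_simps max_def min_def)

lemma cell_adj_norm: "(x, y) \<in> E \<Longrightarrow> \<bar>sup_norm (cell y - z) - sup_norm (cell x - z)\<bar> \<le> 1"
  using cell_adj[of x y] sup_norm_triangle[of "cell x" z "cell y"] sup_norm_triangle[of "cell y" z "cell x"]
    sup_norm_commute[of "cell x" "cell y"] by linarith

lemma cutoff_lipschitz:
  assumes "W > 0" "(x, y) \<in> E"
  shows "\<bar>cutoff z R W y - cutoff z R W x\<bar> \<le> 1 / real_of_int W"
proof -
  let ?a = "real_of_int (R + W - sup_norm (cell x - z)) / real_of_int W"
  let ?b = "real_of_int (R + W - sup_norm (cell y - z)) / real_of_int W"
  have "?b - ?a = real_of_int (sup_norm (cell x - z) - sup_norm (cell y - z)) / real_of_int W"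
    by (simp add: diff_divide_distrib)
  then have "\<bar>?b - ?a\<bar> = \<bar>real_of_int (sup_norm (cell x - z) - sup_norm (cell y - z))\<bar> / real_of_int W"
    using assms(1) by simp
  also have "\<dots> \<le> 1 / real_of_int W"
    using cell_adj_norm[OF assms(2), of z] assms(1) by (intro divide_right_mono) linarith+
  finally show ?thesis unfolding cutoff_def by linarith
qed

lemma grad2_cutoff_le: "W > 0 \<Longrightarrow> grad2 (cutoff z R W) x \<le> deg / (real_of_int W)\<^sup>2"
proof -
  assume W: "W > 0"
  have "grad2 (cutoff z R W) x \<le> (\<Sum>y | (x, y) \<in> E. (1 / real_of_int W)\<^sup>2)"
    unfolding grad2_def
  proof (intro sum_mono)
    fix y assume "y \<in> {y. (x, y) \<in> E}"
    then have "\<bar>cutoff z R W y - cutoff z R W x\<bar> \<le> 1 / real_of_int W" using cutoff_lipschitz W by simp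
    then show "(cutoff z R W y - cutoff z R W x)\<^sup>2 \<le> (1 / real_of_int W)\<^sup>2"
      using W by (metis abs_le_square_iff abs_of_nonneg zero_le_divide_1_iff of_int_0_le_iff less_imp_le)
  qed
  also have "\<dots> = card {y. (x, y) \<in> E} / (real_of_int W)\<^sup>2" by (simp add: power_divide)
  also have "\<dots> \<le> deg / (real_of_int W)\<^sup>2"
    using card_nbrs[of x] by (intro divide_right_mono) (simp_all only: of_nat_le_iff zero_le_power2)
  finally show ?thesis .
qed

lemma grad2_cutoff_zero:
  assumes W: "W > 0" and "sup_norm (cell x - z) < R \<or> sup_norm (cell x - z) > R + W"
  shows "grad2 (cutoff z R W) x = 0"
  unfolding grad2_def
proof (rule sum.neutral, rule ballI)
  fix y assume "y \<in> {y. (x, y) \<in> E}"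
  then have "\<bar>sup_norm (cell y - z) - sup_norm (cell x - z)\<bar> \<le> 1" using cell_adj_norm by simp
  then have "(x \<in> cell_box z R \<and> y \<in> cell_box z R) \<or> (sup_norm (cell x - z) \<ge> R + W \<and> sup_norm (cell y - z) \<ge> R + W)"
    using assms(2) unfolding cell_box_def mem_Collect_eq by linarith
  then show "(cutoff z R W y - cutoff z R W x)\<^sup>2 = 0"
    using cutoff_one[OF W, of x z R] cutoff_one[OF W, of y z R]
      cutoff_zero[OF W, of R x z] cutoff_zero[OF W, of R y z] by auto
qed

lemma interior_support_cutoff:
  assumes "W > 0" "R + W \<le> R'"
  shows "interior_support (cutoff z R W) (cell_box z R')"
  unfolding interior_support_def
proof (intro allI impI)
  fix x assume "cutoff z R W x \<noteq> 0"
  then have 1: "sup_norm (cell x - z) < R + W" using cutoff_zero[OF assms(1), of R x z] by (meson not_le)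
  have "y \<in> cell_box z R'" if "(x, y) \<in> E" for y
    using cell_adj_norm[OF that, of z] 1 assms(2) unfolding cell_box_def mem_Collect_eq by linarith
  then show "x \<in> cell_box z R' \<and> {y. (x, y) \<in> E} \<subseteq> cell_box z R'" using 1 assms(2) by (auto simp: cell_box_def)
qed

section \<open>Ancient solutions of polynomial growth\<close>

definition heat :: "('v \<Rightarrow> real \<Rightarrow> real) \<Rightarrow> bool" where
  "heat u \<longleftrightarrow> (\<forall>x. \<forall>t\<le>0. (u x has_real_derivative lap (\<lambda>y. u y t) x) (at t within {..0}))"

definition Lap :: "('v \<Rightarrow> real \<Rightarrow> real) \<Rightarrow> 'v \<Rightarrow> real \<Rightarrow> real" where
  "Lap u x t = lap (\<lambda>y. u y t) x"

lemma heat_Lap: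
  assumes "heat u" shows "heat (Lap u)"
  unfolding heat_def
proof (intro allI impI)
  fix x and t :: real assume t: "t \<le> 0"
  have d: "(u y has_real_derivative Lap u y t) (at t within {..0})" for y
    using assms t by (simp add: heat_def Lap_def)
  have "((\<lambda>t. \<Sum>y | (x, y) \<in> E. u y t - u x t) has_real_derivative (\<Sum>y | (x, y) \<in> E. Lap u y t - Lap u x t)) (at t within {..0})"
    by (intro DERIV_sum DERIV_diff d)
  then show "(Lap u x has_real_derivative lap (\<lambda>y. Lap u y t) x) (at t within {..0})"
    by (simp add: Lap_def[abs_def] graph_laplacian_def)
qed

lemma heat_weighted_norm_deriv:
  assumes "heat u" "t \<le> 0"
  shows "((\<lambda>t. \<Sum>x\<in>S. (\<phi> x)\<^sup>2 * (u x t)\<^sup>2) has_real_derivative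
     (\<Sum>x\<in>S. (\<phi> x)\<^sup>2 * (2 * u x t * lap (\<lambda>y. u y t) x))) (at t within {..0})"
proof -
  have d: "(u y has_real_derivative lap (\<lambda>y. u y t) y) (at t within {..0})" for y
    using assms by (simp add: heat_def)
  have "((\<lambda>t. (u x t)\<^sup>2) has_real_derivative (2 * u x t * lap (\<lambda>y. u y t) x)) (at t within {..0})" for x
    by (rule derivative_eq_intros d refl)+ simp
  then show ?thesis by (intro DERIV_sum DERIV_cmult)
qed

lemma cutoff_energy_inequality:
  assumes W: "W > 0" "R + W \<le> R'"
  shows "(\<Sum>x\<in>cell_box z R'. (cutoff z R W x)\<^sup>2 * (2 * f x * lap f x)) \<le>
     - (1/2) * (\<Sum>x\<in>cell_box z R'. (cutoff z R W x)\<^sup>2 * grad2 f x)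
     + 2 * deg / (real_of_int W)\<^sup>2 * (\<Sum>x\<in>cell_box z (R + W) - cell_box z (R - 1). (f x)\<^sup>2)"
proof -
  have "(\<Sum>x\<in>cell_box z R'. (f x)\<^sup>2 * grad2 (cutoff z R W) x) =
      (\<Sum>x\<in>cell_box z (R + W) - cell_box z (R - 1). (f x)\<^sup>2 * grad2 (cutoff z R W) x)"
    using W(2) by (intro sum.mono_neutral_right) (simp, force simp: cell_box_def, auto simp: cell_box_def intro!: grad2_cutoff_zero[OF W(1)])
  also have "\<dots> \<le> (\<Sum>x\<in>cell_box z (R + W) - cell_box z (R - 1). (f x)\<^sup>2 * (deg / (real_of_int W)\<^sup>2))"
    by (intro sum_mono mult_left_mono grad2_cutoff_le W) auto
  also have "\<dots> = deg / (real_of_int W)\<^sup>2 * (\<Sum>x\<in>cell_box z (R + W) - cell_box z (R - 1). (f x)\<^sup>2)"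
    by (simp add: sum_distrib_left mult.commute)
  finally show ?thesis
    using weighted_energy_inequality[OF finite_box_vertices interior_support_cutoff[OF W], of z f] by (simp add: mult.assoc)
qed

lemma box_mono: "R \<le> R' \<Longrightarrow> cell_box z R \<subseteq> cell_box z R'"
  by (auto simp: cell_box_def)

text \<open>
  Let \<open>v = \<Delta>u\<close> and \<open>w = \<Delta>v\<close>, and let \<open>\<tau>\<close>
  be the time elapsed since the bottom of the cylinder. The derivative of \<open>A\<^sup>2 \<Sum>
  (\<phi>0 u)\<^sup>2 + A \<tau> \<Sum> (\<phi>1 v)\<^sup>2 + \<tau>\<^sup>2 \<Sum> (\<phi>2
  w)\<^sup>2\<close> produces positive terms of two kinds: from the powers of \<open>\<tau>\<close>,
  and from the gradients of the cutoffs. Those in \<open>v\<close> and \<open>w\<close> are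
  dominated, as \<open>(\<Delta>g)\<^sup>2\<close> is by
  \<open>\<bar>\<nabla>g\<bar>\<^sup>2\<close>, by the gradient terms that the preceding summand
  dissipates, because each cutoff equals 1 wherever the next one is not constant or not zero and
  because \<open>\<tau> \<le> r\<^sup>2\<close>. Only a multiple of \<open>\<Sum> u\<^sup>2 /
  r\<^sup>2\<close> remains.
\<close>

lemma parabolic_mean_bound:
  fixes K :: real
  assumes u: "heat u" and t0: "t0 \<le> 0" and r: "(r::int) \<ge> 1"
    and bound: "\<And>y s. y \<in> cell_box (cell x0) (3 * r) \<Longrightarrow> t0 - (real_of_int r)\<^sup>2 \<le> s \<Longrightarrow> s \<le> t0 \<Longrightarrow> \<bar>u y s\<bar> \<le> K"
  shows "(Lap (Lap u) x0 t0)\<^sup>2 * (real_of_int r)\<^sup>2 \<le> (4 * (1 + deg) * deg)\<^sup>2 * (1 + 2 * deg) * (49 * P) * K\<^sup>2"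
proof -
  define z where "z = cell x0"
  define S where "S = cell_box z (3 * r)"
  define v where "v = Lap u"
  define w where "w = Lap v"
  define \<rho> where "\<rho> = real_of_int r"
  have \<rho>1: "\<rho> \<ge> 1" using r by (simp add: \<rho>_def)
  define d where "d = real deg"
  have d0: "d \<ge> 0" by (simp add: d_def)
  \<comment> \<open>chosen such that \<open>A / 2\<close> is at least \<open>(1 + 2 d) d\<close> and \<open>(2 + 2 d) d\<close>, the constants to be absorbed below\<close>
  define A where "A = 4 * (1 + d) * d"
  have A0: "A \<ge> 0" using d0 by (simp add: A_def)
  define \<phi>0 where "\<phi>0 = cutoff z (2 * r) r"
  define \<phi>1 where "\<phi>1 = cutoff z r r"
  define \<phi>2 where "\<phi>2 = cutoff z 0 r"
  have hv: "heat v" and hw: "heat w" using heat_Lap u by (auto simp: v_def w_def)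
  have r0: "r > 0" using r by simp
  define nrm where "nrm \<phi> g t = (\<Sum>x\<in>S. (\<phi> x)\<^sup>2 * (g x t)\<^sup>2)" for \<phi> and g :: "'v \<Rightarrow> real \<Rightarrow> real" and t
  define dr where "dr \<phi> g t = (\<Sum>x\<in>S. (\<phi> x)\<^sup>2 * (2 * g x t * lap (\<lambda>y. g y t) x))" for \<phi> and g :: "'v \<Rightarrow> real \<Rightarrow> real" and t
  define dir where "dir \<phi> g t = (\<Sum>x\<in>S. (\<phi> x)\<^sup>2 * grad2 (\<lambda>y. g y t) x)" for \<phi> and g :: "'v \<Rightarrow> real \<Rightarrow> real" and t
  have deriv: "(nrm \<phi> g has_real_derivative dr \<phi> g t) (at t within {..0})" if "heat g" "t \<le> 0" for \<phi> g t
    unfolding nrm_def dr_def using heat_weighted_norm_deriv[OF that] by simp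
  have dir0: "dir \<phi> g t \<ge> 0" for \<phi> g t unfolding dir_def by (intro sum_nonneg mult_nonneg_nonneg) auto
  have nrm0: "nrm \<phi> g t \<ge> 0" for \<phi> g t unfolding nrm_def by (intro sum_nonneg mult_nonneg_nonneg) auto
  have lapdir: "nrm \<phi> (Lap g) t \<le> d * dir \<phi> g t" for \<phi> g t
  proof -
    have "nrm \<phi> (Lap g) t \<le> (\<Sum>x\<in>S. (\<phi> x)\<^sup>2 * (d * grad2 (\<lambda>y. g y t) x))"
      unfolding nrm_def Lap_def d_def using lap_sq_le by (intro sum_mono mult_left_mono) auto
    then show ?thesis unfolding dir_def by (simp add: sum_distrib_left mult.left_commute)
  qed
  have step: "dr (cutoff z R r) g t \<le> - (1/2) * dir (cutoff z R r) g t + 2 * d / \<rho>\<^sup>2 * (\<Sum>x\<in>cell_box z (R + r). (g x t)\<^sup>2)"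
    if "R + r \<le> 3 * r" for R g t
  proof -
    have "(\<Sum>x\<in>cell_box z (R + r) - cell_box z (R - 1). (g x t)\<^sup>2) \<le> (\<Sum>x\<in>cell_box z (R + r). (g x t)\<^sup>2)"
      by (intro sum_mono2) auto
    then have "2 * d / \<rho>\<^sup>2 * (\<Sum>x\<in>cell_box z (R + r) - cell_box z (R - 1). (g x t)\<^sup>2) \<le> 2 * d / \<rho>\<^sup>2 * (\<Sum>x\<in>cell_box z (R + r). (g x t)\<^sup>2)"
      using d0 by (intro mult_left_mono) auto
    then show ?thesis
      using cutoff_energy_inequality[OF r0 that, of z "\<lambda>x. g x t"] unfolding dr_def dir_def d_def \<rho>_def S_def by linarith
  qed
  have inner: "(\<Sum>x\<in>cell_box z R. (g x t)\<^sup>2) \<le> nrm (cutoff z R r) g t" if "R \<le> 3 * r" for R g t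
  proof -
    have "(\<Sum>x\<in>cell_box z R. (g x t)\<^sup>2) = (\<Sum>x\<in>cell_box z R. (cutoff z R r x)\<^sup>2 * (g x t)\<^sup>2)"
      using cutoff_one[OF r0] by (intro sum.cong) auto
    also have "\<dots> \<le> nrm (cutoff z R r) g t"
      unfolding nrm_def S_def by (intro sum_mono2 box_mono that) auto
    finally show ?thesis .
  qed
  have nmono: "nrm (cutoff z R r) g t \<le> (\<Sum>x\<in>cell_box z (R + r). (g x t)\<^sup>2)" if "R + r \<le> 3 * r" for R g t
  proof -
    have "nrm (cutoff z R r) g t = (\<Sum>x\<in>cell_box z (R + r). (cutoff z R r x)\<^sup>2 * (g x t)\<^sup>2)"
      unfolding nrm_def S_def using box_mono[OF that, of z]
      by (intro sum.mono_neutral_right) (simp, simp, auto simp: cell_box_def intro!: cutoff_zero[OF r0])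
    also have "\<dots> \<le> (\<Sum>x\<in>cell_box z (R + r). 1 * (g x t)\<^sup>2)"
      using cutoff_range by (intro sum_mono mult_right_mono power_le_one) auto
    finally show ?thesis by simp
  qed
  define t1 where "t1 = t0 - \<rho>\<^sup>2"
  define F where "F t = A\<^sup>2 * nrm \<phi>0 u t + A * ((t - t1) * nrm \<phi>1 v t) + (t - t1)\<^sup>2 * nrm \<phi>2 w t" for t
  \<comment> \<open>the rate at which \<open>F\<close> can still increase\<close>
  define B where "B = A\<^sup>2 * (2 * d / \<rho>\<^sup>2 * (card S * K\<^sup>2))"
  define F' where "F' t = A\<^sup>2 * dr \<phi>0 u t + A * (1 * nrm \<phi>1 v t + (t - t1) * dr \<phi>1 v t)
     + (2 * (t - t1) * nrm \<phi>2 w t + (t - t1)\<^sup>2 * dr \<phi>2 w t)" for t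
  have Fd: "(F has_real_derivative F' t) (at t within {..0})" if t: "t \<le> 0" for t
    unfolding F_def F'_def
    by (rule derivative_eq_intros deriv u hv hw t refl)+ (simp add: algebra_simps)
  have supS: "(\<Sum>x\<in>S. (u x t)\<^sup>2) \<le> card S * K\<^sup>2" if "t1 \<le> t" "t \<le> t0" for t
  proof -
    have "(u x t)\<^sup>2 \<le> K\<^sup>2" if "x \<in> S" for x
    proof -
      have "\<bar>u x t\<bar> \<le> K"
        using bound[of x t] that \<open>t1 \<le> t\<close> \<open>t \<le> t0\<close> by (simp add: S_def z_def t1_def \<rho>_def)
      from power_mono[OF this, of 2] show ?thesis by simp
    qed
    then show ?thesis using sum_bounded_above[of S "\<lambda>x. (u x t)\<^sup>2" "K\<^sup>2"] by simp
  qed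
  have F'le: "F' t \<le> B" if t: "t1 \<le> t" "t \<le> t0" for t
  proof -
    define \<tau> where "\<tau> = t - t1"
    have \<tau>: "0 \<le> \<tau>" "\<tau> \<le> \<rho>\<^sup>2" using t by (auto simp: \<tau>_def t1_def)
    have \<tau>\<rho>: "\<tau> / \<rho>\<^sup>2 \<le> 1" using \<tau> \<rho>1 by (simp add: divide_le_eq_1)
    have n1: "nrm \<phi>1 v t \<le> d * dir \<phi>0 u t"
    proof -
      have "nrm \<phi>1 v t \<le> (\<Sum>x\<in>cell_box z (2 * r). (v x t)\<^sup>2)" using nmono[of r v t] r0 by (simp add: \<phi>1_def)
      also have "\<dots> \<le> nrm \<phi>0 v t" using inner[of "2 * r" v t] r0 by (simp add: \<phi>0_def)
      also have "\<dots> \<le> d * dir \<phi>0 u t" unfolding v_def by (rule lapdir)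
      finally show ?thesis .
    qed
    have n2: "nrm \<phi>2 w t \<le> d * dir \<phi>1 v t"
    proof -
      have "nrm \<phi>2 w t \<le> (\<Sum>x\<in>cell_box z r. (w x t)\<^sup>2)" using nmono[of 0 w t] r0 by (simp add: \<phi>2_def)
      also have "\<dots> \<le> nrm \<phi>1 w t" using inner[of "r" w t] r0 by (simp add: \<phi>1_def)
      also have "\<dots> \<le> d * dir \<phi>1 v t" unfolding w_def by (rule lapdir)
      finally show ?thesis .
    qed
    have s0: "dr \<phi>0 u t \<le> - (1/2) * dir \<phi>0 u t + 2 * d / \<rho>\<^sup>2 * (card S * K\<^sup>2)"
    proof -
      have "2 * d / \<rho>\<^sup>2 * (\<Sum>x\<in>S. (u x t)\<^sup>2) \<le> 2 * d / \<rho>\<^sup>2 * (card S * K\<^sup>2)"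
        using supS[OF t] d0 by (intro mult_left_mono) auto
      then show ?thesis using step[of "2 * r" u t] by (simp add: \<phi>0_def S_def)
    qed
    have s1: "\<tau> * dr \<phi>1 v t \<le> - (1/2) * (\<tau> * dir \<phi>1 v t) + 2 * d * (d * dir \<phi>0 u t)"
    proof -
      have x: "(\<Sum>x\<in>cell_box z (2 * r). (v x t)\<^sup>2) \<le> d * dir \<phi>0 u t"
        using inner[of "2 * r" v t] r0 lapdir[of \<phi>0 u t] by (simp add: \<phi>0_def v_def)
      have "\<tau> * dr \<phi>1 v t \<le> \<tau> * (- (1/2) * dir \<phi>1 v t + 2 * d / \<rho>\<^sup>2 * (\<Sum>x\<in>cell_box z (2 * r). (v x t)\<^sup>2))"
        using step[of r v t] r0 \<tau> by (intro mult_left_mono) (auto simp: \<phi>1_def)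
      also have "\<dots> = - (1/2) * (\<tau> * dir \<phi>1 v t) + (\<tau> / \<rho>\<^sup>2) * (2 * d * (\<Sum>x\<in>cell_box z (2 * r). (v x t)\<^sup>2))"
        by (simp add: algebra_simps)
      also have "(\<tau> / \<rho>\<^sup>2) * (2 * d * (\<Sum>x\<in>cell_box z (2 * r). (v x t)\<^sup>2)) \<le> 1 * (2 * d * (d * dir \<phi>0 u t))"
        using \<tau>\<rho> x d0 \<tau> by (intro mult_mono mult_left_mono) (auto intro!: mult_nonneg_nonneg sum_nonneg)
      finally show ?thesis by simp
    qed
    have s2: "\<tau>\<^sup>2 * dr \<phi>2 w t \<le> 2 * d * (\<tau> * (d * dir \<phi>1 v t))"
    proof -
      have x: "(\<Sum>x\<in>cell_box z r. (w x t)\<^sup>2) \<le> d * dir \<phi>1 v t"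
        using inner[of "r" w t] r0 lapdir[of \<phi>1 v t] by (simp add: \<phi>1_def w_def)
      have "\<tau>\<^sup>2 * dr \<phi>2 w t \<le> \<tau>\<^sup>2 * (2 * d / \<rho>\<^sup>2 * (\<Sum>x\<in>cell_box z r. (w x t)\<^sup>2))"
        using step[of 0 w t] r0 dir0[of \<phi>2 w t] by (intro mult_left_mono) (auto simp: \<phi>2_def)
      also have "\<dots> = (\<tau> / \<rho>\<^sup>2) * (\<tau> * (2 * d * (\<Sum>x\<in>cell_box z r. (w x t)\<^sup>2)))"
        by (simp add: power2_eq_square)
      also have "\<dots> \<le> 1 * (\<tau> * (2 * d * (d * dir \<phi>1 v t)))"
        using \<tau>\<rho> x d0 \<tau> by (intro mult_mono mult_left_mono) (auto intro!: mult_nonneg_nonneg sum_nonneg)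
      finally show ?thesis by (simp add: algebra_simps)
    qed
    have c1: "A * (A * dir \<phi>0 u t) * (1/2) \<ge> A * ((1 + 2 * d) * (d * dir \<phi>0 u t))"
    proof -
      have "A * (1/2) \<ge> (1 + 2 * d) * d" using d0 by (simp add: A_def algebra_simps)
      then have "(A * dir \<phi>0 u t) * A * (1/2) \<ge> (A * dir \<phi>0 u t) * ((1 + 2 * d) * d)"
        using mult_left_mono[of "(1 + 2 * d) * d" "A * (1/2)" "A * dir \<phi>0 u t"] A0 dir0[of \<phi>0 u t] by (simp add: mult.assoc)
      then show ?thesis by (simp add: algebra_simps)
    qed
    have c2: "A * (\<tau> * dir \<phi>1 v t) * (1/2) \<ge> (2 + 2 * d) * (\<tau> * (d * dir \<phi>1 v t))"
    proof -
      have "A * (1/2) = (2 + 2 * d) * d" by (simp add: A_def algebra_simps)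
      then have "(A * (1/2)) * (\<tau> * dir \<phi>1 v t) = ((2 + 2 * d) * d) * (\<tau> * dir \<phi>1 v t)" by simp
      then show ?thesis by (simp add: algebra_simps)
    qed
    have "A\<^sup>2 * dr \<phi>0 u t \<le> A\<^sup>2 * (- (1/2) * dir \<phi>0 u t + 2 * d / \<rho>\<^sup>2 * (card S * K\<^sup>2))"
      using s0 by (intro mult_left_mono) auto
    then have e0: "A\<^sup>2 * dr \<phi>0 u t \<le> - (A * (A * dir \<phi>0 u t) * (1/2)) + B"
      by (simp add: B_def power2_eq_square algebra_simps)
    have "A * (1 * nrm \<phi>1 v t + \<tau> * dr \<phi>1 v t) \<le> A * (d * dir \<phi>0 u t + (- (1/2) * (\<tau> * dir \<phi>1 v t) + 2 * d * (d * dir \<phi>0 u t)))"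
      using n1 s1 A0 by (intro mult_left_mono) linarith+
    then have e1: "A * (1 * nrm \<phi>1 v t + \<tau> * dr \<phi>1 v t) \<le> A * ((1 + 2 * d) * (d * dir \<phi>0 u t)) - A * (\<tau> * dir \<phi>1 v t) * (1/2)"
      by (simp add: algebra_simps)
    have "2 * \<tau> * nrm \<phi>2 w t \<le> 2 * \<tau> * (d * dir \<phi>1 v t)" using n2 \<tau> by (intro mult_left_mono) auto
    then have e2: "2 * \<tau> * nrm \<phi>2 w t + \<tau>\<^sup>2 * dr \<phi>2 w t \<le> (2 + 2 * d) * (\<tau> * (d * dir \<phi>1 v t))"
      using s2 by (simp add: algebra_simps)
    show ?thesis unfolding F'_def \<tau>_def[symmetric] using e0 e1 e2 c1 c2 by linarith
  qed
  have t10: "t1 < t0" using \<rho>1 by (simp add: t1_def)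
  have "F t0 - B * t0 \<le> F t1 - B * t1"
  proof (rule DERIV_nonpos_imp_decreasing_open[where f = "\<lambda>t. F t - B * t" and a = t1 and b = t0])
    show "t1 \<le> t0" using t10 by simp
    show "\<exists>y. ((\<lambda>t. F t - B * t) has_real_derivative y) (at x) \<and> y \<le> 0" if "t1 < x" "x < t0" for x
    proof -
      have "(F has_real_derivative F' x) (at x within {..0})" using Fd that t0 by simp
      moreover have "at x within {..0} = at x" using that t0 by (intro at_within_interior) (simp add: interior_real_atMost)
      ultimately have "(F has_real_derivative F' x) (at x)" by simp
      then have "((\<lambda>t. F t - B * t) has_real_derivative (F' x - B)) (at x)"
        by (auto intro!: derivative_eq_intros)
      then show ?thesis using F'le[of x] that by (intro exI[of _ "F' x - B"]) auto
    qed
    have "continuous_on {..0} F" using Fd by (auto intro!: DERIV_continuous_on)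
    then have "continuous_on {t1..t0} F" by (rule continuous_on_subset) (use t0 in auto)
    then show "continuous_on {t1..t0} (\<lambda>t. F t - B * t)" by (intro continuous_intros)
  qed
  then have "F t0 \<le> F t1 + B * (t0 - t1)" by (simp add: algebra_simps)
  also have "B * (t0 - t1) = A\<^sup>2 * (2 * d) * (card S * K\<^sup>2)" using \<rho>1 by (simp add: B_def t1_def)
  also have "F t1 \<le> A\<^sup>2 * (card S * K\<^sup>2)"
  proof -
    have "nrm \<phi>0 u t1 \<le> (\<Sum>x\<in>S. (u x t1)\<^sup>2)" using nmono[of "2 * r" u t1] by (simp add: \<phi>0_def S_def)
    also have "\<dots> \<le> card S * K\<^sup>2" using supS[of t1] t10 by simp
    finally show ?thesis unfolding F_def by (simp add: mult_left_mono)
  qed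
  finally have F0: "F t0 \<le> A\<^sup>2 * (1 + 2 * d) * (card S * K\<^sup>2)" by (simp add: algebra_simps)
  have x0S: "x0 \<in> S" using r by (simp add: S_def z_def cell_box_def)
  have p1: "\<phi>2 x0 = 1" using cutoff_one[OF r0, of x0 z 0] by (simp add: \<phi>2_def z_def cell_box_def)
  have "(w x0 t0)\<^sup>2 \<le> nrm \<phi>2 w t0"
    unfolding nrm_def using member_le_sum[of x0 S "\<lambda>x. (\<phi>2 x)\<^sup>2 * (w x t0)\<^sup>2"] x0S p1 by (simp add: S_def)
  then have "(\<rho>\<^sup>2)\<^sup>2 * (w x0 t0)\<^sup>2 \<le> (\<rho>\<^sup>2)\<^sup>2 * nrm \<phi>2 w t0" by (intro mult_left_mono) auto
  also have "\<dots> \<le> F t0"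
    unfolding F_def using A0 nrm0 by (simp add: t1_def)
  finally have G: "(\<rho>\<^sup>2)\<^sup>2 * (w x0 t0)\<^sup>2 \<le> A\<^sup>2 * (1 + 2 * d) * (card S * K\<^sup>2)" using F0 by linarith
  have "real (card S) \<le> real (P * (2 * nat (3 * r) + 1)\<^sup>2)"
    unfolding S_def using card_box_vertices[of "3 * r" z] r by (simp only: of_nat_le_iff)
  also have "\<dots> = P * (6 * \<rho> + 1)\<^sup>2" using r by (simp add: \<rho>_def)
  also have "\<dots> \<le> P * (7 * \<rho>)\<^sup>2" using \<rho>1 by (intro mult_left_mono power_mono) auto
  finally have cS: "real (card S) \<le> 49 * P * \<rho>\<^sup>2" by (simp add: power_mult_distrib)
  have "A\<^sup>2 * (1 + 2 * d) * (card S * K\<^sup>2) \<le> A\<^sup>2 * (1 + 2 * d) * ((49 * P * \<rho>\<^sup>2) * K\<^sup>2)"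
    using cS d0 by (intro mult_left_mono mult_right_mono) auto
  with G have "\<rho>\<^sup>2 * ((w x0 t0)\<^sup>2 * \<rho>\<^sup>2) \<le> \<rho>\<^sup>2 * (A\<^sup>2 * (1 + 2 * d) * (49 * P) * K\<^sup>2)"
    by (simp add: algebra_simps power2_eq_square)
  then have "(w x0 t0)\<^sup>2 * \<rho>\<^sup>2 \<le> A\<^sup>2 * (1 + 2 * d) * (49 * P) * K\<^sup>2"
    using \<rho>1 by (subst (asm) mult_le_cancel_left_pos) auto
  moreover have "real ((4 * (1 + deg) * deg)\<^sup>2 * (1 + 2 * deg) * (49 * P)) = A\<^sup>2 * (1 + 2 * d) * (49 * P)"
    by (simp only: A_def d_def of_nat_mult of_nat_add of_nat_power of_nat_1 of_nat_numeral)
  ultimately show ?thesis by (simp only: w_def v_def \<rho>_def)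
qed

end

context rough_lattice begin

text \<open>
  Up to a constant factor the weight is the one in \<^const>\<open>ancient_poly\<close>, but it
  refers to cells, as the cutoffs do. Integer exponents suffice, because a bound quadratic in the
  exponent survives rounding up.
\<close>

definition polynomial_ancient :: "nat \<Rightarrow> ('v \<Rightarrow> real \<Rightarrow> real) set" where
  "polynomial_ancient k = {u. heat u \<and> (\<forall>x. \<forall>t>0. u x t = 0) \<and>
     (\<exists>K::real. \<forall>x. \<forall>t\<le>0. \<bar>u x t\<bar> \<le> K * (1 + rad x + sqrt \<bar>t\<bar>) ^ k)}"

definition polynomial_harmonic :: "nat \<Rightarrow> ('v \<Rightarrow> real) set" where
  "polynomial_harmonic k = {f. (\<forall>x. lap f x = 0) \<and> (\<exists>K::real. \<forall>x. \<bar>f x\<bar> \<le> K * (1 + rad x) ^ k)}"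

lemma lap_zero [simp]: "lap (\<lambda>y. 0) x = 0"
  by (simp add: graph_laplacian_def)

lemma heat_add: "heat u \<Longrightarrow> heat v \<Longrightarrow> heat (\<lambda>x t. u x t + v x t)"
  unfolding heat_def lap_add by (auto intro!: DERIV_add)

lemma heat_scale: "heat u \<Longrightarrow> heat (\<lambda>x t. a * u x t)"
  unfolding heat_def lap_scale by (auto intro!: DERIV_cmult)

lemma growth_nonneg:
  assumes "\<And>x t. t \<le> 0 \<Longrightarrow> \<bar>u x t\<bar> \<le> K * (1 + rad x + sqrt \<bar>t\<bar>) ^ k"
  shows "K \<ge> (0::real)"
proof -
  obtain x where "cell x = 0" using fibre_nonempty by blast
  then have "\<bar>u x 0\<bar> \<le> K" using assms[of 0 x] by simp
  then show ?thesis by linarith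
qed

lemma subspace_polynomial_ancient: "subspace (polynomial_ancient k)"
  unfolding subspace_def
proof (intro conjI ballI allI)
  show "0 \<in> polynomial_ancient k" by (auto simp: polynomial_ancient_def heat_def zero_fun_def intro!: exI[of _ 0])
next
  fix u v assume u: "u \<in> polynomial_ancient k" and v: "v \<in> polynomial_ancient k"
  obtain K where K: "\<And>x t. t \<le> 0 \<Longrightarrow> \<bar>u x t\<bar> \<le> K * (1 + rad x + sqrt \<bar>t\<bar>) ^ k"
    using u by (auto simp: polynomial_ancient_def)
  obtain L where L: "\<And>x t. t \<le> 0 \<Longrightarrow> \<bar>v x t\<bar> \<le> L * (1 + rad x + sqrt \<bar>t\<bar>) ^ k"
    using v by (auto simp: polynomial_ancient_def)
  have "\<bar>u x t + v x t\<bar> \<le> (K + L) * (1 + rad x + sqrt \<bar>t\<bar>) ^ k" if "t \<le> 0" for x t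
    using K[OF that, of x] L[OF that, of x] by (simp add: distrib_right)
  then show "u + v \<in> polynomial_ancient k"
    using u v heat_add[of u v] unfolding polynomial_ancient_def by (auto simp: plus_fun_def)
next
  fix a u assume u: "u \<in> polynomial_ancient k"
  obtain K where K: "\<And>x t. t \<le> 0 \<Longrightarrow> \<bar>u x t\<bar> \<le> K * (1 + rad x + sqrt \<bar>t\<bar>) ^ k"
    using u by (auto simp: polynomial_ancient_def)
  have "\<bar>a * u x t\<bar> \<le> (\<bar>a\<bar> * K) * (1 + rad x + sqrt \<bar>t\<bar>) ^ k" if "t \<le> 0" for x t
    using mult_left_mono[OF K[OF that, of x], of "\<bar>a\<bar>"] by (simp add: abs_mult mult.assoc)
  then show "a *\<^sub>R u \<in> polynomial_ancient k"
    using u heat_scale[of u a] unfolding polynomial_ancient_def by (auto simp: scaleR_fun_def)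
qed

lemma linear_Lap: "linear Lap"
  by (rule linearI) (auto simp: Lap_def fun_eq_iff lap_add lap_scale scaleR_fun_def)

lemma cell_norm_adj: "(x, y) \<in> E \<Longrightarrow> sup_norm (cell y) \<le> sup_norm (cell x) + 1"
  using cell_adj_norm[of x y 0] by simp

text \<open>
  With \<open>r\<close> comparable to the parabolic size of \<open>(x, t)\<close>, the bound on the
  cylinder around \<open>(x, t)\<close> is comparable to the one at its centre; for bounded
  \<open>u\<close> the number \<open>r\<close> may also tend to infinity.
\<close>

lemma Lap_growth_double:
  fixes K :: real
  assumes u: "heat u" and K: "\<And>x t. t \<le> 0 \<Longrightarrow> \<bar>u x t\<bar> \<le> K * (1 + rad x + sqrt \<bar>t\<bar>) ^ k"
    and t: "t \<le> 0" and r: "(r::int) \<ge> 1" "1 + rad x + sqrt \<bar>t\<bar> \<le> r"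
  shows "(Lap (Lap u) x t)\<^sup>2 * (real_of_int r)\<^sup>2 \<le>
    (4 * (1 + deg) * deg)\<^sup>2 * (1 + 2 * deg) * (49 * P) * (K * (5 * r) ^ k)\<^sup>2"
proof (rule parabolic_mean_bound[OF u t r(1)])
  fix y s assume y: "y \<in> cell_box (cell x) (3 * r)" and s: "t - (real_of_int r)\<^sup>2 \<le> s" "s \<le> t"
  have "sup_norm (cell y) \<le> sup_norm (cell x) + 3 * r"
    using y sup_norm_diff_le[of "cell y" "cell x"] by (simp add: cell_box_def)
  then have 1: "rad y \<le> sup_norm (cell x) + 3 * r" by linarith
  have "\<bar>s\<bar> \<le> \<bar>t\<bar> + (real_of_int r)\<^sup>2" using s t by auto
  then have "sqrt \<bar>s\<bar> \<le> sqrt (\<bar>t\<bar> + (real_of_int r)\<^sup>2)" by simp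
  also have "\<dots> \<le> sqrt \<bar>t\<bar> + sqrt ((real_of_int r)\<^sup>2)" by (rule sqrt_add_le_add_sqrt) auto
  finally have 2: "sqrt \<bar>s\<bar> \<le> sqrt \<bar>t\<bar> + r" using r(1) by simp
  have "1 + rad y + sqrt \<bar>s\<bar> \<le> 5 * real_of_int r" using 1 2 r(2) by linarith
  then have "(1 + rad y + sqrt \<bar>s\<bar>) ^ k \<le> (5 * real_of_int r) ^ k"
    by (intro power_mono) auto
  then have "K * (1 + rad y + sqrt \<bar>s\<bar>) ^ k \<le> K * (5 * real_of_int r) ^ k"
    using growth_nonneg[OF K] by (intro mult_left_mono) auto
  moreover have "\<bar>u y s\<bar> \<le> K * (1 + rad y + sqrt \<bar>s\<bar>) ^ k" using K[of s y] s t by simp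
  ultimately show "\<bar>u y s\<bar> \<le> K * (5 * real_of_int r) ^ k" by linarith
qed

lemma Lap_zero_past: "(\<And>x t. t > 0 \<Longrightarrow> u x t = 0) \<Longrightarrow> t > 0 \<Longrightarrow> Lap u x t = 0"
  by (simp add: Lap_def)

lemma Lap_polynomial_ancient:
  assumes u: "u \<in> polynomial_ancient k" shows "Lap u \<in> polynomial_ancient k"
proof -
  obtain K where K: "\<And>x t. t \<le> 0 \<Longrightarrow> \<bar>u x t\<bar> \<le> K * (1 + rad x + sqrt \<bar>t\<bar>) ^ k"
    using u by (auto simp: polynomial_ancient_def)
  have h: "heat u" and z: "\<And>x t. t > 0 \<Longrightarrow> u x t = 0" using u by (auto simp: polynomial_ancient_def)
  have K0: "K \<ge> 0" using growth_nonneg[OF K] .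
  have "\<bar>Lap u x t\<bar> \<le> (deg * (2 * K * 2 ^ k)) * (1 + rad x + sqrt \<bar>t\<bar>) ^ k" if t: "t \<le> 0" for x t
  proof -
    let ?b = "1 + rad x + sqrt \<bar>t\<bar>"
    have b: "?b \<ge> 1" by simp
    have "\<bar>u y t - u x t\<bar> \<le> 2 * K * 2 ^ k * ?b ^ k" if "(x, y) \<in> E" for y
    proof -
      have "1 + rad y + sqrt \<bar>t\<bar> \<le> 2 * ?b" proof -
        have "rad y \<le> rad x + 1"
          using cell_norm_adj[OF that] by linarith
        moreover have "0 \<le> rad x" by simp
        moreover have "0 \<le> sqrt \<bar>t\<bar>" by simp
        moreover have "b' \<le> a + 1 \<Longrightarrow> 0 \<le> a \<Longrightarrow> 0 \<le> c \<Longrightarrow> 1 + b' + c \<le> 2 * (1 + a + c)" for a b' c :: real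
          by simp
        ultimately show ?thesis by blast
      qed
      then have "(1 + rad y + sqrt \<bar>t\<bar>) ^ k \<le> (2 * ?b) ^ k" by (intro power_mono) auto
      then have "\<bar>u y t\<bar> \<le> K * (2 * ?b) ^ k" using K[OF t, of y] K0 by (meson mult_left_mono order_trans)
      moreover have "?b ^ k \<le> (2 * ?b) ^ k" by (intro power_mono) auto
      then have "\<bar>u x t\<bar> \<le> K * (2 * ?b) ^ k" using K[OF t, of x] K0 by (meson mult_left_mono order_trans)
      ultimately have "\<bar>u y t - u x t\<bar> \<le> 2 * (K * (2 * ?b) ^ k)" by linarith
      then show ?thesis by (simp only: power_mult_distrib mult.assoc)
    qed
    then have "(\<Sum>y | (x, y) \<in> E. \<bar>u y t - u x t\<bar>) \<le> card {y. (x, y) \<in> E} * (2 * K * 2 ^ k * ?b ^ k)"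
      by (intro sum_bounded_above) auto
    also have "\<dots> \<le> deg * (2 * K * 2 ^ k * ?b ^ k)"
      using card_nbrs[of x] K0 b by (intro mult_right_mono) (simp_all only: of_nat_le_iff, auto)
    finally show ?thesis
      unfolding Lap_def graph_laplacian_def using order_trans[OF sum_abs[of "\<lambda>y. u y t - u x t" "{y. (x, y) \<in> E}"]]
      by (simp only: mult.assoc)
  qed
  moreover have "Lap u x t = 0" if "t > 0" for x t
    using that by (intro Lap_zero_past z)
  ultimately show ?thesis using heat_Lap[OF h] unfolding polynomial_ancient_def by blast
qed

lemma Lap_Lap_lowers_growth:
  assumes u: "u \<in> polynomial_ancient (Suc k)" shows "Lap (Lap u) \<in> polynomial_ancient k"
proof -
  obtain K where K: "\<And>x t. t \<le> 0 \<Longrightarrow> \<bar>u x t\<bar> \<le> K * (1 + rad x + sqrt \<bar>t\<bar>) ^ Suc k"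
    using u by (auto simp: polynomial_ancient_def)
  have h: "heat u" and z: "\<And>x t. t > 0 \<Longrightarrow> u x t = 0" using u by (auto simp: polynomial_ancient_def)
  define C where "C = (4 * (1 + deg) * deg)\<^sup>2 * (1 + 2 * deg) * (49 * P) * (K * (5::real) ^ Suc k)\<^sup>2"
  have C0: "C \<ge> 0" by (simp add: C_def)
  have "\<bar>Lap (Lap u) x t\<bar> \<le> (sqrt C * 2 ^ k) * (1 + rad x + sqrt \<bar>t\<bar>) ^ k" if t: "t \<le> 0" for x t
  proof -
    let ?b = "1 + rad x + sqrt \<bar>t\<bar>"
    define r where "r = \<lceil>?b\<rceil>"
    have b: "?b \<ge> 1" by simp
    have "real_of_int r \<le> ?b + 1" unfolding r_def by (rule of_int_ceiling_le_add_one)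
    moreover have "?b \<le> r" unfolding r_def by (rule le_of_int_ceiling)
    moreover have "c \<le> b' + 1 \<Longrightarrow> b' \<le> c \<Longrightarrow> 1 \<le> b' \<Longrightarrow> 1 \<le> c \<and> b' \<le> c \<and> c \<le> 2 * b'" for b' c :: real
      by linarith
    ultimately have "1 \<le> real_of_int r" "?b \<le> r" "r \<le> 2 * ?b" using b by blast+
    then have r: "r \<ge> 1" "?b \<le> r" "r \<le> 2 * ?b" by simp_all
    have "(Lap (Lap u) x t)\<^sup>2 * (real_of_int r)\<^sup>2 \<le> C * (real_of_int r ^ Suc k)\<^sup>2"
      using Lap_growth_double[OF h K t r(1,2)] by (simp add: C_def power_mult_distrib algebra_simps)
    also have "\<dots> = (C * (real_of_int r ^ k)\<^sup>2) * (real_of_int r)\<^sup>2" by (simp add: power_mult_distrib)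
    finally have "(Lap (Lap u) x t)\<^sup>2 \<le> C * (real_of_int r ^ k)\<^sup>2" using r(1) by simp
    then have "(Lap (Lap u) x t)\<^sup>2 \<le> (sqrt C * real_of_int r ^ k)\<^sup>2" using C0 by (simp add: power_mult_distrib)
    moreover have nn: "0 \<le> sqrt C * real_of_int r ^ k" using C0 r(1) by simp
    ultimately have "\<bar>Lap (Lap u) x t\<bar> \<le> sqrt C * real_of_int r ^ k"
      by (metis power2_abs power2_le_imp_le)
    also have "\<dots> \<le> sqrt C * (2 * ?b) ^ k" using r C0 by (intro mult_left_mono power_mono) auto
    finally show ?thesis by (simp only: power_mult_distrib mult.assoc)
  qed
  moreover have "Lap (Lap u) x t = 0" if "t > 0" for x t
    using that by (intro Lap_zero_past z)
  ultimately show ?thesis using heat_Lap[OF heat_Lap[OF h]]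
    unfolding polynomial_ancient_def by blast
qed

lemma Lap_Lap_bounded:
  assumes u: "u \<in> polynomial_ancient 0" shows "Lap (Lap u) = 0"
proof -
  obtain K where K: "\<And>x t. t \<le> 0 \<Longrightarrow> \<bar>u x t\<bar> \<le> K * (1 + rad x + sqrt \<bar>t\<bar>) ^ 0"
    using u by (auto simp: polynomial_ancient_def)
  have h: "heat u" and z: "\<And>x t. t > 0 \<Longrightarrow> u x t = 0" using u by (auto simp: polynomial_ancient_def)
  define C where "C = (4 * (1 + deg) * deg)\<^sup>2 * (1 + 2 * deg) * (49 * P) * (K * (1::real))\<^sup>2"
  have "Lap (Lap u) x t = 0" for x t
  proof (cases "t \<le> 0")
    case t: True
    let ?b = "1 + rad x + sqrt \<bar>t\<bar>"
    show ?thesis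
    proof (rule ccontr)
      assume "Lap (Lap u) x t \<noteq> 0"
      then have pos: "(Lap (Lap u) x t)\<^sup>2 > 0" by simp
      define r where "r = \<lceil>max ?b (C / (Lap (Lap u) x t)\<^sup>2 + 1)\<rceil>"
      have r: "?b \<le> r" "C / (Lap (Lap u) x t)\<^sup>2 + 1 \<le> r" unfolding r_def by linarith+
      have "?b \<ge> 1" by simp
      then have r1: "r \<ge> 1" using r(1) by linarith
      have "(Lap (Lap u) x t)\<^sup>2 * (real_of_int r)\<^sup>2 \<le> C"
        using Lap_growth_double[OF h K t r1 r(1)] by (simp add: C_def)
      moreover have "real_of_int r \<le> (real_of_int r)\<^sup>2" using r1 by (simp add: power2_eq_square)
      then have "(Lap (Lap u) x t)\<^sup>2 * real_of_int r \<le> (Lap (Lap u) x t)\<^sup>2 * (real_of_int r)\<^sup>2" by (intro mult_left_mono) auto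
      ultimately have "real_of_int r \<le> C / (Lap (Lap u) x t)\<^sup>2" using pos
        by (simp only: pos_le_divide_eq mult.commute)
      then show False using r(2) by linarith
    qed
  next
    case False
    then show ?thesis by (intro Lap_zero_past z) auto
  qed
  then show ?thesis by (simp add: fun_eq_iff)
qed

lemma Lap_nilpotent: "u \<in> polynomial_ancient k \<Longrightarrow> (Lap ^^ (2 * k + 2)) u = 0"
proof (induction k arbitrary: u)
  case 0
  then show ?case using Lap_Lap_bounded by simp
next
  case (Suc k)
  have "(Lap ^^ (2 * Suc k + 2)) u = (Lap ^^ (2 * k + 2)) (Lap (Lap u))"
    by (simp add: funpow_swap1)
  then show ?case using Suc.IH[OF Lap_Lap_lowers_growth[OF Suc.prems]] by simp
qed

lemma static_kernel:
  assumes u: "u \<in> polynomial_ancient k" and L: "Lap u = 0"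
  shows "\<exists>f\<in>polynomial_harmonic k. u = (\<lambda>x t. if t \<le> 0 then f x else 0)"
proof -
  obtain K where K: "\<And>x t. t \<le> 0 \<Longrightarrow> \<bar>u x t\<bar> \<le> K * (1 + rad x + sqrt \<bar>t\<bar>) ^ k"
    using u by (auto simp: polynomial_ancient_def)
  have h: "heat u" and z: "\<And>x t. t > 0 \<Longrightarrow> u x t = 0" using u by (auto simp: polynomial_ancient_def)
  define f where "f x = u x 0" for x
  have lf: "lap (\<lambda>y. u y t) x = 0" for x t using fun_cong[OF fun_cong[OF L], of x t] by (simp add: Lap_def)
  have const: "u x t = f x" if "t \<le> 0" for x t
  proof -
    have "(u x has_real_derivative 0) (at s within {..0})" if "s \<in> {..0}" for s
      using h that lf by (simp add: heat_def)
    then obtain c where "\<And>s. s \<in> {..0} \<Longrightarrow> u x s = c"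
      using has_field_derivative_zero_constant[of "{..0::real}" "u x"] by (auto simp: convex_real_interval)
    then show ?thesis using that by (simp add: f_def)
  qed
  have "f \<in> polynomial_harmonic k"
    unfolding polynomial_harmonic_def f_def using lf[of 0] K[of 0] by (auto intro!: exI[of _ K])
  moreover have "u = (\<lambda>x t. if t \<le> 0 then f x else 0)" using const z by (auto simp: fun_eq_iff)
  ultimately show ?thesis by blast
qed

text \<open>
  Each of the \<open>2k + 2\<close> steps of the filtration by the kernels of the powers of
  \<^const>\<open>Lap\<close> adds at most the dimension of the kernel of
  \<^const>\<open>Lap\<close> itself.
\<close>

lemma ancient_spanned_by_harmonic:
  assumes "spanned_by h (polynomial_harmonic k)"
  shows "spanned_by ((2 * k + 2) * h) (polynomial_ancient k)"
proof -
  define emb where "emb f = (\<lambda>x (t::real). if t \<le> 0 then f x else 0)" for f :: "'v \<Rightarrow> real"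
  have emb: "linear emb" by (rule linearI) (auto simp: emb_def fun_eq_iff scaleR_fun_def)
  obtain B where B: "finite B" "card B \<le> h" "polynomial_harmonic k \<subseteq> span B"
    using assms by (auto simp: spanned_by_def)
  have ker: "spanned_by h {u \<in> polynomial_ancient k. Lap u = 0}"
  proof -
    have "{u \<in> polynomial_ancient k. Lap u = 0} \<subseteq> emb ` span B"
      using static_kernel B(3) by (fastforce simp: emb_def)
    then have "{u \<in> polynomial_ancient k. Lap u = 0} \<subseteq> span (emb ` B)"
      by (simp add: linear_span_image[OF emb])
    moreover have "card (emb ` B) \<le> h" using card_image_le[OF B(1), of emb] B(2) by simp
    ultimately show ?thesis unfolding spanned_by_def using B(1) by blast
  qed
  have "spanned_by (j * h) {u \<in> polynomial_ancient k. (Lap ^^ j) u = 0}" for j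
  proof (induction j)
    case 0
    have "{u \<in> polynomial_ancient k. (Lap ^^ 0) u = 0} \<subseteq> span {}" by auto
    then show ?case unfolding spanned_by_def by (intro exI[of _ "{}"]) auto
  next
    case (Suc j)
    have lin: "linear (Lap ^^ i)" for i
    proof (induction i)
      case 0
      show ?case by (simp add: id_def linear_id[unfolded id_def])
    next
      case (Suc i)
      show ?case using linear_compose[OF Suc linear_Lap] by (simp add: comp_def)
    qed
    have sub: "subspace {u \<in> polynomial_ancient k. (Lap ^^ Suc j) u = 0}"
      using subspace_inter[OF subspace_polynomial_ancient linear_subspace_kernel[OF lin], of k "Suc j"]
      by (simp add: Int_def)
    have "Lap ` {u \<in> polynomial_ancient k. (Lap ^^ Suc j) u = 0} \<subseteq> {u \<in> polynomial_ancient k. (Lap ^^ j) u = 0}"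
      using Lap_polynomial_ancient by (auto simp: funpow_swap1)
    then have "spanned_by (j * h) (Lap ` {u \<in> polynomial_ancient k. (Lap ^^ Suc j) u = 0})"
      using Suc.IH by (blast intro: spanned_by_mono)
    moreover have "spanned_by h {w \<in> {u \<in> polynomial_ancient k. (Lap ^^ Suc j) u = 0}. Lap w = 0}"
      using ker by (rule spanned_by_mono) auto
    ultimately have "spanned_by (j * h + h) {u \<in> polynomial_ancient k. (Lap ^^ Suc j) u = 0}"
      by (rule spanned_by_kernel_image[OF sub linear_Lap])
    then show ?case by (simp only: mult_Suc add.commute)
  qed
  from this[of "2 * k + 2"] show ?thesis
    by (rule spanned_by_mono) (use Lap_nilpotent in blast, simp)
qed

end

lemma entropy_iterated:
  fixes b :: "nat \<Rightarrow> 'a::real_vector \<Rightarrow> 'a \<Rightarrow> real"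
  assumes bil: "\<And>j. bilinear (b j)" and sym: "\<And>j f g. b j f g = b j g f"
    and nn: "\<And>j f. b j f f \<ge> 0" and le: "\<And>j f. b j f f \<le> b (Suc j) f f"
    and fin: "finite F" and pos: "\<And>f. f \<in> span F \<Longrightarrow> f \<noteq> 0 \<Longrightarrow> b 0 f f > 0"
    and L: "\<And>j. finite (L j)" "\<And>j. card (L j) \<le> m" "\<And>j l. l \<in> L j \<Longrightarrow> linear l"
    and M: "M > 0"
    and contr: "\<And>j f. f \<in> span F \<Longrightarrow> (\<forall>l\<in>L j. l f = (0::real)) \<Longrightarrow> b j f f \<le> b (Suc j) f f / (real M)\<^sup>2"
    and X: "finite X" "X \<subseteq> span F" "\<And>x y. x \<in> X \<Longrightarrow> y \<in> X \<Longrightarrow> b J (x - y) (x - y) \<le> \<rho>"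
  shows "\<exists>X'\<subseteq>X. card X \<le> ((3 * 2 ^ (M + 1)) ^ m) ^ J * card X' \<and>
            (\<forall>x\<in>X'. \<forall>y\<in>X'. b 0 (x - y) (x - y) \<le> \<rho> * (4 / (real M)\<^sup>2) ^ J)"
  using X
proof (induction J arbitrary: X \<rho>)
  case 0
  then show ?case by (intro exI[of _ X]) auto
next
  case (Suc J)
  have pos': "b j f f > 0" if "f \<in> span F" "f \<noteq> 0" for j f
  proof (induction j)
    case 0 then show ?case using pos that by simp
  next
    case (Suc j) then show ?case using le[of j f] by linarith
  qed
  have "\<exists>X'\<subseteq>X. card X \<le> (3 * 2 ^ (M + 1)) ^ m * card X' \<and>
      (\<forall>x\<in>X'. \<forall>y\<in>X'. b J (x - y) (x - y) \<le> 4 * \<rho> / (real M)\<^sup>2)"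
    by (rule entropy_step[OF bil[of J] bil[of "Suc J"] sym sym nn le fin pos' L(1)[of J] L(2)[of J] L(3)[of _ J]
          M contr[of _ J] Suc.prems]) auto
  then obtain Y where Y: "Y \<subseteq> X" "card X \<le> (3 * 2 ^ (M + 1)) ^ m * card Y"
    "\<forall>x\<in>Y. \<forall>y\<in>Y. b J (x - y) (x - y) \<le> 4 * \<rho> / (real M)\<^sup>2"
    by blast
  obtain Z where Z: "Z \<subseteq> Y" "card Y \<le> ((3 * 2 ^ (M + 1)) ^ m) ^ J * card Z"
    "\<forall>x\<in>Z. \<forall>y\<in>Z. b 0 (x - y) (x - y) \<le> (4 * \<rho> / (real M)\<^sup>2) * (4 / (real M)\<^sup>2) ^ J"
    using Suc.IH[of Y "4 * \<rho> / (real M)\<^sup>2"] Y finite_subset[OF Y(1) Suc.prems(1)] order_trans[OF Y(1) Suc.prems(2)]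
    by blast
  have "card X \<le> (3 * 2 ^ (M + 1)) ^ m * (((3 * 2 ^ (M + 1)) ^ m) ^ J * card Z)"
    using Y(2) Z(2) by (meson mult_le_mono2 order_trans)
  moreover have "(4 * \<rho> / (real M)\<^sup>2) * (4 / (real M)\<^sup>2) ^ J = \<rho> * (4 / (real M)\<^sup>2) ^ Suc J" by simp
  ultimately have "card X \<le> ((3 * 2 ^ (M + 1)) ^ m) ^ Suc J * card Z \<and>
      (\<forall>x\<in>Z. \<forall>y\<in>Z. b 0 (x - y) (x - y) \<le> \<rho> * (4 / (real M)\<^sup>2) ^ Suc J)"
    using Z(3) by (simp only: power_Suc mult.assoc)
  then show ?case using Y(1) Z(1) by blast
qed

section \<open>Energy decay of harmonic functions across a square annulus\<close>

lemma difference_sq_le_gradient_sum: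
  fixes h :: "nat \<Rightarrow> real"
  assumes "i \<le> n" "j \<le> n"
  shows "(h i - h j)\<^sup>2 \<le> n * (\<Sum>l<n. (h (Suc l) - h l)\<^sup>2)"
  using assms
proof (induction i j rule: linorder_wlog)
  case (le i j)
  have "h j - h i = (\<Sum>l=i..<j. (h (Suc l) - h l) * 1)" using le by (simp add: sum_Suc_diff')
  then have "(h i - h j)\<^sup>2 = (\<Sum>l=i..<j. (h (Suc l) - h l) * 1)\<^sup>2" by (simp only: power2_commute[of "h i" "h j"])
  also have "\<dots> \<le> (\<Sum>l=i..<j. (h (Suc l) - h l)\<^sup>2) * (\<Sum>l=i..<j. 1\<^sup>2)" by (rule Cauchy_Schwarz_ineq_sum)
  also have "\<dots> \<le> (\<Sum>l<n. (h (Suc l) - h l)\<^sup>2) * n"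
    using le by (intro mult_mono sum_mono2 sum_nonneg) auto
  finally show ?case by (simp add: mult.commute)
next
  case (sym i j)
  then show ?case by (simp add: power2_commute)
qed

text \<open>
  When the mean is zero, the sum of squares is proportional to the sum of the squared differences
  over all pairs of points. Two points are joined by a horizontal and a vertical path; the constant
  is \<open>n\<^sup>2\<close>, as scaling demands, because every edge is used by
  \<open>O(n^3)\<close> of the pairs.
\<close>

lemma square_poincare:
  fixes h :: "nat \<Rightarrow> nat \<Rightarrow> real"
  assumes mean: "(\<Sum>i<n. \<Sum>j<n. h i j) = 0"
  shows "(\<Sum>i<n. \<Sum>j<n. (h i j)\<^sup>2) \<le>
    (real n)\<^sup>2 * (\<Sum>i<n. \<Sum>j<n. (h (Suc i) j - h i j)\<^sup>2 + (h i (Suc j) - h i j)\<^sup>2)"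
proof (cases "n = 0")
  case False
  define A where "A = (\<Sum>i<n. \<Sum>j<n. (h (Suc i) j - h i j)\<^sup>2)"
  define B where "B = (\<Sum>i<n. \<Sum>j<n. (h i (Suc j) - h i j)\<^sup>2)"
  define S where "S = (\<Sum>i<n. \<Sum>j<n. (h i j)\<^sup>2)"
  let ?D = "\<Sum>i<n. \<Sum>j<n. \<Sum>i'<n. \<Sum>j'<n. (h i j - h i' j')\<^sup>2"
  have inner: "(\<Sum>i'<n. \<Sum>j'<n. (h i j - h i' j')\<^sup>2) = (real n)\<^sup>2 * (h i j)\<^sup>2 + S" for i j
  proof -
    have "(\<Sum>i'<n. \<Sum>j'<n. (h i j - h i' j')\<^sup>2) = (\<Sum>i'<n. \<Sum>j'<n. (h i j)\<^sup>2 + ((h i' j')\<^sup>2 - 2 * h i j * h i' j'))"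
      by (intro sum.cong) (auto simp: power2_diff)
    also have "\<dots> = (real n)\<^sup>2 * (h i j)\<^sup>2 + S - 2 * h i j * (\<Sum>i'<n. \<Sum>j'<n. h i' j')"
      by (simp add: sum.distrib sum_subtractf S_def sum_distrib_left power2_eq_square)
    finally show ?thesis using mean by simp
  qed
  have D: "?D = 2 * (real n)\<^sup>2 * S"
  proof -
    have "?D = (real n)\<^sup>2 * S + n * (n * S)"
      unfolding inner by (simp add: sum.distrib sum_distrib_left[symmetric] S_def[symmetric])
    then show ?thesis by (simp add: power2_eq_square)
  qed
  have pt: "(h i j - h i' j')\<^sup>2 \<le> 2 * n * (\<Sum>l<n. (h (Suc l) j - h l j)\<^sup>2) + 2 * n * (\<Sum>l<n. (h i' (Suc l) - h i' l)\<^sup>2)"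
    if "i < n" "j < n" "i' < n" "j' < n" for i j i' j'
  proof -
    have s: "(a + c)\<^sup>2 \<le> 2 * a\<^sup>2 + 2 * c\<^sup>2" for a c :: real
      using zero_le_power2[of "a - c"] by (simp add: power2_sum power2_diff)
    have "(h i j - h i' j')\<^sup>2 \<le> 2 * (h i j - h i' j)\<^sup>2 + 2 * (h i' j - h i' j')\<^sup>2"
      using s[of "h i j - h i' j" "h i' j - h i' j'"] by simp
    moreover have "(h i j - h i' j)\<^sup>2 \<le> n * (\<Sum>l<n. (h (Suc l) j - h l j)\<^sup>2)"
      using difference_sq_le_gradient_sum[of i n i' "\<lambda>i. h i j"] that by simp
    moreover have "(h i' j - h i' j')\<^sup>2 \<le> n * (\<Sum>l<n. (h i' (Suc l) - h i' l)\<^sup>2)"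
      using difference_sq_le_gradient_sum[of j n j' "h i'"] that by simp
    ultimately show ?thesis by linarith
  qed
  have "?D \<le> (\<Sum>i<n. \<Sum>j<n. \<Sum>i'<n. \<Sum>j'<n.
      2 * n * (\<Sum>l<n. (h (Suc l) j - h l j)\<^sup>2) + 2 * n * (\<Sum>l<n. (h i' (Suc l) - h i' l)\<^sup>2))"
    by (intro sum_mono pt) auto
  also have "\<dots> = 2 * (real n) ^ 4 * (A + B)"
  proof -
    have "(\<Sum>j<n. \<Sum>l<n. (h (Suc l) j - h l j)\<^sup>2) = A" unfolding A_def by (rule sum.swap)
    then show ?thesis
      by (simp add: sum.distrib sum_distrib_left[symmetric] B_def[symmetric] algebra_simps power4_eq_xxxx)
  qed
  finally have "2 * (real n)\<^sup>2 * S \<le> 2 * (real n)\<^sup>2 * ((real n)\<^sup>2 * (A + B))"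
    unfolding D by (simp add: power4_eq_xxxx power2_eq_square mult.assoc)
  then have "S \<le> (real n)\<^sup>2 * (A + B)" using False by (subst (asm) mult_le_cancel_left_pos) auto
  then show ?thesis by (simp add: S_def A_def B_def sum.distrib)
qed simp

lemma step_towards:
  assumes "sup_norm (a - b) \<le> int (Suc d)"
  shows "\<exists>p. sup_norm (p - b) \<le> 1 \<and> sup_norm (a - p) \<le> int d"
proof -
  have 1: "\<exists>z. \<bar>z - y\<bar> \<le> 1 \<and> \<bar>x - z\<bar> \<le> int d" if "\<bar>x - y\<bar> \<le> int (Suc d)" for x y :: int
    using that by (intro exI[of _ "y + sgn (x - y)"]) (auto simp: sgn_if)
  obtain z w where "\<bar>z - fst b\<bar> \<le> 1" "\<bar>fst a - z\<bar> \<le> int d" "\<bar>w - snd b\<bar> \<le> 1" "\<bar>snd a - w\<bar> \<le> int d"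
    using 1[of "fst a" "fst b"] 1[of "snd a" "snd b"] assms by (auto simp: sup_norm_def)
  then show ?thesis by (intro exI[of _ "(z, w)"]) (simp add: sup_norm_def)
qed

context rough_lattice begin

text \<open>
  Following a chain of adjacent cells, one short path for each step.
\<close>

lemma path_length_le:
  assumes "sup_norm (cell x - cell y) \<le> int d"
  shows "\<exists>n\<le>M * (d + 1). (x, y) \<in> E ^^ n"
  using assms
proof (induction d arbitrary: y)
  case 0
  then show ?case using short_path[of x y] by simp
next
  case (Suc d)
  obtain p where p: "sup_norm (p - cell y) \<le> 1" "sup_norm (cell x - p) \<le> int d"
    using step_towards[OF Suc.prems] by blast
  obtain z where z: "cell z = p" using fibre_nonempty by blast
  obtain n where n: "n \<le> M * (d + 1)" "(x, z) \<in> E ^^ n" using Suc.IH[of z] p(2) z by blast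
  obtain n' where n': "n' \<le> M" "(z, y) \<in> E ^^ n'" using short_path[of z y] p(1) z by blast
  have "(x, y) \<in> E ^^ (n + n')" unfolding relpow_add using n(2) n'(2) by (rule relcompI)
  moreover have "n + n' \<le> M * (Suc d + 1)" using n(1) n'(1) by simp
  ultimately show ?case by blast
qed

text \<open>
  The path may visit a vertex repeatedly, so each step is estimated by the whole sum on the right.
\<close>

lemma path_gradient:
  assumes "(x, y) \<in> E ^^ n" "sup_norm (cell x - c) + int n \<le> R"
  shows "\<bar>f y - f x\<bar> \<le> n * sqrt (\<Sum>z\<in>cell_box c R. grad2 f z) \<and> sup_norm (cell y - c) \<le> sup_norm (cell x - c) + int n"
  using assms
proof (induction n arbitrary: y)
  case 0
  then show ?case by simp
next
  case (Suc n)
  let ?G = "\<Sum>z\<in>cell_box c R. grad2 f z"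
  obtain w where w: "(x, w) \<in> E ^^ n" "(w, y) \<in> E" using Suc.prems(1) by auto
  have IH: "\<bar>f w - f x\<bar> \<le> n * sqrt ?G" "sup_norm (cell w - c) \<le> sup_norm (cell x - c) + int n"
    using Suc.IH[OF w(1)] Suc.prems(2) by auto
  have wR: "w \<in> cell_box c R" using IH(2) Suc.prems(2) by (simp add: cell_box_def)
  have "(f y - f w)\<^sup>2 \<le> grad2 f w"
    unfolding grad2_def using member_le_sum[of y "{y. (w, y) \<in> E}" "\<lambda>y. (f y - f w)\<^sup>2"] w(2) by simp
  also have "\<dots> \<le> ?G" using member_le_sum[of w "cell_box c R" "grad2 f"] wR by simp
  finally have "\<bar>f y - f w\<bar> \<le> sqrt ?G" by (simp add: real_le_rsqrt)
  then have "\<bar>f y - f x\<bar> \<le> Suc n * sqrt ?G" using IH(1) by (simp add: algebra_simps)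
  moreover have "sup_norm (cell y - c) \<le> sup_norm (cell x - c) + int (Suc n)"
    using cell_adj_norm[OF w(2), of c] IH(2) by simp
  ultimately show ?case by blast
qed

definition energy :: "('v \<Rightarrow> real) \<Rightarrow> int \<Rightarrow> real" where
  "energy f R = (\<Sum>x\<in>cell_box 0 R. grad2 f x)"

text \<open>
  All short paths that start in the cell \<open>p\<close> stay in this box.
\<close>

definition local_energy :: "('v \<Rightarrow> real) \<Rightarrow> int \<times> int \<Rightarrow> real" where
  "local_energy f p = (\<Sum>z\<in>cell_box p (int M). grad2 f z)"

definition rep :: "int \<times> int \<Rightarrow> 'v" where
  "rep p = (SOME x. cell x = p)"

lemma cell_rep [simp]: "cell (rep p) = p"
  unfolding rep_def using fibre_nonempty by (rule someI_ex)

lemma energy_mono: "R \<le> R' \<Longrightarrow> energy f R \<le> energy f R'"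
  unfolding energy_def by (intro sum_mono2 box_mono) auto

lemma energy_nonneg [simp]: "0 \<le> energy f R"
  unfolding energy_def by (intro sum_nonneg) auto

lemma local_energy_nonneg [simp]: "0 \<le> local_energy f p"
  unfolding local_energy_def by (intro sum_nonneg) auto

lemma local_variation:
  assumes "sup_norm (cell x - cell y) \<le> 1"
  shows "(f y - f x)\<^sup>2 \<le> (real M)\<^sup>2 * local_energy f (cell x)"
proof -
  obtain n where n: "n \<le> M" "(x, y) \<in> E ^^ n" using short_path[OF assms] by blast
  have "\<bar>f y - f x\<bar> \<le> n * sqrt (local_energy f (cell x))"
    using path_gradient[OF n(2), of "cell x" "int M" f] n(1) by (simp add: local_energy_def)
  also have "\<dots> \<le> M * sqrt (local_energy f (cell x))" using n(1) by (intro mult_right_mono) auto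
  finally have "\<bar>f y - f x\<bar>\<^sup>2 \<le> (M * sqrt (local_energy f (cell x)))\<^sup>2" by (rule power_mono) simp
  then show ?thesis by (simp add: power_mult_distrib)
qed

lemma sum_local_energy_le:
  assumes Q: "Q \<subseteq> {p. sup_norm p \<le> R}"
  shows "(\<Sum>p\<in>Q. local_energy f p) \<le> (2 * real M + 1)\<^sup>2 * energy f (R + int M)"
proof -
  have finQ: "finite Q" using finite_subset[OF Q] finite_box[of 0 R] by simp
  let ?V = "cell_box 0 (R + int M)"
  have "local_energy f p = (\<Sum>z\<in>?V. if sup_norm (cell z - p) \<le> int M then grad2 f z else 0)" if "p \<in> Q" for p
  proof -
    have "cell_box p (int M) = {z \<in> ?V. sup_norm (cell z - p) \<le> int M}"
    proof -
      have "sup_norm (cell z) \<le> R + int M" if "sup_norm (cell z - p) \<le> int M" for z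
      proof -
        have "sup_norm p \<le> R" using Q \<open>p \<in> Q\<close> by blast
        then show ?thesis using sup_norm_diff_le[of "cell z" p] that by linarith
      qed
      then show ?thesis by (auto simp: cell_box_def)
    qed
    then show ?thesis unfolding local_energy_def by (simp add: sum.inter_filter)
  qed
  then have "(\<Sum>p\<in>Q. local_energy f p) = (\<Sum>p\<in>Q. \<Sum>z\<in>?V. if sup_norm (cell z - p) \<le> int M then grad2 f z else 0)"
    by simp
  also have "\<dots> = (\<Sum>z\<in>?V. \<Sum>p\<in>Q. if sup_norm (cell z - p) \<le> int M then grad2 f z else 0)" by (rule sum.swap)
  also have "\<dots> \<le> (\<Sum>z\<in>?V. (2 * real M + 1)\<^sup>2 * grad2 f z)"
  proof (rule sum_mono)
    fix z
    have "(\<Sum>p\<in>Q. if sup_norm (cell z - p) \<le> int M then grad2 f z else 0) = card {p \<in> Q. sup_norm (cell z - p) \<le> int M} * grad2 f z"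
      using finQ by (simp add: sum.inter_filter[symmetric])
    also have "\<dots> \<le> (2 * real M + 1)\<^sup>2 * grad2 f z"
    proof (rule mult_right_mono)
      have "card {p \<in> Q. sup_norm (cell z - p) \<le> int M} \<le> card {p. sup_norm (p - cell z) \<le> int M}"
        by (intro card_mono finite_box) (auto simp: sup_norm_commute)
      also have "\<dots> = (2 * M + 1)\<^sup>2" by (simp add: card_box)
      finally have "real (card {p \<in> Q. sup_norm (cell z - p) \<le> int M}) \<le> real ((2 * M + 1)\<^sup>2)" by (simp only: of_nat_le_iff)
      then show "real (card {p \<in> Q. sup_norm (cell z - p) \<le> int M}) \<le> (2 * real M + 1)\<^sup>2" by (simp add: add.commute)
    qed simp
    finally show "(\<Sum>p\<in>Q. if sup_norm (cell z - p) \<le> int M then grad2 f z else 0) \<le> (2 * real M + 1)\<^sup>2 * grad2 f z" .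
  qed
  finally show ?thesis by (simp add: energy_def sum_distrib_left)
qed

lemma sum_over_cells_le:
  fixes h :: "int \<times> int \<Rightarrow> real"
  assumes Q: "finite Q" "cell ` S \<subseteq> Q" and h: "\<And>p. h p \<ge> 0"
  shows "(\<Sum>x\<in>S. h (cell x)) \<le> P * (\<Sum>p\<in>Q. h p)"
proof -
  have S: "finite S"
  proof (rule finite_subset)
    show "S \<subseteq> (\<Union>p\<in>Q. {x. cell x = p})" using Q(2) by auto
  qed (use Q(1) finite_fibre in auto)
  have "(\<Sum>x\<in>S. h (cell x)) = (\<Sum>p\<in>Q. \<Sum>x\<in>{x \<in> S. cell x = p}. h (cell x))"
    by (rule sum.group[OF S Q, symmetric])
  also have "\<dots> = (\<Sum>p\<in>Q. card {x \<in> S. cell x = p} * h p)" by simp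
  also have "\<dots> \<le> (\<Sum>p\<in>Q. P * h p)"
  proof (rule sum_mono)
    fix p
    have "card {x \<in> S. cell x = p} \<le> card {x. cell x = p}" by (intro card_mono finite_fibre) auto
    then have "real (card {x \<in> S. cell x = p}) \<le> real P" using card_fibre[of p] by simp
    then show "real (card {x \<in> S. cell x = p}) * h p \<le> real P * h p" using h by (rule mult_right_mono)
  qed
  finally show ?thesis by (simp add: sum_distrib_left)
qed

definition square_point :: "nat \<Rightarrow> int \<times> int \<Rightarrow> nat \<Rightarrow> nat \<Rightarrow> int \<times> int" where
  "square_point n \<sigma> i j = (fst \<sigma> * int n + int i, snd \<sigma> * int n + int j)"

definition square_sum :: "nat \<Rightarrow> int \<times> int \<Rightarrow> ('v \<Rightarrow> real) \<Rightarrow> real" where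
  "square_sum n \<sigma> f = (\<Sum>i<n. \<Sum>j<n. f (rep (square_point n \<sigma> i j)))"

text \<open>
  The squares of side \<open>n\<close> are indexed by their lower left corners divided by
  \<open>n\<close>. The two bounds describe the squares that meet the annulus between the radii
  \<open>k q n\<close> and \<open>(k + 1) q n\<close>.
\<close>

definition shell_squares :: "nat \<Rightarrow> nat \<Rightarrow> (int \<times> int) set" where
  "shell_squares k q = {\<sigma>. sup_norm \<sigma> \<le> int ((k + 1) * q)} - {\<sigma>. sup_norm \<sigma> \<le> int (k * q) - 1}"

lemma finite_shell_squares [simp]: "finite (shell_squares k q)"
  unfolding shell_squares_def using finite_box[of 0] by simp

lemma card_shell_squares:
  assumes "k \<ge> 1" "q \<ge> 1"
  shows "card (shell_squares k q) \<le> 24 * q\<^sup>2 * k"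
proof -
  have kq: "k * q \<ge> 1" using assms by simp
  have "card (shell_squares k q) = card {\<sigma>. sup_norm \<sigma> \<le> int ((k + 1) * q)} - card {\<sigma>. sup_norm \<sigma> \<le> int (k * q) - 1}"
    unfolding shell_squares_def
  proof (rule card_Diff_subset)
    show "finite {\<sigma>. sup_norm \<sigma> \<le> int (k * q) - 1}" using finite_box[of 0 "int (k * q) - 1"] by (simp only: diff_zero)
    have "int (k * q) - 1 \<le> int ((k + 1) * q)" by (simp add: algebra_simps)
    then show "{\<sigma>. sup_norm \<sigma> \<le> int (k * q) - 1} \<subseteq> {\<sigma>. sup_norm \<sigma> \<le> int ((k + 1) * q)}" by auto
  qed
  also have "\<dots> = (2 * ((k + 1) * q) + 1)\<^sup>2 - (2 * (k * q - 1) + 1)\<^sup>2"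
  proof -
    have "card {\<sigma>. sup_norm \<sigma> \<le> int K} = (2 * K + 1)\<^sup>2" for K
      using card_box[of "int K" 0] by simp
    from this[of "(k + 1) * q"] have "card {\<sigma>. sup_norm \<sigma> \<le> int ((k + 1) * q)} = (2 * ((k + 1) * q) + 1)\<^sup>2" .
    moreover have "nat (int (k * q) - 1) = k * q - 1" using kq by linarith
    then have "card {\<sigma>. sup_norm \<sigma> \<le> int (k * q) - 1} = (2 * (k * q - 1) + 1)\<^sup>2"
      using card_box[of "int (k * q) - 1" 0] kq by simp
    ultimately show ?thesis by simp
  qed
  also have "\<dots> \<le> 24 * q\<^sup>2 * k"
  proof -
    obtain a where a: "k * q = Suc a" using kq by (metis Suc_le_D One_nat_def)
    have "(2 * ((k + 1) * q) + 1)\<^sup>2 = (2 * Suc a + 2 * q + 1)\<^sup>2" using a by (simp add: algebra_simps)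
    also have "\<dots> = (2 * a + 1)\<^sup>2 + (2 * q + 2) * (4 * Suc a + 2 * q)"
      by (simp add: power2_eq_square algebra_simps)
    also have "(2 * q + 2) * (4 * Suc a + 2 * q) \<le> (4 * q) * (6 * (k * q))"
    proof (rule mult_le_mono)
      show "2 * q + 2 \<le> 4 * q" using assms by simp
      have "q \<le> k * q" using assms by simp
      then show "4 * Suc a + 2 * q \<le> 6 * (k * q)" unfolding a[symmetric] by simp
    qed
    finally have f: "(2 * ((k + 1) * q) + 1)\<^sup>2 \<le> (2 * a + 1)\<^sup>2 + (4 * q) * (6 * (k * q))" by simp
    have "(2 * ((k + 1) * q) + 1)\<^sup>2 \<le> (2 * (k * q - 1) + 1)\<^sup>2 + 24 * q\<^sup>2 * k"
    proof -
      have e1: "24 * q\<^sup>2 * k = (4 * q) * (6 * (k * q))" by (simp add: power2_eq_square)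
      have e2: "k * q - 1 = a" using a by simp
      show ?thesis unfolding e1 e2 by (rule f)
    qed
    then show ?thesis by simp
  qed
  finally show ?thesis .
qed

lemma inj_square_point: "inj_on (\<lambda>(\<sigma>, i, j). square_point n \<sigma> i j) (UNIV \<times> {..<n} \<times> {..<n})"
proof (rule inj_on_inverseI)
  fix x assume "x \<in> (UNIV :: (int \<times> int) set) \<times> {..<n} \<times> {..<n}"
  then obtain s t i j where x: "x = ((s, t), i, j)" "i < n" "j < n" by auto
  then show "(\<lambda>p. ((fst p div int n, snd p div int n), nat (fst p mod int n), nat (snd p mod int n)))
      ((\<lambda>(\<sigma>, i, j). square_point n \<sigma> i j) x) = x"
    by (simp add: square_point_def)
qed

lemma shell_covered:
  assumes n: "n \<ge> 1" and p: "int (k * q * n) \<le> sup_norm p" "sup_norm p \<le> int ((k + 1) * q * n)"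
  shows "p \<in> (\<lambda>(\<sigma>, i, j). square_point n \<sigma> i j) ` (shell_squares k q \<times> {..<n} \<times> {..<n})"
proof -
  let ?\<sigma> = "(fst p div int n, snd p div int n)"
  let ?i = "nat (fst p mod int n)" and ?j = "nat (snd p mod int n)"
  have eq: "p = square_point n ?\<sigma> ?i ?j" using n by (simp add: square_point_def)
  have ij: "?i < n" "?j < n" using n by (simp_all add: nat_less_iff)
  have n0: "int n > 0" using n by simp
  have up: "\<bar>a div int n\<bar> \<le> b" if "\<bar>a\<bar> \<le> b * int n" for a b
  proof -
    have "- b * int n \<le> a" "a \<le> b * int n" using that by auto
    moreover have "- b * int n div int n = - b" "b * int n div int n = b"
      using n0 by (intro nonzero_mult_div_cancel_right; simp)+
    ultimately have "a div int n \<le> b" "- b \<le> a div int n"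
      using zdiv_mono1[of a "b * int n" "int n"] zdiv_mono1[of "- b * int n" a "int n"] n0 by metis+
    then show ?thesis by simp
  qed
  have down: "b \<le> \<bar>a div int n\<bar>" if "b * int n \<le> \<bar>a\<bar>" "b \<ge> 0" for a b
  proof (cases "a \<ge> 0")
    case True
    then show ?thesis using that zdiv_mono1[of "b * int n" a "int n"] n0 by simp
  next
    case False
    then have "a \<le> - b * int n" using that by auto
    moreover have "- b * int n div int n = - b" using n0 by (intro nonzero_mult_div_cancel_right) simp
    ultimately have "a div int n \<le> - b" using zdiv_mono1[of a "- b * int n" "int n"] n0 by metis
    then show ?thesis by simp
  qed
  have u: "sup_norm ?\<sigma> \<le> int ((k + 1) * q)"
    using p(2) up[of "fst p" "int ((k + 1) * q)"] up[of "snd p" "int ((k + 1) * q)"]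
    by (simp add: sup_norm_def)
  have d: "int (k * q) \<le> sup_norm ?\<sigma>"
    using p(1) down[of "int (k * q)" "fst p"] down[of "int (k * q)" "snd p"]
    by (auto simp: sup_norm_def max_def split: if_splits)
  have "?\<sigma> \<in> shell_squares k q" using u d unfolding shell_squares_def by simp
  then show ?thesis using eq ij by (intro image_eqI[of _ _ "(?\<sigma>, ?i, ?j)"]) auto
qed

definition shell_constant :: nat where
  "shell_constant = 216 * P\<^sup>2 * M\<^sup>2 * (2 * M + 1)\<^sup>2"

text \<open>
  By Caccioppoli's inequality the energy inside radius \<open>k q n\<close> is at most \<open>O(1/(q
  n)\<^sup>2)\<close> times the sum of \<open>f\<^sup>2\<close> over the annulus of width \<open>q
  n\<close>. The function is compared with its values at one representative of each cell; these form
  a function on the lattice to which Poincare's inequality on the squares of side \<open>n\<close>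
  applies, with constant \<open>n\<^sup>2\<close>. The quotient is \<open>1/q\<^sup>2\<close>.
\<close>

lemma shell_energy_decay:
  assumes k: "k \<ge> 1" and q: "q \<ge> 1" and n: "n \<ge> M + 1"
    and harm: "\<And>x. lap f x = 0"
    and mean: "\<And>\<sigma>. \<sigma> \<in> shell_squares k q \<Longrightarrow> square_sum n \<sigma> f = 0"
  shows "energy f (int (k * q * n)) * (real q)\<^sup>2 \<le> shell_constant * energy f (int ((k + 3) * q * n))"
proof -
  define N where "N = int (k * q * n)"
  define W where "W = int (q * n)"
  define En where "En = energy f (int ((k + 3) * q * n))"
  define F where "F p = f (rep p)" for p
  define c where "c = (2 * real M + 1)\<^sup>2"
  have n1: "n \<ge> 1" using n by simp
  have Wpos: "W > 0" using q n1 by (simp add: W_def)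
  have NW: "N + W = int ((k + 1) * q * n)" by (simp add: N_def W_def algebra_simps)
  have qn: "n \<le> q * n" using q by simp
  have big: "N + W + int n + int M \<le> int ((k + 3) * q * n)"
  proof -
    have "(k + 3) * q * n = (k + 1) * q * n + 2 * (q * n)" by (simp add: algebra_simps)
    then show ?thesis unfolding NW using n qn by linarith
  qed
  define shell where "shell = cell_box 0 (N + W) - cell_box 0 (N - 1)"
  define T where "T = {p. sup_norm p \<le> N + W} - {p. sup_norm p \<le> N - 1}"
  have finT: "finite T" unfolding T_def using finite_box[of 0 "N + W"] by simp
  have cellT: "cell ` shell \<subseteq> T" by (auto simp: shell_def T_def cell_box_def)
  have "energy f N \<le> (\<Sum>x\<in>cell_box 0 (N + W). (cutoff 0 N W x)\<^sup>2 * grad2 f x)"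
  proof -
    have "energy f N = (\<Sum>x\<in>cell_box 0 N. (cutoff 0 N W x)\<^sup>2 * grad2 f x)"
      unfolding energy_def using cutoff_one[OF Wpos, of _ 0 N] by (intro sum.cong) auto
    also have "\<dots> \<le> (\<Sum>x\<in>cell_box 0 (N + W). (cutoff 0 N W x)\<^sup>2 * grad2 f x)"
      using Wpos by (intro sum_mono2 box_mono) auto
    finally show ?thesis .
  qed
  moreover have "0 \<le> - (1/2) * (\<Sum>x\<in>cell_box 0 (N + W). (cutoff 0 N W x)\<^sup>2 * grad2 f x)
     + 2 * deg / (real_of_int W)\<^sup>2 * (\<Sum>x\<in>shell. (f x)\<^sup>2)"
    using cutoff_energy_inequality[OF Wpos order_refl, where R = N and z = 0 and f = f] harm by (simp add: shell_def)
  ultimately have cacc: "energy f N \<le> 4 * deg / (real_of_int W)\<^sup>2 * (\<Sum>x\<in>shell. (f x)\<^sup>2)"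
    by (simp add: field_simps)
  have "(\<Sum>x\<in>shell. (f x)\<^sup>2) \<le> (\<Sum>x\<in>shell. 2 * ((real M)\<^sup>2 * local_energy f (cell x)) + 2 * (F (cell x))\<^sup>2)"
  proof (rule sum_mono)
    fix x
    have "(f x)\<^sup>2 \<le> 2 * (F (cell x) - f x)\<^sup>2 + 2 * (F (cell x))\<^sup>2"
      using zero_le_power2[of "f x - 2 * F (cell x)"] by (simp add: power2_eq_square algebra_simps)
    moreover have "(F (cell x) - f x)\<^sup>2 \<le> (real M)\<^sup>2 * local_energy f (cell x)"
      unfolding F_def by (rule local_variation) simp
    ultimately show "(f x)\<^sup>2 \<le> 2 * ((real M)\<^sup>2 * local_energy f (cell x)) + 2 * (F (cell x))\<^sup>2" by linarith
  qed
  also have "\<dots> \<le> P * (\<Sum>p\<in>T. 2 * ((real M)\<^sup>2 * local_energy f p) + 2 * (F p)\<^sup>2)"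
    by (rule sum_over_cells_le[OF finT cellT, where h = "\<lambda>p. 2 * ((real M)\<^sup>2 * local_energy f p) + 2 * (F p)\<^sup>2"])
      (auto intro!: add_nonneg_nonneg mult_nonneg_nonneg)
  also have "(\<Sum>p\<in>T. 2 * ((real M)\<^sup>2 * local_energy f p) + 2 * (F p)\<^sup>2)
      = 2 * (real M)\<^sup>2 * (\<Sum>p\<in>T. local_energy f p) + 2 * (\<Sum>p\<in>T. (F p)\<^sup>2)"
    by (simp add: sum.distrib sum_distrib_left mult.assoc)
  finally have s1: "(\<Sum>x\<in>shell. (f x)\<^sup>2) \<le> P * (2 * (real M)\<^sup>2 * (\<Sum>p\<in>T. local_energy f p) + 2 * (\<Sum>p\<in>T. (F p)\<^sup>2))" .
  have s2: "(\<Sum>p\<in>T. local_energy f p) \<le> c * En"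
  proof -
    have "(\<Sum>p\<in>T. local_energy f p) \<le> c * energy f (N + W + int M)"
      unfolding c_def by (rule sum_local_energy_le) (auto simp: T_def)
    also have "\<dots> \<le> c * En" unfolding En_def using big by (intro mult_left_mono energy_mono) (auto simp: c_def)
    finally show ?thesis .
  qed
  define g where "g = (\<lambda>(\<sigma>, i, j). square_point n \<sigma> i j)"
  define X where "X = shell_squares k q \<times> {..<n} \<times> {..<n}"
  have finX: "finite X" by (simp add: X_def)
  have injg: "inj_on g X" unfolding g_def X_def by (rule inj_on_subset[OF inj_square_point]) auto
  have Tsub: "T \<subseteq> g ` X"
    unfolding g_def X_def
  proof
    fix p assume "p \<in> T"
    then have "N \<le> sup_norm p" "sup_norm p \<le> N + W" by (auto simp: T_def)
    then show "p \<in> (\<lambda>(\<sigma>, i, j). square_point n \<sigma> i j) ` (shell_squares k q \<times> {..<n} \<times> {..<n})"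
      unfolding NW unfolding N_def by (intro shell_covered n1)
  qed
  have gbound: "g ` X \<subseteq> {p. sup_norm p \<le> N + W + int n}"
  proof (rule subsetI)
    fix p assume "p \<in> g ` X"
    then obtain s t i j where x: "((s, t), i, j) \<in> X" "p = g ((s, t), i, j)"
      by (metis imageE prod.collapse)
    have coord: "\<bar>a * int n + int b\<bar> \<le> N + W + int n" if "\<bar>a\<bar> \<le> int ((k + 1) * q)" "b < n" for a b
    proof -
      have "\<bar>a * int n\<bar> \<le> int ((k + 1) * q) * int n" using that(1) by (simp add: abs_mult mult_right_mono)
      then have "\<bar>a * int n\<bar> \<le> N + W" unfolding NW by (simp add: algebra_simps)
      then show ?thesis using that(2) by linarith
    qed
    have "\<bar>s\<bar> \<le> int ((k + 1) * q)" "\<bar>t\<bar> \<le> int ((k + 1) * q)" "i < n" "j < n"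
      using x(1) by (auto simp: X_def shell_squares_def sup_norm_def)
    then show "p \<in> {p. sup_norm p \<le> N + W + int n}"
      using coord[of s i] coord[of t j] x(2) by (simp add: g_def square_point_def sup_norm_def)
  qed
  have sumX: "(\<Sum>x\<in>X. h (g x)) = (\<Sum>\<sigma>\<in>shell_squares k q. \<Sum>i<n. \<Sum>j<n. h (square_point n \<sigma> i j))" for h :: "int \<times> int \<Rightarrow> real"
    unfolding X_def g_def by (simp add: sum.cartesian_product[symmetric] case_prod_unfold) (simp add: sum.cartesian_product case_prod_unfold)
  have "(\<Sum>p\<in>T. (F p)\<^sup>2) \<le> (\<Sum>p\<in>g ` X. (F p)\<^sup>2)" using Tsub finX by (intro sum_mono2) auto
  also have "\<dots> = (\<Sum>x\<in>X. (F (g x))\<^sup>2)" using injg by (simp add: sum.reindex)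
  also have "\<dots> = (\<Sum>\<sigma>\<in>shell_squares k q. \<Sum>i<n. \<Sum>j<n. (F (square_point n \<sigma> i j))\<^sup>2)" by (rule sumX)
  also have "\<dots> \<le> (\<Sum>\<sigma>\<in>shell_squares k q. (real n)\<^sup>2 * (\<Sum>i<n. \<Sum>j<n. 2 * (real M)\<^sup>2 * local_energy f (square_point n \<sigma> i j)))"
  proof (rule sum_mono)
    fix \<sigma> assume \<sigma>: "\<sigma> \<in> shell_squares k q"
    have "(\<Sum>i<n. \<Sum>j<n. F (square_point n \<sigma> i j)) = 0" using mean[OF \<sigma>] by (simp add: square_sum_def F_def)
    then have "(\<Sum>i<n. \<Sum>j<n. (F (square_point n \<sigma> i j))\<^sup>2) \<le> (real n)\<^sup>2 * (\<Sum>i<n. \<Sum>j<n.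
        (F (square_point n \<sigma> (Suc i) j) - F (square_point n \<sigma> i j))\<^sup>2 + (F (square_point n \<sigma> i (Suc j)) - F (square_point n \<sigma> i j))\<^sup>2)"
      by (rule square_poincare)
    also have "\<dots> \<le> (real n)\<^sup>2 * (\<Sum>i<n. \<Sum>j<n. 2 * (real M)\<^sup>2 * local_energy f (square_point n \<sigma> i j))"
    proof (intro mult_left_mono sum_mono)
      fix i j
      have "(F (square_point n \<sigma> (Suc i) j) - F (square_point n \<sigma> i j))\<^sup>2 \<le> (real M)\<^sup>2 * local_energy f (square_point n \<sigma> i j)"
        unfolding F_def using local_variation[of "rep (square_point n \<sigma> i j)" "rep (square_point n \<sigma> (Suc i) j)" f]
        by (simp add: square_point_def sup_norm_def)
      moreover have "(F (square_point n \<sigma> i (Suc j)) - F (square_point n \<sigma> i j))\<^sup>2 \<le> (real M)\<^sup>2 * local_energy f (square_point n \<sigma> i j)"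
        unfolding F_def using local_variation[of "rep (square_point n \<sigma> i j)" "rep (square_point n \<sigma> i (Suc j))" f]
        by (simp add: square_point_def sup_norm_def)
      ultimately show "(F (square_point n \<sigma> (Suc i) j) - F (square_point n \<sigma> i j))\<^sup>2 + (F (square_point n \<sigma> i (Suc j)) - F (square_point n \<sigma> i j))\<^sup>2
          \<le> 2 * (real M)\<^sup>2 * local_energy f (square_point n \<sigma> i j)" by linarith
    qed simp
    finally show "(\<Sum>i<n. \<Sum>j<n. (F (square_point n \<sigma> i j))\<^sup>2) \<le> (real n)\<^sup>2 * (\<Sum>i<n. \<Sum>j<n. 2 * (real M)\<^sup>2 * local_energy f (square_point n \<sigma> i j))" .
  qed
  also have "\<dots> = (real n)\<^sup>2 * (2 * (real M)\<^sup>2) * (\<Sum>x\<in>X. local_energy f (g x))"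
    unfolding sumX by (simp add: sum_distrib_left mult.assoc)
  also have "(\<Sum>x\<in>X. local_energy f (g x)) = (\<Sum>p\<in>g ` X. local_energy f p)" using injg by (simp add: sum.reindex)
  also have "(real n)\<^sup>2 * (2 * (real M)\<^sup>2) * \<dots> \<le> (real n)\<^sup>2 * (2 * (real M)\<^sup>2) * (c * En)"
  proof (rule mult_left_mono)
    have "(\<Sum>p\<in>g ` X. local_energy f p) \<le> c * energy f (N + W + int n + int M)"
      unfolding c_def by (rule sum_local_energy_le[OF gbound])
    also have "\<dots> \<le> c * En" unfolding En_def using big by (intro mult_left_mono energy_mono) (auto simp: c_def)
    finally show "(\<Sum>p\<in>g ` X. local_energy f p) \<le> c * En" .
  qed simp
  finally have s3: "(\<Sum>p\<in>T. (F p)\<^sup>2) \<le> (real n)\<^sup>2 * (2 * (real M)\<^sup>2) * (c * En)" .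
  define Z where "Z = (real M)\<^sup>2 * (c * En)"
  have Z0: "Z \<ge> 0" unfolding Z_def c_def En_def by (intro mult_nonneg_nonneg) auto
  have "(\<Sum>x\<in>shell. (f x)\<^sup>2) \<le> P * (2 * Z + 4 * ((real n)\<^sup>2 * Z))"
  proof -
    have "2 * (real M)\<^sup>2 * (\<Sum>p\<in>T. local_energy f p) \<le> 2 * Z"
      using mult_left_mono[OF s2, of "2 * (real M)\<^sup>2"] by (simp add: Z_def)
    moreover have "2 * (\<Sum>p\<in>T. (F p)\<^sup>2) \<le> 4 * ((real n)\<^sup>2 * Z)" using s3 by (simp add: Z_def mult_ac)
    ultimately show ?thesis using s1 by (smt (verit) mult_left_mono of_nat_0_le_iff)
  qed
  also have "\<dots> \<le> P * (6 * ((real n)\<^sup>2 * Z))"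
  proof (rule mult_left_mono)
    have "1 \<le> (real n)\<^sup>2" using n1 by simp
    then have "Z \<le> (real n)\<^sup>2 * Z" using mult_right_mono[of 1 "(real n)\<^sup>2" Z] Z0 by simp
    then show "2 * Z + 4 * ((real n)\<^sup>2 * Z) \<le> 6 * ((real n)\<^sup>2 * Z)" by linarith
  qed simp
  finally have s4: "(\<Sum>x\<in>shell. (f x)\<^sup>2) \<le> P * (6 * ((real n)\<^sup>2 * Z))" .
  have "energy f N \<le> 4 * deg / (real_of_int W)\<^sup>2 * (P * (6 * ((real n)\<^sup>2 * Z)))"
    using cacc mult_left_mono[OF s4, of "4 * deg / (real_of_int W)\<^sup>2"] by simp
  then have "energy f N * (real_of_int W)\<^sup>2 \<le> 4 * deg * (P * (6 * ((real n)\<^sup>2 * Z)))"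
    using Wpos by (simp add: field_simps)
  then have "(real n)\<^sup>2 * (energy f N * (real q)\<^sup>2) \<le> (real n)\<^sup>2 * (216 * (real P)\<^sup>2 * Z)"
    by (simp add: W_def power_mult_distrib power2_eq_square algebra_simps)
  then have "energy f N * (real q)\<^sup>2 \<le> 216 * (real P)\<^sup>2 * Z" using n1 by (subst (asm) mult_le_cancel_left_pos) auto
  then show ?thesis by (simp add: N_def En_def Z_def c_def shell_constant_def mult.assoc add.commute)
qed

end

section \<open>Dimension of harmonic functions of polynomial growth\<close>

lemma subspace_fixed_points:
  fixes T :: "'a::real_vector \<Rightarrow> 'a"
  assumes "linear T" shows "subspace {g. g = T g}"
  unfolding subspace_def using linear_0[OF assms] linear_add[OF assms] linear_scale[OF assms] by simp

context rough_lattice begin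

lemma subspace_polynomial_harmonic: "subspace (polynomial_harmonic k)"
  unfolding subspace_def
proof (intro conjI ballI allI)
  show "0 \<in> polynomial_harmonic k" by (auto simp: polynomial_harmonic_def zero_fun_def intro!: exI[of _ 0])
next
  fix u v assume u: "u \<in> polynomial_harmonic k" and v: "v \<in> polynomial_harmonic k"
  obtain K where K: "\<And>x. \<bar>u x\<bar> \<le> K * (1 + rad x) ^ k"
    using u by (auto simp: polynomial_harmonic_def)
  obtain L where L: "\<And>x. \<bar>v x\<bar> \<le> L * (1 + rad x) ^ k"
    using v by (auto simp: polynomial_harmonic_def)
  have "\<bar>u x + v x\<bar> \<le> (K + L) * (1 + rad x) ^ k" for x
    using K[of x] L[of x] by (simp add: distrib_right)
  then show "u + v \<in> polynomial_harmonic k"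
    using u v unfolding polynomial_harmonic_def by (auto simp: plus_fun_def lap_add)
next
  fix a u assume u: "u \<in> polynomial_harmonic k"
  obtain K where K: "\<And>x. \<bar>u x\<bar> \<le> K * (1 + rad x) ^ k"
    using u by (auto simp: polynomial_harmonic_def)
  have "\<bar>a * u x\<bar> \<le> (\<bar>a\<bar> * K) * (1 + rad x) ^ k" for x
    using mult_left_mono[OF K[of x], of "\<bar>a\<bar>"] by (simp add: abs_mult mult.assoc)
  then show "a *\<^sub>R u \<in> polynomial_harmonic k"
    using u unfolding polynomial_harmonic_def by (auto simp: scaleR_fun_def lap_scale)
qed

definition energy_form :: "int \<Rightarrow> ('v \<Rightarrow> real) \<Rightarrow> ('v \<Rightarrow> real) \<Rightarrow> real" where
  "energy_form R f g = (\<Sum>x\<in>cell_box 0 R. \<Sum>y | (x, y) \<in> E. (f y - f x) * (g y - g x))"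

lemma energy_form_self: "energy_form R f f = energy f R"
  by (simp add: energy_form_def energy_def grad2_def power2_eq_square)

lemma energy_form_commute: "energy_form R f g = energy_form R g f"
  by (simp add: energy_form_def mult.commute)

lemma bilinear_energy_form: "bilinear (energy_form R)"
proof -
  have "linear (energy_form R f)" for f
    by (rule linearI)
      (simp_all add: energy_form_def scaleR_fun_def algebra_simps sum.distrib sum_subtractf sum_distrib_left)
  moreover have "(\<lambda>f. energy_form R f g) = energy_form R g" for g
    using energy_form_commute by auto
  ultimately show ?thesis unfolding bilinear_def by simp
qed

lemma linear_square_sum: "linear (square_sum n \<sigma>)"
  by (rule linearI) (simp_all add: square_sum_def scaleR_fun_def sum.distrib sum_distrib_left)

lemma energy_growth:
  assumes K: "\<And>x. \<bar>f x\<bar> \<le> K * (1 + rad x) ^ k" and R: "R \<ge> 1"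
  shows "energy f R \<le> K\<^sup>2 * (324 * (real P)\<^sup>2 * 9 ^ k) * real_of_int R ^ (2 * k + 2)"
proof -
  obtain x0 where "cell x0 = 0" using fibre_nonempty by blast
  then have K0: "K \<ge> 0" using K[of x0] by simp
  have R0: "real_of_int R \<ge> 1" using R by simp
  have fb: "\<bar>f x\<bar> \<le> K * (3 * real_of_int R) ^ k" if "sup_norm (cell x) \<le> R + 1" for x
  proof -
    have "1 + rad x \<le> 3 * real_of_int R" using that R by linarith
    then have "(1 + rad x) ^ k \<le> (3 * real_of_int R) ^ k" by (intro power_mono) auto
    then have "K * (1 + rad x) ^ k \<le> K * (3 * real_of_int R) ^ k"
      using K0 by (rule mult_left_mono)
    with K[of x] show ?thesis by linarith
  qed
  define B where "B = (2 * (K * (3 * real_of_int R) ^ k))\<^sup>2"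
  have g: "grad2 f x \<le> deg * B" if "x \<in> cell_box 0 R" for x
  proof -
    have xR: "sup_norm (cell x) \<le> R" using that by (simp add: cell_box_def)
    have "(f y - f x)\<^sup>2 \<le> B" if "(x, y) \<in> E" for y
    proof -
      have "sup_norm (cell y) \<le> R + 1" using cell_norm_adj[OF that] xR by linarith
      then have "\<bar>f y - f x\<bar> \<le> 2 * (K * (3 * real_of_int R) ^ k)" using fb[of y] fb[of x] xR by linarith
      from power_mono[OF this, of 2] show ?thesis by (simp add: B_def)
    qed
    then have "grad2 f x \<le> card {y. (x, y) \<in> E} * B"
      unfolding grad2_def by (intro sum_bounded_above) auto
    also have "\<dots> \<le> deg * B" using card_nbrs[of x] by (intro mult_right_mono) (simp_all only: of_nat_le_iff, simp add: B_def)
    finally show ?thesis .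
  qed
  have "energy f R \<le> card (cell_box 0 R) * (deg * B)" unfolding energy_def using g by (intro sum_bounded_above) auto
  also have "\<dots> \<le> (P * (3 * real_of_int R)\<^sup>2) * (deg * B)"
  proof (rule mult_right_mono)
    have "real (card (cell_box 0 R)) \<le> real (P * (2 * nat R + 1)\<^sup>2)"
      using card_box_vertices[of R 0] R by (simp only: of_nat_le_iff)
    also have "\<dots> = P * (2 * real_of_int R + 1)\<^sup>2" using R by simp
    also have "\<dots> \<le> P * (3 * real_of_int R)\<^sup>2" using R0 by (intro mult_left_mono power_mono) auto
    finally show "real (card (cell_box 0 R)) \<le> P * (3 * real_of_int R)\<^sup>2" .
  qed (simp add: B_def)
  also have "\<dots> = K\<^sup>2 * (324 * (real P)\<^sup>2 * 9 ^ k) * real_of_int R ^ (2 * k + 2)"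
  proof -
    have "(3::real) ^ (2 * k) = 9 ^ k" by (simp add: power_mult)
    then have "B = 4 * K\<^sup>2 * (9 ^ k * real_of_int R ^ (2 * k))"
      by (simp add: B_def power_mult_distrib power_mult[symmetric] mult.commute[of k])
    then show ?thesis by (simp add: power_add power2_eq_square algebra_simps)
  qed
  finally show ?thesis .
qed

text \<open>
  The side of the squares used at the \<open>j\<close>-th scale. The outer radius \<open>(k + 3) q
  n\<close> of one scale must not exceed the inner radius \<open>k q n'\<close> of the next one
  (\<open>scale_step\<close>), and yet \<open>k\<close> scales together may multiply the radius by a
  constant only (\<open>scale_power_le\<close>).
\<close>

primrec shell_scale :: "nat \<Rightarrow> nat \<Rightarrow> nat \<Rightarrow> nat" where
  "shell_scale k n 0 = n"
| "shell_scale k n (Suc j) = shell_scale k n j + (3 * shell_scale k n j) div k + 1"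

lemma scale_ge: "n \<le> shell_scale k n j"
  by (induction j) auto

lemma scale_step:
  assumes "k \<ge> 1"
  shows "(k + 3) * shell_scale k n j \<le> k * shell_scale k n (Suc j)"
proof -
  let ?s = "shell_scale k n j"
  have "3 * ?s = k * ((3 * ?s) div k) + (3 * ?s) mod k" by simp
  moreover have "(3 * ?s) mod k < k" using assms by simp
  ultimately have "3 * ?s \<le> k * ((3 * ?s) div k) + k" by linarith
  then show ?thesis by (simp add: algebra_simps)
qed

lemma scale_le:
  assumes "k \<ge> 1" "n \<ge> k"
  shows "real (shell_scale k n j) \<le> real n * (1 + 4 / real k) ^ j"
proof (induction j)
  case (Suc j)
  let ?s = "shell_scale k n j"
  have sk: "?s \<ge> k" using scale_ge[of n k j] assms by linarith
  have "real ((3 * ?s) div k) \<le> 3 * real ?s / real k" using of_nat_div_le_of_nat[of "3 * ?s" k, where 'a = real] by simp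
  moreover have "1 \<le> real ?s / real k" using sk assms by simp
  ultimately have "real (shell_scale k n (Suc j)) \<le> real ?s + 3 * (real ?s / real k) + real ?s / real k" by simp
  also have "\<dots> = real ?s * (1 + 4 / real k)" by (simp add: algebra_simps)
  also have "\<dots> \<le> real n * (1 + 4 / real k) ^ j * (1 + 4 / real k)"
    using Suc.IH by (intro mult_right_mono) auto
  finally show ?case by (simp add: mult_ac)
qed simp

lemma scale_power_le:
  assumes "k \<ge> 1" "n \<ge> k"
  shows "real (shell_scale k n j) ^ (2 * k + 2) \<le> real n ^ (2 * k + 2) * (3 ^ 16) ^ j"
proof -
  have base: "(1 + 4 / real k) ^ k \<le> 3 ^ 4"
  proof -
    have "(1 + 4 / real k) ^ k \<le> exp (4 / real k) ^ k"
      by (intro power_mono) (auto simp: exp_ge_add_one_self)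
    also have "\<dots> = exp 4" using assms(1) by (simp add: exp_of_nat_mult[symmetric])
    also have "\<dots> = exp 1 ^ 4" by (simp add: exp_of_nat_mult[symmetric])
    also have "\<dots> \<le> 3 ^ 4" using exp_le by (intro power_mono) auto
    finally show ?thesis .
  qed
  have "(1 + 4 / real k) ^ (2 * k + 2) \<le> (1 + 4 / real k) ^ (4 * k)"
    using assms(1) by (intro power_increasing) auto
  also have "\<dots> = ((1 + 4 / real k) ^ k) ^ 4" by (simp add: power_mult[symmetric] mult.commute)
  also have "\<dots> \<le> (3 ^ 4) ^ 4" using base by (intro power_mono) auto
  finally have b: "(1 + 4 / real k) ^ (2 * k + 2) \<le> 3 ^ 16" by simp
  have "real (shell_scale k n j) ^ (2 * k + 2) \<le> (real n * (1 + 4 / real k) ^ j) ^ (2 * k + 2)"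
    using scale_le[OF assms] by (intro power_mono) auto
  also have "\<dots> = real n ^ (2 * k + 2) * ((1 + 4 / real k) ^ (2 * k + 2)) ^ j"
    by (simp only: power_mult_distrib power_mult[symmetric] mult.commute)
  also have "\<dots> \<le> real n ^ (2 * k + 2) * (3 ^ 16) ^ j"
    using b by (intro mult_left_mono power_mono) auto
  finally show ?thesis .
qed

text \<open>
  The factor by which the energy form shrinks at each scale is the square of this number. It has to
  beat the growth of the energy, which is \<open>9 * 3^16\<close> per scale (\<open>9\<close> from
  the coefficients, \<open>3^16\<close> from the radius), and the factor \<open>4\<close> lost in
  \<open>entropy_step\<close>.
\<close>

definition entropy_base :: nat where "entropy_base = 3 ^ 11"

definition harmonic_constant :: nat where
  "harmonic_constant = (entropy_base + 2) * (24 * ((shell_constant + 1) * entropy_base)\<^sup>2)"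

text \<open>
  On functions that vanish at one point, the energies within large radii control the values at any
  finite number of points; in particular they are definite on finite-dimensional spaces.
\<close>

lemma harmonic_vanishing_at_origin_spanned:
  assumes k: "k \<ge> 1" and v0: "cell v0 = 0"
  shows "spanned_by (harmonic_constant * k) {f \<in> polynomial_harmonic k. f v0 = 0}"
proof (rule ccontr)
  assume not_spanned: "\<not> ?thesis"
  define W where "W = {f \<in> polynomial_harmonic k. f v0 = 0}"
  have subW: "subspace W"
    using subspace_polynomial_harmonic[of k] unfolding subspace_def W_def by (auto simp: scaleR_fun_def)
  define D where "D = entropy_base"
  define q where "q = (shell_constant + 1) * D"
  define m where "m = 24 * q\<^sup>2 * k"
  define N where "N = (D + 2) * m"
  have Neq: "harmonic_constant * k = N"
    by (simp only: harmonic_constant_def N_def m_def q_def D_def mult.assoc)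
  have D1: "D \<ge> 1" by (simp add: D_def entropy_base_def)
  have q1: "q \<ge> 1" using D1 by (simp add: q_def)
  have "\<not> spanned_by N W" using not_spanned Neq by (simp add: W_def)
  from dual_points_of_not_spanned[OF subW this]
  obtain x f where fW: "\<And>i. i \<le> N \<Longrightarrow> f i \<in> W"
    and fx: "\<And>i j. i \<le> N \<Longrightarrow> j \<le> N \<Longrightarrow> f i (x j) = (if i = j then 1 else (0::real))"
    by (elim exE conjE) blast
  define F where "F = f ` {..N}"
  have finF: "finite F" by (simp add: F_def)
  have FW: "span F \<subseteq> W" using fW subW by (intro span_minimal) (auto simp: F_def)
  have harm: "lap g y = 0" if "g \<in> span F" for g y
    using that FW by (auto simp: W_def polynomial_harmonic_def)
  have go: "g v0 = 0" if "g \<in> span F" for g using that FW by (auto simp: W_def)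
  have expand: "g = (\<Sum>i\<le>N. g (x i) *\<^sub>R f i)" if "g \<in> span F" for g
  proof -
    have T: "linear (\<lambda>g. \<Sum>i\<le>N. g (x i) *\<^sub>R f i)"
      by (rule linearI) (simp_all add: scaleR_fun_apply scaleR_add_left sum.distrib scaleR_sum_right)
    have "subspace {g. g = (\<Sum>i\<le>N. g (x i) *\<^sub>R f i)}"
      by (rule subspace_fixed_points[OF T])
    moreover have "F \<subseteq> {g. g = (\<Sum>i\<le>N. g (x i) *\<^sub>R f i)}"
    proof
      fix h assume "h \<in> F"
      then obtain j where j: "j \<le> N" "h = f j" by (auto simp: F_def)
      have "(\<Sum>i\<le>N. f j (x i) *\<^sub>R f i) = (\<Sum>i\<le>N. if i = j then f i else 0)"
        using j fx by (intro sum.cong) auto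
      then show "h \<in> {g. g = (\<Sum>i\<le>N. g (x i) *\<^sub>R f i)}" using j by simp
    qed
    ultimately have "span F \<subseteq> {g. g = (\<Sum>i\<le>N. g (x i) *\<^sub>R f i)}" by (intro span_minimal)
    then show ?thesis using that by blast
  qed
  \<comment> \<open>the smallest radius is so large that the box contains paths from the origin to all points \<open>x i\<close>\<close>
  have "\<exists>l. (v0, x i) \<in> E ^^ l" for i
    using path_length_le[of "v0" "x i" "nat (sup_norm (cell v0 - cell (x i)))"] by auto
  then obtain len where len: "\<And>i. (v0, x i) \<in> E ^^ len i" by metis
  define L where "L = (\<Sum>i\<le>N. len i)"
  have lenL: "len i \<le> L" if "i \<le> N" for i unfolding L_def using that by (intro member_le_sum) auto
  define n0 where "n0 = M + 1 + k + L"
  define n where "n j = shell_scale k n0 j" for j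
  define R where "R j = int (k * q * n j)" for j
  have n_ge: "n0 \<le> n j" for j unfolding n_def by (rule scale_ge)
  have R_ge: "int L \<le> R j" for j
  proof -
    have "L \<le> n j" using n_ge[of j] by (simp add: n0_def)
    also have "\<dots> \<le> k * q * n j" using k q1 by simp
    finally show ?thesis unfolding R_def by (simp only: of_nat_le_iff)
  qed
  have point_values: "\<bar>g (x i)\<bar> \<le> L * sqrt (energy g (R 0))" if "g \<in> span F" "i \<le> N" for g i
  proof -
    have "\<bar>g (x i) - g v0\<bar> \<le> len i * sqrt (energy g (R 0))"
      using path_gradient[OF len[of i], of 0 "R 0" g] v0 lenL[OF that(2)] R_ge[of 0] by (simp add: energy_def)
    also have "\<dots> \<le> L * sqrt (energy g (R 0))" using lenL[OF that(2)] by (intro mult_right_mono) auto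
    finally show ?thesis using go[OF that(1)] by simp
  qed
  have pos: "energy_form (R 0) g g > 0" if "g \<in> span F" "g \<noteq> 0" for g
  proof (rule ccontr)
    assume "\<not> ?thesis"
    then have "energy g (R 0) = 0" using energy_nonneg[of g "R 0"] by (simp add: energy_form_self)
    then have "g (x i) = 0" if "i \<le> N" for i using point_values[OF \<open>g \<in> span F\<close> that] by simp
    then have "g = 0" using expand[OF that(1)] by simp
    then show False using that by simp
  qed
  have Rmono: "(k + 3) * q * n j \<le> k * q * n (Suc j)" for j
    using mult_le_mono2[OF scale_step[OF k, of n0 j], of q] by (simp only: n_def mult_ac)
  have contr: "energy_form (R j) g g \<le> energy_form (R (Suc j)) g g / (real D)\<^sup>2"
    if g: "g \<in> span F" and z: "\<forall>l\<in>square_sum (n j) ` shell_squares k q. l g = 0" for j g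
  proof -
    have "energy g (R j) * (real q)\<^sup>2 \<le> shell_constant * energy g (int ((k + 3) * q * n j))"
      unfolding R_def
    proof (rule shell_energy_decay[OF k q1])
      show "M + 1 \<le> n j" using n_ge[of j] by (simp add: n0_def)
    qed (use harm[OF g] z in auto)
    also have "\<dots> \<le> shell_constant * energy g (R (Suc j))"
      unfolding R_def using Rmono[of j] by (intro mult_left_mono energy_mono) (simp_all only: of_nat_le_iff of_nat_0_le_iff)
    finally have a1: "energy g (R j) * (real q)\<^sup>2 \<le> shell_constant * energy g (R (Suc j))" .
    have a2: "(real q)\<^sup>2 = (real shell_constant + 1)\<^sup>2 * (real D)\<^sup>2"
      by (simp only: q_def of_nat_mult of_nat_add of_nat_1 power_mult_distrib)
    have "real shell_constant \<le> (real shell_constant + 1)\<^sup>2" by (simp add: power2_eq_square algebra_simps)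
    then have a3: "shell_constant * energy g (R (Suc j)) \<le> (real shell_constant + 1)\<^sup>2 * energy g (R (Suc j))"
      by (intro mult_right_mono) auto
    have "(real shell_constant + 1)\<^sup>2 * (energy g (R j) * (real D)\<^sup>2) = energy g (R j) * (real q)\<^sup>2"
      by (simp only: a2 mult_ac)
    then have "(real shell_constant + 1)\<^sup>2 * (energy g (R j) * (real D)\<^sup>2) \<le> (real shell_constant + 1)\<^sup>2 * energy g (R (Suc j))"
      using a1 a3 by linarith
    then have "energy g (R j) * (real D)\<^sup>2 \<le> energy g (R (Suc j))"
      by (subst (asm) mult_le_cancel_left_pos) (simp_all add: add_nonneg_pos)
    then show ?thesis using D1 by (simp add: energy_form_self field_simps)
  qed
  have "\<exists>K. \<forall>y. \<bar>f i y\<bar> \<le> K * (1 + rad y) ^ k" if "i \<le> N" for i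
    using fW[OF that] by (auto simp: W_def polynomial_harmonic_def)
  then obtain Ki where Ki: "\<And>i y. i \<le> N \<Longrightarrow> \<bar>f i y\<bar> \<le> Ki i * (1 + rad y) ^ k" by metis
  define K where "K = (\<Sum>i\<le>N. Ki i)"
  define C where "C = K\<^sup>2 * (324 * (real P)\<^sup>2 * 9 ^ k)"
  have C0: "C \<ge> 0" by (simp add: C_def)
  have growth: "energy g (R J) \<le> A\<^sup>2 * C * real (k * q * n J) ^ (2 * k + 2)"
    if g: "g \<in> span F" and A: "\<And>i. i \<le> N \<Longrightarrow> \<bar>g (x i)\<bar> \<le> A" for g A J
  proof -
    have "\<bar>g y\<bar> \<le> (A * K) * (1 + rad y) ^ k" for y
    proof -
      have "g y = (\<Sum>i\<le>N. g (x i) * f i y)" by (subst expand[OF g]) (simp add: sum_fun_apply scaleR_fun_apply)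
      then have "\<bar>g y\<bar> \<le> (\<Sum>i\<le>N. \<bar>g (x i)\<bar> * \<bar>f i y\<bar>)" by (simp add: abs_mult[symmetric])
      also have "\<dots> \<le> (\<Sum>i\<le>N. A * (Ki i * (1 + rad y) ^ k))"
        using A Ki by (intro sum_mono mult_mono) (auto intro: order_trans[OF abs_ge_zero])
      finally show ?thesis by (simp add: K_def sum_distrib_left sum_distrib_right mult_ac)
    qed
    moreover have "R J \<ge> 1"
    proof -
      have "1 \<le> k * q * n J" using n_ge[of J] k q1 by (simp add: n0_def)
      then have "int 1 \<le> R J" unfolding R_def by (simp only: of_nat_le_iff)
      then show ?thesis by simp
    qed
    ultimately have "energy g (R J) \<le> (A * K)\<^sup>2 * (324 * (real P)\<^sup>2 * 9 ^ k) * real_of_int (R J) ^ (2 * k + 2)"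
      by (rule energy_growth)
    moreover have "real_of_int (R J) = real (k * q * n J)" unfolding R_def by (rule of_int_of_nat_eq)
    ultimately show ?thesis by (simp only: C_def power_mult_distrib mult.assoc)
  qed
  define C' where "C' = C * real (k * q * n0) ^ (2 * k + 2)"
  have C'0: "C' \<ge> 0" using C0 by (simp add: C'_def)
  \<comment> \<open>with this many scales, the survivors of the descent differ by less than 1 at each of the points \<open>x i\<close>\<close>
  obtain J where J: "(real L + 1)\<^sup>2 * C' * (1/3) ^ J < 1" "J \<ge> 1"
  proof -
    have "(\<lambda>J. (real L + 1)\<^sup>2 * C' * (1/3::real) ^ J) \<longlonglongrightarrow> (real L + 1)\<^sup>2 * C' * 0"
      by (intro tendsto_intros LIMSEQ_realpow_zero) auto
    then have "\<forall>\<^sub>F J in sequentially. (real L + 1)\<^sup>2 * C' * (1/3::real) ^ J < 1"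
      by (rule order_tendstoD) simp
    then obtain J0 where "\<And>J. J \<ge> J0 \<Longrightarrow> (real L + 1)\<^sup>2 * C' * (1/3::real) ^ J < 1"
      by (auto simp: eventually_sequentially)
    then show ?thesis using that[of "max J0 1"] by simp
  qed
  define coef where "coef = ({..N} \<rightarrow>\<^sub>E {..<(3::nat) ^ J})"
  define comb where "comb a = (\<Sum>i\<le>N. real (a i) *\<^sub>R f i)" for a :: "nat \<Rightarrow> nat"
  define X where "X = comb ` coef"
  have combx: "comb a (x j) = real (a j)" if "j \<le> N" for a j
  proof -
    have "comb a (x j) = (\<Sum>i\<le>N. if i = j then real (a i) else 0)"
      unfolding comb_def sum_fun_apply scaleR_fun_apply using fx that by (intro sum.cong) auto
    then show ?thesis using that by simp
  qed
  have combF: "comb a \<in> span F" for a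
    unfolding comb_def by (intro span_sum span_scale span_base) (auto simp: F_def)
  have fin_coef: "finite coef" by (simp add: coef_def finite_PiE)
  have inj: "inj_on comb coef"
  proof (rule inj_onI)
    fix a a' assume a: "a \<in> coef" "a' \<in> coef" "comb a = comb a'"
    have "a j = a' j" if "j \<in> {..N}" for j using combx[of j a] combx[of j a'] a(3) that by simp
    then show "a = a'" using a(1,2) unfolding coef_def by (intro PiE_ext) auto
  qed
  have cardX: "card X = (3 ^ J) ^ (N + 1)"
  proof -
    have "card coef = (3 ^ J) ^ (N + 1)" by (simp add: coef_def card_PiE)
    then show ?thesis using card_image[OF inj] by (simp add: X_def)
  qed
  define \<rho> where "\<rho> = (3 ^ J)\<^sup>2 * C * real (k * q * n J) ^ (2 * k + 2)"
  have Xb: "energy_form (R J) (y - z) (y - z) \<le> \<rho>" if yz: "y \<in> X" "z \<in> X" for y z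
  proof -
    obtain a a' where a: "a \<in> coef" "a' \<in> coef" "y = comb a" "z = comb a'" using yz by (auto simp: X_def)
    have "\<bar>(y - z) (x i)\<bar> \<le> 3 ^ J" if "i \<le> N" for i
    proof -
      have "a i < 3 ^ J" "a' i < 3 ^ J" using a(1,2) that by (auto simp: coef_def PiE_iff)
      then have "real (a i) < real (3 ^ J)" "real (a' i) < real (3 ^ J)" by (simp_all only: of_nat_less_iff)
      then have "\<bar>real (a i) - real (a' i)\<bar> \<le> real (3 ^ J)"
        using of_nat_0_le_iff[of "a i", where 'a = real] of_nat_0_le_iff[of "a' i", where 'a = real] by linarith
      then show ?thesis using combx[OF that] a(3,4) by simp
    qed
    then show ?thesis
      unfolding energy_form_self \<rho>_def a(3,4) using combF by (intro growth span_diff) auto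
  qed
  have "\<exists>X'\<subseteq>X. card X \<le> ((3 * 2 ^ (D + 1)) ^ m) ^ J * card X' \<and>
      (\<forall>y\<in>X'. \<forall>z\<in>X'. energy_form (R 0) (y - z) (y - z) \<le> \<rho> * (4 / (real D)\<^sup>2) ^ J)"
  proof (rule entropy_iterated[where F = F and b = "\<lambda>j. energy_form (R j)" and L = "\<lambda>j. square_sum (n j) ` shell_squares k q"])
    show "energy_form (R j) g g \<le> energy_form (R (Suc j)) g g" for j g
    proof -
      have "n j \<le> n (Suc j)" by (simp add: n_def)
      then have "R j \<le> R (Suc j)" unfolding R_def of_nat_le_iff by (rule mult_le_mono2)
      then show ?thesis by (simp add: energy_form_self energy_mono)
    qed
    show "card (square_sum (n j) ` shell_squares k q) \<le> m" for j
      using card_image_le[OF finite_shell_squares, of "square_sum (n j)"] card_shell_squares[OF k q1]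
      unfolding m_def by (meson order_trans)
    show "X \<subseteq> span F" using combF by (auto simp: X_def)
  qed (use D1 pos contr Xb finF fin_coef in \<open>auto simp: bilinear_energy_form energy_form_commute energy_form_self linear_square_sum X_def\<close>)
  then obtain X' where X': "X' \<subseteq> X" "card X \<le> ((3 * 2 ^ (D + 1)) ^ m) ^ J * card X'"
    "\<And>y z. y \<in> X' \<Longrightarrow> z \<in> X' \<Longrightarrow> energy_form (R 0) (y - z) (y - z) \<le> \<rho> * (4 / (real D)\<^sup>2) ^ J" by blast
  have \<rho>small: "\<rho> * (4 / (real D)\<^sup>2) ^ J \<le> C' * (1/3) ^ J"
  proof -
    have "real (k * q * n J) ^ (2 * k + 2) = real (k * q) ^ (2 * k + 2) * real (n J) ^ (2 * k + 2)"
      by (simp only: of_nat_mult power_mult_distrib)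
    also have "\<dots> \<le> real (k * q) ^ (2 * k + 2) * (real n0 ^ (2 * k + 2) * (3 ^ 16) ^ J)"
      unfolding n_def using k by (intro mult_left_mono scale_power_le) (auto simp: n0_def)
    also have "\<dots> = real (k * q * n0) ^ (2 * k + 2) * (3 ^ 16) ^ J"
      by (simp only: of_nat_mult power_mult_distrib mult.assoc)
    finally have "\<rho> \<le> (3 ^ J)\<^sup>2 * C * (real (k * q * n0) ^ (2 * k + 2) * (3 ^ 16) ^ J)"
      unfolding \<rho>_def using C0 by (intro mult_left_mono) auto
    also have "\<dots> = C' * (9 * 3 ^ 16) ^ J"
    proof -
      have "((3::real) ^ J)\<^sup>2 = 9 ^ J" by (simp add: power2_eq_square power_mult_distrib[symmetric])
      then show ?thesis by (simp only: C'_def power_mult_distrib mult_ac)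
    qed
    finally have "\<rho> * (4 / (real D)\<^sup>2) ^ J \<le> C' * (9 * 3 ^ 16) ^ J * (4 / (real D)\<^sup>2) ^ J"
      by (intro mult_right_mono) auto
    also have "\<dots> = C' * (9 * 3 ^ 16 * (4 / (real D)\<^sup>2)) ^ J" by (simp only: power_mult_distrib mult.assoc)
    also have "\<dots> \<le> C' * (1/3) ^ J"
      using C'0 by (intro mult_left_mono power_mono) (auto simp: D_def entropy_base_def)
    finally show ?thesis .
  qed
  have single: "y = z" if yz: "y \<in> X'" "z \<in> X'" for y z
  proof -
    have ys: "y - z \<in> span F" using yz X'(1) combF by (auto simp: X_def intro!: span_diff)
    have "energy (y - z) (R 0) \<le> C' * (1/3) ^ J"
      using X'(3)[OF yz] \<rho>small by (simp add: energy_form_self)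
    then have "(real L + 1)\<^sup>2 * energy (y - z) (R 0) \<le> (real L + 1)\<^sup>2 * (C' * (1/3) ^ J)" by (intro mult_left_mono) auto
    then have lt: "(real L + 1)\<^sup>2 * energy (y - z) (R 0) < 1"
      by (rule order.strict_trans1) (use J(1) in \<open>simp only: mult.assoc\<close>)
    have small: "\<bar>(y - z) (x i)\<bar> < 1" if "i \<le> N" for i
    proof -
      have "\<bar>(y - z) (x i)\<bar> \<le> L * sqrt (energy (y - z) (R 0))" by (rule point_values[OF ys that])
      also have "\<dots> \<le> (real L + 1) * sqrt (energy (y - z) (R 0))" by (intro mult_right_mono) auto
      also have "\<dots> = sqrt ((real L + 1)\<^sup>2 * energy (y - z) (R 0))" by (simp add: real_sqrt_mult)
      also have "\<dots> < 1" using lt by simp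
      finally show ?thesis .
    qed
    obtain a a' where a: "a \<in> coef" "a' \<in> coef" "y = comb a" "z = comb a'" using yz X'(1) unfolding X_def by blast
    have "a i = a' i" if "i \<in> {..N}" for i
    proof -
      have "\<bar>real (a i) - real (a' i)\<bar> < 1" using small[of i] that combx[of i] a(3,4) by simp
      then show ?thesis by linarith
    qed
    then have "a = a'" using a(1,2) unfolding coef_def by (intro PiE_ext) auto
    then show "y = z" using a by simp
  qed
  have "card X' \<le> 1"
  proof (cases "X' = {}")
    case False
    then obtain y where "y \<in> X'" by blast
    then have "X' \<subseteq> {y}" using single by blast
    then show ?thesis using card_mono[of "{y}" X'] by simp
  qed simp
  then have "(3 ^ J) ^ (N + 1) \<le> ((3 * 2 ^ (D + 1)) ^ m) ^ J * (1::nat)"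
    using X'(2) unfolding cardX by (meson mult_le_mono2 order_trans)
  also have "\<dots> \<le> ((3 * 3 ^ (D + 1)) ^ m) ^ J"
    by (simp only: mult_1_right) (intro power_mono mult_left_mono; simp)
  also have "\<dots> = 3 ^ (J * N)"
    by (simp add: N_def power_mult[symmetric] power_Suc[symmetric] mult_ac del: power_Suc)
  finally have "(3::nat) ^ (J * (N + 1)) \<le> 3 ^ (J * N)" by (simp only: power_mult)
  then have "J * (N + 1) \<le> J * N" by (rule power_le_imp_le_exp[rotated]) simp
  then show False using J(2) by simp
qed

lemma harmonic_spanned:
  assumes k: "k \<ge> 1"
  shows "spanned_by (harmonic_constant * k + 1) (polynomial_harmonic k)"
proof -
  obtain v0 where v0: "cell v0 = 0" using fibre_nonempty by blast
  obtain B where B: "finite B" "card B \<le> harmonic_constant * k" "{f \<in> polynomial_harmonic k. f v0 = 0} \<subseteq> span B"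
    using harmonic_vanishing_at_origin_spanned[OF k v0] by (auto simp: spanned_by_def)
  define one where "one = (\<lambda>x::'v. 1::real)"
  have "polynomial_harmonic k \<subseteq> span (insert one B)"
  proof
    fix f assume f: "f \<in> polynomial_harmonic k"
    have "one \<in> polynomial_harmonic k"
      unfolding polynomial_harmonic_def one_def graph_laplacian_def by (auto intro!: exI[of _ 1])
    then have "f - f v0 *\<^sub>R one \<in> polynomial_harmonic k"
      using f subspace_polynomial_harmonic[of k] by (intro subspace_diff subspace_scale)
    then have "f - f v0 *\<^sub>R one \<in> span B" using B(3) by (auto simp: one_def scaleR_fun_def)
    then have "f - f v0 *\<^sub>R one \<in> span (insert one B)" by (meson span_mono subsetD subset_insertI)
    moreover have "f v0 *\<^sub>R one \<in> span (insert one B)" by (intro span_scale span_base) simp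
    ultimately have "(f - f v0 *\<^sub>R one) + f v0 *\<^sub>R one \<in> span (insert one B)" by (rule span_add)
    then show "f \<in> span (insert one B)" by simp
  qed
  moreover have "card (insert one B) \<le> harmonic_constant * k + 1" using B(1,2) by (simp add: card_insert_if)
  ultimately show ?thesis unfolding spanned_by_def using B(1) by (intro exI[of _ "insert one B"]) simp
qed

theorem ancient_spanned:
  assumes k: "k \<ge> 1"
  shows "spanned_by (4 * (harmonic_constant + 1) * k\<^sup>2) (polynomial_ancient k)"
proof -
  have "(2 * k + 2) * (harmonic_constant * k + 1) \<le> (4 * k) * ((harmonic_constant + 1) * k)"
    using k by (intro mult_le_mono) auto
  then show ?thesis
    using ancient_spanned_by_harmonic[OF harmonic_spanned[OF k]]
    by (elim spanned_by_mono) (simp_all only: power2_eq_square mult_ac order_refl)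
qed

end

section \<open>Geometry of penny graphs\<close>

locale penny_graph =
  fixes c :: "nat \<Rightarrow> complex"
  assumes configuration: "penny_configuration c"
begin

abbreviation E where "E \<equiv> penny_edges c"

abbreviation G where "G \<equiv> embedded_graph c"

abbreviation seg where "seg i j \<equiv> closed_segment (c i) (c j)"

lemma dist_ge_1: "i \<noteq> j \<Longrightarrow> dist (c i) (c j) \<ge> 1"
proof (rule ccontr)
  assume ij: "i \<noteq> j" and "\<not> dist (c i) (c j) \<ge> 1"
  then have "midpoint (c i) (c j) \<in> ball (c i) (1/2) \<inter> ball (c j) (1/2)"
    by (simp add: dist_midpoint)
  moreover have "ball (c i) (1/2) \<inter> ball (c j) (1/2) = {}"
    using configuration ij by (simp add: penny_configuration_def disjoint_family_on_def)
  ultimately show False by blast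
qed

lemma edge_sym: "(i, j) \<in> E \<Longrightarrow> (j, i) \<in> E"
  by (simp add: penny_edges_def Int_commute)

lemma edge_neq: "(i, j) \<in> E \<Longrightarrow> i \<noteq> j"
proof
  assume ij: "(i, j) \<in> E" "i = j"
  then obtain p where "sphere (c i) (1/2) = {p}" by (auto simp: penny_edges_def)
  moreover have "c i + 1/2 \<in> sphere (c i) (1/2)" "c i - 1/2 \<in> sphere (c i) (1/2)" by (auto simp: dist_norm)
  ultimately have "c i + 1/2 = p" "c i - 1/2 = p" by (simp_all only: singleton_iff)
  then have "c i + 1/2 = c i - 1/2" by (simp only:)
  then show False by simp
qed

lemma edge_dist: "(i, j) \<in> E \<Longrightarrow> dist (c i) (c j) = 1"
proof -
  assume ij: "(i, j) \<in> E"
  then obtain p where "sphere (c i) (1/2) \<inter> sphere (c j) (1/2) = {p}" unfolding penny_edges_def by blast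
  then have "p \<in> sphere (c i) (1/2)" "p \<in> sphere (c j) (1/2)" by blast+
  then have "dist (c i) (c j) \<le> 1" using dist_triangle[of "c i" "c j" p] by (simp add: dist_commute)
  then show ?thesis using dist_ge_1[OF edge_neq[OF ij]] by simp
qed

lemma inj_c: "c i = c j \<longleftrightarrow> i = j"
  using dist_ge_1[of i j] by fastforce

text \<open>
  A square of side \<open>1/2\<close> contains at most one vertex.
\<close>

lemma finite_vertices_box: "finite {i. \<bar>Re (c i) - x\<bar> \<le> real s \<and> \<bar>Im (c i) - y\<bar> \<le> real s}" (is "finite ?A")
  and card_vertices_box: "card {i. \<bar>Re (c i) - x\<bar> \<le> real s \<and> \<bar>Im (c i) - y\<bar> \<le> real s} \<le> (4 * s + 1)\<^sup>2"
proof -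
  define g where "g i = (\<lfloor>2 * Re (c i)\<rfloor>, \<lfloor>2 * Im (c i)\<rfloor>)" for i
  define T where "T x = {\<lfloor>2 * x\<rfloor> - 2 * int s..\<lfloor>2 * x\<rfloor> + 2 * int s}" for x :: real
  have inj: "inj g"
  proof (rule injI)
    fix i j assume "g i = g j"
    then have "\<bar>2 * Re (c i) - 2 * Re (c j)\<bar> \<le> 1" "\<bar>2 * Im (c i) - 2 * Im (c j)\<bar> \<le> 1"
      unfolding g_def by simp_all linarith+
    then have "\<bar>Re (c i - c j)\<bar> \<le> 1/2" "\<bar>Im (c i - c j)\<bar> \<le> 1/2" unfolding minus_complex.sel by linarith+
    then have "\<bar>Re (c i - c j)\<bar>\<^sup>2 \<le> (1/2)\<^sup>2" "\<bar>Im (c i - c j)\<bar>\<^sup>2 \<le> (1/2)\<^sup>2" by (intro power_mono; simp)+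
    then have "(Re (c i - c j))\<^sup>2 + (Im (c i - c j))\<^sup>2 \<le> 1/2" unfolding power2_abs by (simp add: power_divide)
    then have "(norm (c i - c j))\<^sup>2 \<le> 1/2" unfolding cmod_power2 .
    then have "\<not> norm (c i - c j) \<ge> 1" using one_le_power[of "norm (c i - c j)" 2] by linarith
    then show "i = j" using dist_ge_1[of i j] by (auto simp: dist_norm)
  qed
  have sub: "g ` ?A \<subseteq> T x \<times> T y"
  proof -
    have "\<lfloor>2 * a\<rfloor> \<in> T b" if "\<bar>a - b\<bar> \<le> real s" for a b
    proof -
      have "2 * a \<le> 2 * b + real_of_int (2 * int s)" "2 * b - real_of_int (2 * int s) \<le> 2 * a" using that by auto
      then have "\<lfloor>2 * a\<rfloor> \<le> \<lfloor>2 * b + real_of_int (2 * int s)\<rfloor>" "\<lfloor>2 * b - real_of_int (2 * int s)\<rfloor> \<le> \<lfloor>2 * a\<rfloor>"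
        by (simp_all only: floor_mono)
      then show ?thesis unfolding T_def by (simp only: floor_add_int[symmetric] floor_diff_of_int atLeastAtMost_iff)
    qed
    then show ?thesis by (auto simp: g_def)
  qed
  have finT: "finite (T x \<times> T y)" by (simp add: T_def)
  have injA: "inj_on g ?A" using inj by (rule inj_on_subset) simp
  show "finite ?A" by (rule finite_imageD[OF finite_subset[OF sub finT] injA])
  have "card ?A = card (g ` ?A)" by (rule card_image[OF injA, symmetric])
  also have "\<dots> \<le> card (T x \<times> T y)" using sub finT by (rule card_mono[rotated])
  also have "card (T z) = 4 * s + 1" for z by (simp add: T_def)
  then have "card (T x \<times> T y) = (4 * s + 1)\<^sup>2" by (simp add: card_cartesian_product power2_eq_square)
  finally show "card ?A \<le> (4 * s + 1)\<^sup>2" .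
qed

lemma dist_box: "dist a b \<le> r \<Longrightarrow> \<bar>Re a - Re b\<bar> \<le> r \<and> \<bar>Im a - Im b\<bar> \<le> r"
  using abs_Re_le_cmod[of "a - b"] abs_Im_le_cmod[of "a - b"] by (simp add: dist_norm)

lemma finite_vertices_near: "finite {i. dist (c i) p \<le> real s}"
  and card_vertices_near: "card {i. dist (c i) p \<le> real s} \<le> (4 * s + 1)\<^sup>2"
proof -
  have sub: "{i. dist (c i) p \<le> real s} \<subseteq> {i. \<bar>Re (c i) - Re p\<bar> \<le> real s \<and> \<bar>Im (c i) - Im p\<bar> \<le> real s}"
    using dist_box by blast
  show "finite {i. dist (c i) p \<le> real s}" using sub finite_vertices_box by (rule finite_subset)
  show "card {i. dist (c i) p \<le> real s} \<le> (4 * s + 1)\<^sup>2"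
    using card_mono[OF finite_vertices_box sub] card_vertices_box[of "Re p" s "Im p"] by linarith
qed

lemma on_unit_segment:
  fixes a b p :: complex
  assumes "p \<in> closed_segment a b" "dist a b = 1"
  shows "p = a + dist a p *\<^sub>R (b - a)" "dist a p + dist p b = 1"
proof -
  obtain u where u: "0 \<le> u" "u \<le> 1" "p = (1 - u) *\<^sub>R a + u *\<^sub>R b" using assms(1) by (auto simp: closed_segment_def)
  have p: "p = a + u *\<^sub>R (b - a)" using u(3) by (simp add: algebra_simps)
  have "dist a p = u" using u(1) assms(2) by (simp add: p dist_norm norm_minus_commute)
  then show "p = a + dist a p *\<^sub>R (b - a)" using p by simp
  show "dist a p + dist p b = 1" using assms between[of a b p] by (simp add: between_mem_segment)
qed

lemma edge_segment_length: "(i, j) \<in> E \<Longrightarrow> p \<in> seg i j \<Longrightarrow> dist (c i) p + dist p (c j) = 1"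
  using on_unit_segment(2) edge_dist by blast

lemma vertex_on_edge:
  assumes "(i, j) \<in> E" "c k \<in> seg i j"
  shows "k = i \<or> k = j"
  using edge_segment_length[OF assms] dist_ge_1[of i k] dist_ge_1[of k j] by fastforce

text \<open>
  If \<open>c i\<close> and \<open>c k\<close> are the endpoints nearest to \<open>p\<close> and are
  different, then \<open>1 \<le> dist (c i) (c k) \<le> 1/2 + 1/2\<close>, so that \<open>p\<close>
  is the midpoint of both edges and of \<open>c i\<close> and \<open>c k\<close>.
\<close>

lemma edges_meet_at_vertices_near:
  assumes e: "(i, j) \<in> E" "(k, l) \<in> E"
    and p: "p \<in> seg i j" "p \<in> seg k l"
    and d: "dist (c i) p \<le> 1/2" "dist (c k) p \<le> 1/2"
  shows "{i, j} = {k, l} \<or> (\<exists>v\<in>{i, j} \<inter> {k, l}. p = c v)"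
proof (cases "i = k")
  case True
  have 1: "p = c i + dist (c i) p *\<^sub>R (c j - c i)" by (rule on_unit_segment(1)[OF p(1) edge_dist[OF e(1)]])
  have 2: "p = c i + dist (c i) p *\<^sub>R (c l - c i)"
    using on_unit_segment(1)[OF p(2) edge_dist[OF e(2)]] True by simp
  show ?thesis
  proof (cases "p = c i")
    case False
    then have "dist (c i) p \<noteq> 0" by simp
    moreover have "dist (c i) p *\<^sub>R (c j - c i) = dist (c i) p *\<^sub>R (c l - c i)" using 1 2 by (metis add_left_imp_eq)
    ultimately have "c j = c l" by simp
    then show ?thesis using True inj_c by auto
  qed (use True in auto)
next
  case False
  have tri: "dist (c i) (c k) \<le> dist (c i) p + dist (c k) p" by (metis dist_commute dist_triangle)
  have ge: "1 \<le> dist (c i) (c k)" by (rule dist_ge_1[OF False])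
  have h: "dist (c i) p = 1/2" "dist (c k) p = 1/2" "dist (c i) (c k) = 1" using tri ge d by linarith+
  have "p \<in> seg i k"
    using h between[of "c i" "c k" p] by (simp add: between_mem_segment dist_commute)
  then have pk: "p = c i + (1/2) *\<^sub>R (c k - c i)" using on_unit_segment(1) h by metis
  have pj: "p = c i + (1/2) *\<^sub>R (c j - c i)" using on_unit_segment(1)[OF p(1) edge_dist[OF e(1)]] h(1) by simp
  have pl: "p = c k + (1/2) *\<^sub>R (c l - c k)" using on_unit_segment(1)[OF p(2) edge_dist[OF e(2)]] h(2) by simp
  have "(1/2::real) *\<^sub>R (c k - c i) = (1/2) *\<^sub>R (c j - c i)" using pk pj by (metis add_left_imp_eq)
  then have kj: "c k = c j" by simp
  have "2 * p = c i + c k" using pk by (simp add: scaleR_conv_of_real field_simps)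
  moreover have "2 * p = c k + c l" using pl by (simp add: scaleR_conv_of_real field_simps)
  ultimately have "c l = c i" by (simp add: add.commute)
  then show ?thesis using kj inj_c by auto
qed

lemma edges_meet_at_vertices:
  assumes e: "(i, j) \<in> E" "(k, l) \<in> E"
    and p: "p \<in> seg i j" "p \<in> seg k l"
  shows "{i, j} = {k, l} \<or> (\<exists>v\<in>{i, j} \<inter> {k, l}. p = c v)"
proof -
  have s: "p \<in> seg j i" "p \<in> seg l k" using p by (simp_all add: closed_segment_commute)
  have "dist (c i) p \<le> 1/2 \<or> dist (c j) p \<le> 1/2" using edge_segment_length[OF e(1) p(1)] dist_commute[of p "c j"] by linarith
  moreover have "dist (c k) p \<le> 1/2 \<or> dist (c l) p \<le> 1/2" using edge_segment_length[OF e(2) p(2)] dist_commute[of p "c l"] by linarith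
  ultimately show ?thesis
    using edges_meet_at_vertices_near[OF e p] edges_meet_at_vertices_near[OF edge_sym[OF e(1)] e(2) s(1) p(2)]
      edges_meet_at_vertices_near[OF e(1) edge_sym[OF e(2)] p(1) s(2)]
      edges_meet_at_vertices_near[OF edge_sym[OF e(1)] edge_sym[OF e(2)] s]
    by (auto simp: insert_commute)
qed

lemma in_graph_iff: "p \<in> G \<longleftrightarrow> (\<exists>i. p = c i) \<or> (\<exists>i j. (i, j) \<in> E \<and> p \<in> seg i j)"
  by (auto simp: embedded_graph_def)

text \<open>
  Close to any point, the graph is a star centred at this point (or empty).
\<close>

lemma star_neighbourhood:
  "\<exists>\<epsilon>>0. (\<forall>k. c k \<in> ball p \<epsilon> \<longrightarrow> c k = p) \<and>
    (\<forall>i j q. (i, j) \<in> E \<longrightarrow> q \<in> seg i j \<longrightarrow> q \<in> ball p \<epsilon> \<longrightarrow> p \<in> seg i j)"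
proof -
  define N where "N = {i. dist (c i) p \<le> real 2}"
  have finN: "finite N" unfolding N_def by (rule finite_vertices_near)
  define \<F> where "\<F> = {S \<in> (\<lambda>k. {c k}) ` N \<union> (\<lambda>(i, j). seg i j) ` (N \<times> N). p \<notin> S}"
  have "finite \<F>" unfolding \<F>_def using finN by auto
  moreover have "closed S" if "S \<in> \<F>" for S using that unfolding \<F>_def by auto
  ultimately have "closed (\<Union>\<F>)" by blast
  then have "open (- \<Union>\<F>)" by auto
  moreover have "p \<in> - \<Union>\<F>" by (auto simp: \<F>_def)
  ultimately obtain e where e: "e > 0" "ball p e \<subseteq> - \<Union>\<F>" by (metis openE)
  show ?thesis
  proof (intro exI[of _ "min e 1"] conjI allI impI)
    show "min e 1 > 0" using e by simp
    fix k assume k: "c k \<in> ball p (min e 1)"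
    then have "k \<in> N" by (simp add: N_def dist_commute)
    moreover have "{c k} \<notin> \<F>" using k e(2) by auto
    ultimately show "c k = p" by (auto simp: \<F>_def)
  next
    fix i j q assume ij: "(i, j) \<in> E" and q: "q \<in> seg i j" "q \<in> ball p (min e 1)"
    have "dist (c i) q + dist q (c j) = 1" by (rule edge_segment_length[OF ij q(1)])
    then have "dist (c i) q \<le> 1" "dist (c j) q \<le> 1" 
      using zero_le_dist[of q "c j"] zero_le_dist[of "c i" q] dist_commute[of q "c j"] by linarith+
    moreover have "dist q p \<le> 1" using q(2) by (simp add: dist_commute)
    ultimately have "i \<in> N" "j \<in> N"
      using dist_triangle[of "c i" p q] dist_triangle[of "c j" p q] by (simp_all add: N_def)
    moreover have "seg i j \<notin> \<F>" using q e(2) by auto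
    ultimately show "p \<in> seg i j" by (auto simp: \<F>_def)
  qed
qed

lemma closed_graph: "closed G"
  unfolding closed_def open_contains_ball
proof
  fix p assume p: "p \<in> - G"
  obtain \<epsilon> where \<epsilon>: "\<epsilon> > 0" "\<And>k. c k \<in> ball p \<epsilon> \<Longrightarrow> c k = p"
    "\<And>i j q. (i, j) \<in> E \<Longrightarrow> q \<in> seg i j \<Longrightarrow> q \<in> ball p \<epsilon> \<Longrightarrow> p \<in> seg i j"
    using star_neighbourhood[of p] by metis
  have "ball p \<epsilon> \<subseteq> - G"
  proof
    fix q assume q: "q \<in> ball p \<epsilon>"
    show "q \<in> - G" using p q \<epsilon>(2,3) unfolding Compl_iff in_graph_iff by metis
  qed
  then show "\<exists>e>0. ball p e \<subseteq> - G" using \<epsilon>(1) by blast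
qed

lemma segment_in_graph: "(i, j) \<in> E \<Longrightarrow> seg i j \<subseteq> G"
  by (auto simp: embedded_graph_def)

lemma vertex_in_graph: "c i \<in> G"
  by (auto simp: embedded_graph_def)

lemma connected_graph:
  assumes "penny_connected c" shows "connected G"
proof -
  have edge: "connected_component G (c i) p" if "(i, j) \<in> E" "p \<in> seg i j" for i j p
    unfolding connected_component_def using that segment_in_graph[OF that(1)] by (intro exI[of _ "seg i j"]) auto
  have vert: "connected_component G (c i) (c j)" for i j
  proof -
    have "(i, j) \<in> E\<^sup>*" using assms by (simp add: penny_connected_def)
    then show ?thesis
    proof (induction rule: rtrancl_induct)
      case base
      then show ?case using vertex_in_graph by simp
    next
      case (step k l)
      then show ?case using edge[of k l "c l"] connected_component_trans by fastforce
    qed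
  qed
  have "connected_component G (c 0) p" if "p \<in> G" for p
    using that vert edge connected_component_trans unfolding in_graph_iff by metis
  then show ?thesis
    unfolding connected_iff_connected_component using connected_component_sym connected_component_trans by metis
qed

end

context penny_graph begin

lemma face_open: "\<sigma> \<in> penny_faces c \<Longrightarrow> open \<sigma>"
  using open_components[of "- G" \<sigma>] closed_graph by (simp add: penny_faces_def open_Compl)

lemma face_disjoint: "\<sigma> \<in> penny_faces c \<Longrightarrow> \<sigma> \<inter> G = {}"
  using in_components_subset[of \<sigma> "- G"] by (auto simp: penny_faces_def)

lemma face_nonempty: "\<sigma> \<in> penny_faces c \<Longrightarrow> \<sigma> \<noteq> {}"
  using in_components_nonempty by (auto simp: penny_faces_def)

lemma frontier_face_subset: "\<sigma> \<in> penny_faces c \<Longrightarrow> frontier \<sigma> \<subseteq> G"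
  using frontier_of_components_closed_complement[OF closed_graph] by (simp add: penny_faces_def)

lemma in_frontier_iff:
  assumes "\<sigma> \<in> penny_faces c" "p \<in> G"
  shows "p \<in> frontier \<sigma> \<longleftrightarrow> p \<in> closure \<sigma>"
  using face_open[OF assms(1)] face_disjoint[OF assms(1)] assms(2) by (auto simp: frontier_def interior_open)

lemma face_absorbs:
  assumes "\<sigma> \<in> penny_faces c" "connected T" "T \<inter> G = {}" "T \<inter> \<sigma> \<noteq> {}"
  shows "T \<subseteq> \<sigma>"
  using components_maximal[of \<sigma> "- G" T] assms by (auto simp: penny_faces_def)

lemma point_in_face: "p \<notin> G \<Longrightarrow> \<exists>\<sigma>\<in>penny_faces c. p \<in> \<sigma>"
  using Union_components[of "- G"] unfolding penny_faces_def by blast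

lemma open_edge_no_vertex:
  assumes "(i, j) \<in> E" "p \<in> open_segment (c i) (c j)" shows "p \<noteq> c k"
  using vertex_on_edge[OF assms(1), of k] assms(2) by (auto simp: open_segment_def)

text \<open>
  Being in the closure of a face is a closed condition along an edge. It is also open: a small disc
  around an interior point of the edge is cut by the edge into two halves that avoid the graph, the
  face contains one of them, and its closure contains the diameter.
\<close>

lemma open_edge_in_closure:
  assumes \<sigma>: "\<sigma> \<in> penny_faces c" and e: "(i, j) \<in> E"
    and p: "p \<in> open_segment (c i) (c j)" "p \<in> closure \<sigma>"
  shows "open_segment (c i) (c j) \<subseteq> closure \<sigma>"
proof -
  let ?S = "open_segment (c i) (c j)"
  define Z where "Z = ?S \<inter> closure \<sigma>"
  define n where "n = \<i> * (c j - c i)"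
  define h where "h y = n \<bullet> (y - c i)" for y
  have n0: "n \<noteq> 0" using edge_neq[OF e] inj_c by (simp add: n_def)
  have nn: "n \<bullet> n > 0" using n0 by simp
  have orth: "n \<bullet> (c j - c i) = 0" by (simp add: n_def inner_complex_def algebra_simps)
  have h_seg: "h y = 0" if y: "y \<in> seg i j" for y
  proof -
    have "y = c i + dist (c i) y *\<^sub>R (c j - c i)" by (rule on_unit_segment(1)[OF y edge_dist[OF e]])
    then have "y - c i = dist (c i) y *\<^sub>R (c j - c i)" by (metis add_diff_cancel_left')
    then show ?thesis by (simp add: h_def orth)
  qed
  have h_shift: "h (y + s *\<^sub>R n) = h y + s * (n \<bullet> n)" for y s
    by (simp add: h_def inner_diff_right inner_add_right)
  have half: "convex {y. t * h y > 0}" for t :: real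
  proof -
    have "{y. t * h y > 0} = {y. (t *\<^sub>R n) \<bullet> y > (t *\<^sub>R n) \<bullet> c i}"
      by (auto simp: h_def inner_diff_right right_diff_distrib)
    then show ?thesis using convex_halfspace_gt by metis
  qed
  have local: "\<exists>\<epsilon>>0. \<forall>y\<in>?S. dist y x < \<epsilon> \<longrightarrow> y \<in> Z" if x: "x \<in> Z" for x
  proof -
    have xS: "x \<in> ?S" and xc: "x \<in> closure \<sigma>" using x by (auto simp: Z_def)
    obtain \<epsilon> where \<epsilon>: "\<epsilon> > 0" "\<And>k. c k \<in> ball x \<epsilon> \<Longrightarrow> c k = x"
      "\<And>k l q. (k, l) \<in> E \<Longrightarrow> q \<in> seg k l \<Longrightarrow> q \<in> ball x \<epsilon> \<Longrightarrow> x \<in> seg k l"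
      using star_neighbourhood[of x] by metis
    have xcl: "x \<in> seg i j" using xS by (simp add: open_segment_def)
    have line: "h y = 0" if y: "y \<in> ball x \<epsilon>" "y \<in> G" for y
    proof -
      have "\<not> (\<exists>k. y = c k)" using \<epsilon>(2) y(1) open_edge_no_vertex[OF e xS] by metis
      then obtain k l where kl: "(k, l) \<in> E" "y \<in> seg k l" using y(2) in_graph_iff by blast
      have "x \<in> seg k l" by (rule \<epsilon>(3)[OF kl y(1)])
      then have "{i, j} = {k, l}"
        using edges_meet_at_vertices[OF e kl(1) xcl] open_edge_no_vertex[OF e xS] by blast
      then have "(k = i \<and> l = j) \<or> (k = j \<and> l = i)" by (auto simp: doubleton_eq_iff)
      then have "seg k l = seg i j" using closed_segment_commute by auto
      then show ?thesis using kl(2) by (intro h_seg) (simp only:)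
    qed
    obtain q where q: "q \<in> \<sigma>" "q \<in> ball x \<epsilon>"
      using xc \<epsilon>(1) unfolding closure_approachable by (metis dist_commute mem_ball)
    have "open (\<sigma> \<inter> ball x \<epsilon>)" using face_open[OF \<sigma>] by auto
    then obtain \<delta> where \<delta>: "\<delta> > 0" "ball q \<delta> \<subseteq> \<sigma> \<inter> ball x \<epsilon>" using q by (meson IntI openE)
    \<comment> \<open>on the line through the edge one cannot decide for a half disc, so the point is moved off it\<close>
    obtain q' where q': "q' \<in> \<sigma>" "q' \<in> ball x \<epsilon>" "h q' \<noteq> 0"
    proof (cases "h q = 0")
      case True
      define s where "s = \<delta> / (2 * norm n)"
      have s: "s > 0" using \<delta>(1) n0 by (simp add: s_def)
      have "dist q (q + s *\<^sub>R n) < \<delta>" using n0 \<delta>(1) by (simp add: dist_norm s_def)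
      then have "q + s *\<^sub>R n \<in> \<sigma> \<inter> ball x \<epsilon>" using \<delta>(2) by auto
      moreover have "h (q + s *\<^sub>R n) \<noteq> 0" using True s n0 by (simp add: h_shift)
      ultimately show thesis using that by blast
    qed (use q that in blast)
    define t where "t = sgn (h q')"
    define H where "H = ball x \<epsilon> \<inter> {y. t * h y > 0}"
    have "convex H" unfolding H_def by (intro convex_Int convex_ball half)
    then have "connected H" by (rule convex_connected)
    moreover have "H \<inter> G = {}" using line by (fastforce simp: H_def)
    moreover have "t * h q' = \<bar>h q'\<bar>" by (simp add: t_def sgn_if)
    then have "q' \<in> H" using q' by (simp add: H_def)
    ultimately have Hs: "H \<subseteq> \<sigma>" using face_absorbs[OF \<sigma>] q'(1) by blast
    have "y \<in> Z" if y: "y \<in> ?S" "dist y x < \<epsilon>" for y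
    proof -
      have "y \<in> closure H"
        unfolding closure_approachable
      proof (intro allI impI)
        fix e :: real assume e: "e > 0"
        define s where "s = min e (\<epsilon> - dist y x) / (2 * norm n)"
        have s: "s > 0" using e y(2) n0 by (simp add: s_def)
        have d: "norm (s *\<^sub>R t *\<^sub>R n) < min e (\<epsilon> - dist y x)"
        proof -
          have "\<bar>t\<bar> = 1" using q'(3) by (simp add: t_def abs_sgn_eq)
          then have "norm (s *\<^sub>R t *\<^sub>R n) = s * norm n" using s by (simp add: abs_mult)
          also have "\<dots> = min e (\<epsilon> - dist y x) / 2" using n0 by (simp add: s_def)
          also have "\<dots> < min e (\<epsilon> - dist y x)"
          proof -
            have "a > 0 \<Longrightarrow> a / 2 < a" for a :: real by simp
            moreover have "min e (\<epsilon> - dist y x) > 0" using e y(2) by simp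
            ultimately show ?thesis by blast
          qed
          finally show ?thesis .
        qed
        define y' where "y' = y + (s * t) *\<^sub>R n"
        have "dist y' y = norm (s *\<^sub>R t *\<^sub>R n)" by (simp add: y'_def dist_norm)
        then have dd: "dist y' y < e" "dist y' y < \<epsilon> - dist y x" using d by auto
        have "h y = 0" using h_seg y(1) by (simp add: open_segment_def)
        then have "t * h y' = s * (t * t) * (n \<bullet> n)" by (simp add: y'_def h_shift)
        moreover have "t * t = 1" using q'(3) by (simp add: t_def sgn_if)
        ultimately have "t * h y' > 0" using s nn by simp
        moreover have "y' \<in> ball x \<epsilon>" using dd(2) dist_triangle[of y' x y] by (simp add: dist_commute)
        ultimately show "\<exists>y'\<in>H. dist y' y < e" using dd(1) by (auto simp: H_def)
      qed
      then show ?thesis using Hs y(1) closure_mono unfolding Z_def by blast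
    qed
    then show ?thesis using \<epsilon>(1) by blast
  qed
  have "openin (top_of_set ?S) Z"
    unfolding openin_euclidean_subtopology_iff using local by (auto simp: Z_def)
  moreover have "closedin (top_of_set ?S) Z" unfolding Z_def by (simp add: closedin_closed_Int)
  moreover have "Z \<noteq> {}" using p by (auto simp: Z_def)
  ultimately have "Z = ?S" using convex_connected[OF convex_open_segment[of "c i" "c j"]] unfolding connected_clopen by blast
  then show ?thesis by (auto simp: Z_def)
qed

text \<open>
  The vertices on the frontier, each taken once; as corners are counted with multiplicity, the
  facial degree can be larger than the number of these vertices.
\<close>

definition corners_of :: "complex set \<Rightarrow> nat set" where
  "corners_of \<sigma> = {i. c i \<in> frontier \<sigma>}"

lemma edge_on_frontier:
  assumes \<sigma>: "\<sigma> \<in> penny_faces c" and e: "(i, j) \<in> E"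
    and p: "p \<in> open_segment (c i) (c j)" "p \<in> frontier \<sigma>"
  shows "i \<in> corners_of \<sigma>" "j \<in> corners_of \<sigma>"
proof -
  have "p \<in> closure \<sigma>" using p(2) by (simp add: frontier_def)
  then have "open_segment (c i) (c j) \<subseteq> closure \<sigma>" by (rule open_edge_in_closure[OF \<sigma> e p(1)])
  then have "closure (open_segment (c i) (c j)) \<subseteq> closure \<sigma>" by (rule closure_minimal) simp
  moreover have "closure (open_segment (c i) (c j)) = seg i j"
    using edge_neq[OF e] inj_c by (simp add: closure_open_segment)
  ultimately have "seg i j \<subseteq> closure \<sigma>" by (simp only:)
  then show "i \<in> corners_of \<sigma>" "j \<in> corners_of \<sigma>"
    using in_frontier_iff[OF \<sigma> vertex_in_graph] by (auto simp: corners_of_def)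
qed

lemma frontier_point_cases:
  assumes \<sigma>: "\<sigma> \<in> penny_faces c" and p: "p \<in> frontier \<sigma>"
  shows "(\<exists>k\<in>corners_of \<sigma>. p = c k) \<or>
    (\<exists>i\<in>corners_of \<sigma>. \<exists>j\<in>corners_of \<sigma>. (i, j) \<in> E \<and> p \<in> open_segment (c i) (c j))"
proof (cases "\<exists>k. p = c k")
  case True
  then show ?thesis using p by (auto simp: corners_of_def)
next
  case False
  then obtain i j where ij: "(i, j) \<in> E" "p \<in> seg i j"
    using frontier_face_subset[OF \<sigma>] p in_graph_iff by blast
  then have "p \<in> open_segment (c i) (c j)" using False by (auto simp: open_segment_def)
  then show ?thesis using edge_on_frontier[OF \<sigma> ij(1) _ p] ij(1) by blast
qed

lemma card_corners_of:
  assumes "facial_degree c \<sigma> \<le> enat D"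
  shows "finite (corners_of \<sigma>)" "card (corners_of \<sigma>) \<le> D"
proof -
  have fin: "finite (face_corners c \<sigma>)" and card: "card (face_corners c \<sigma>) \<le> D"
    using assms by (auto simp: facial_degree_def split: if_splits)
  have "\<exists>C. C \<in> components (\<sigma> \<inter> ball (c i) (1/2))" if "i \<in> corners_of \<sigma>" for i
  proof -
    have "c i \<in> closure \<sigma>" using that by (simp add: corners_of_def frontier_def)
    then obtain y where "y \<in> \<sigma>" "dist y (c i) < 1/2" unfolding closure_approachable by (metis half_gt_zero zero_less_one)
    then have "\<sigma> \<inter> ball (c i) (1/2) \<noteq> {}" by (auto simp: dist_commute)
    then show ?thesis using components_eq_empty by blast
  qed
  then obtain f where f: "\<And>i. i \<in> corners_of \<sigma> \<Longrightarrow> f i \<in> components (\<sigma> \<inter> ball (c i) (1/2))" by metis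
  have sub: "(\<lambda>i. (i, f i)) ` corners_of \<sigma> \<subseteq> face_corners c \<sigma>" using f by (auto simp: face_corners_def)
  have inj: "inj_on (\<lambda>i. (i, f i)) (corners_of \<sigma>)" by (auto simp: inj_on_def)
  show "finite (corners_of \<sigma>)" using finite_imageD[OF finite_subset[OF sub fin] inj] .
  show "card (corners_of \<sigma>) \<le> D" using card_mono[OF fin sub] card_image[OF inj] card by simp
qed

text \<open>
  The vertices in a connected component \<open>K\<close> of the corners, with the edges between
  them, and the corners outside of \<open>K\<close>, with the edges between those, form two disjoint
  closed sets. Together they cover the frontier, which is connected.
\<close>

lemma corners_connected:
  assumes conn: "penny_connected c" and \<sigma>: "\<sigma> \<in> penny_faces c" and fin: "finite (corners_of \<sigma>)"
    and ij: "i \<in> corners_of \<sigma>" "j \<in> corners_of \<sigma>"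
  shows "(i, j) \<in> (E \<inter> corners_of \<sigma> \<times> corners_of \<sigma>)\<^sup>*"
proof -
  let ?V = "corners_of \<sigma>" and ?R = "E \<inter> corners_of \<sigma> \<times> corners_of \<sigma>"
  define K where "K = {k \<in> ?V. (i, k) \<in> ?R\<^sup>*}"
  define span_of where "span_of K = c ` K \<union> (\<Union>(a, b)\<in>E \<inter> K \<times> K. seg a b)" for K
  have clos: "closed (span_of K)" if "K \<subseteq> ?V" for K
  proof -
    have "finite K" using that fin by (rule finite_subset)
    then show ?thesis unfolding span_of_def
      by (intro closed_Un closed_UN) (auto intro: finite_imp_closed)
  qed
  have step: "a \<in> K \<longleftrightarrow> b \<in> K" if "(a, b) \<in> E" "a \<in> ?V" "b \<in> ?V" for a b
  proof -
    have "(a, b) \<in> ?R" "(b, a) \<in> ?R" using that edge_sym by auto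
    then show ?thesis using that unfolding K_def by (auto intro: rtrancl_into_rtrancl)
  qed
  have KV: "K \<subseteq> ?V" by (auto simp: K_def)
  have disj: "span_of K \<inter> span_of (?V - K) = {}"
  proof -
    have False if p: "p \<in> span_of K" "p \<in> span_of (?V - K)" for p
    proof -
      have "(\<exists>k\<in>L. p = c k) \<or> (\<exists>a\<in>L. \<exists>b\<in>L. (a, b) \<in> E \<and> p \<in> seg a b)" if "p \<in> span_of L" for L
        using that by (auto simp: span_of_def)
      from this[OF p(1)] this[OF p(2)] have "\<exists>v. v \<in> K \<and> v \<in> ?V - K"
      proof (elim disjE bexE conjE)
        fix k k' assume "k \<in> K" "k' \<in> ?V - K" "p = c k" "p = c k'"
        moreover from this have "k = k'" using inj_c by metis
        ultimately show ?thesis by blast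
      next
        fix k a b assume k: "k \<in> K" "p = c k" and ab: "a \<in> ?V - K" "b \<in> ?V - K" "(a, b) \<in> E" "p \<in> seg a b"
        then have "k = a \<or> k = b" by (intro vertex_on_edge) simp_all
        then show ?thesis using k ab by blast
      next
        fix k a b assume k: "k \<in> ?V - K" "p = c k" and ab: "a \<in> K" "b \<in> K" "(a, b) \<in> E" "p \<in> seg a b"
        then have "k = a \<or> k = b" by (intro vertex_on_edge) simp_all
        then show ?thesis using k ab by blast
      next
        fix a b a' b' assume ab: "a \<in> K" "b \<in> K" "(a, b) \<in> E" "p \<in> seg a b"
          and ab': "a' \<in> ?V - K" "b' \<in> ?V - K" "(a', b') \<in> E" "p \<in> seg a' b'"
        from edges_meet_at_vertices[OF ab(3) ab'(3) ab(4) ab'(4)]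
        have "\<exists>v. v \<in> {a, b} \<and> v \<in> {a', b'}" by blast
        then show ?thesis using ab(1,2) ab'(1,2) by blast
      qed
      then show False by blast
    qed
    then show ?thesis by blast
  qed
  have cover: "frontier \<sigma> \<subseteq> span_of K \<union> span_of (?V - K)"
  proof
    fix p assume "p \<in> frontier \<sigma>"
    from frontier_point_cases[OF \<sigma> this] show "p \<in> span_of K \<union> span_of (?V - K)"
    proof (elim disjE bexE conjE)
      fix k assume "k \<in> ?V" "p = c k" then show ?thesis by (auto simp: span_of_def)
    next
      fix a b assume ab: "a \<in> ?V" "b \<in> ?V" "(a, b) \<in> E" "p \<in> open_segment (c a) (c b)"
      then have pc: "p \<in> seg a b" by (simp add: open_segment_def)
      show ?thesis using step[OF ab(3,1,2)] ab pc unfolding span_of_def by blast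
    qed
  qed
  have "connected (frontier \<sigma>)"
    using connected_frontier_component_complement[OF connected_graph[OF conn]] \<sigma> by (simp add: penny_faces_def)
  then have "span_of K \<inter> frontier \<sigma> = {} \<or> span_of (?V - K) \<inter> frontier \<sigma> = {}"
    using connected_closedD[of "frontier \<sigma>" "span_of K" "span_of (?V - K)"] clos[OF KV] clos[of "?V - K"] disj cover by blast
  moreover have "c i \<in> span_of K \<inter> frontier \<sigma>" using ij(1) by (auto simp: span_of_def K_def corners_of_def)
  moreover have "c j \<in> span_of (?V - K) \<inter> frontier \<sigma>" if "j \<notin> K" using that ij(2) by (auto simp: span_of_def corners_of_def)
  ultimately have "j \<in> K" by blast
  then show ?thesis by (simp add: K_def)
qed

end

section \<open>Penny graphs with bounded facial degree are rough lattices\<close>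

locale penny_bounded_faces = penny_graph +
  fixes D :: nat
  assumes connected_penny: "penny_connected c"
    and facial_degree_le: "\<sigma> \<in> penny_faces c \<Longrightarrow> facial_degree c \<sigma> \<le> enat D"
begin

definition face_radius :: nat where "face_radius = D\<^sup>2 + 1"

lemma no_bounded_graph: "\<not> range c \<subseteq> cball p (real R)"
proof
  assume "range c \<subseteq> cball p (real R)"
  then have "{i. dist (c i) p \<le> real R} = UNIV" by (auto simp: dist_commute)
  then show False using finite_vertices_near[of p R] by simp
qed

lemma corners_nonempty:
  assumes \<sigma>: "\<sigma> \<in> penny_faces c" shows "corners_of \<sigma> \<noteq> {}"
proof -
  have "\<sigma> \<noteq> UNIV" using face_disjoint[OF \<sigma>] vertex_in_graph by blast
  then have "frontier \<sigma> \<noteq> {}" using face_nonempty[OF \<sigma>] by (simp add: frontier_eq_empty)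
  then show ?thesis using frontier_point_cases[OF \<sigma>] by blast
qed

lemma corners_linked:
  assumes \<sigma>: "\<sigma> \<in> penny_faces c" and ij: "i \<in> corners_of \<sigma>" "j \<in> corners_of \<sigma>"
  shows "(i, j) \<in> (E \<inter> corners_of \<sigma> \<times> corners_of \<sigma>)\<^sup>*"
  using corners_connected[OF connected_penny \<sigma> card_corners_of(1)[OF facial_degree_le[OF \<sigma>]] ij] .

lemma path_dist: "(i, j) \<in> E ^^ n \<Longrightarrow> dist (c i) (c j) \<le> n"
proof (induction n arbitrary: j)
  case (Suc n)
  then obtain k where k: "(i, k) \<in> E ^^ n" "(k, j) \<in> E" by auto
  have "dist (c i) (c j) \<le> dist (c i) (c k) + dist (c k) (c j)" by (rule dist_triangle)
  then show ?case using Suc.IH[OF k(1)] edge_dist[OF k(2)] by simp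
qed simp

lemma relpow_restrict: "(i, j) \<in> (E \<inter> A) ^^ n \<Longrightarrow> (i, j) \<in> E ^^ n"
  by (induction n arbitrary: j) auto

lemma linked_path:
  assumes "(i, j) \<in> (E \<inter> N \<times> N)\<^sup>*" "finite N" "card N \<le> m"
  shows "\<exists>n\<le>m\<^sup>2. (i, j) \<in> E ^^ n"
proof -
  have fin: "finite (E \<inter> N \<times> N)" using assms(2) by simp
  have "card (E \<inter> N \<times> N) \<le> card (N \<times> N)" using assms(2) by (intro card_mono) auto
  also have "\<dots> \<le> m\<^sup>2" using assms(3) by (simp add: card_cartesian_product power2_eq_square mult_le_mono)
  finally have "card (E \<inter> N \<times> N) \<le> m\<^sup>2" .
  moreover obtain n where "n \<le> card (E \<inter> N \<times> N)" "(i, j) \<in> (E \<inter> N \<times> N) ^^ n"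
    using assms(1) unfolding rtrancl_finite_eq_relpow[OF fin] by blast
  ultimately show ?thesis using relpow_restrict by (meson order_trans)
qed

lemma corners_dist:
  assumes \<sigma>: "\<sigma> \<in> penny_faces c" and ij: "i \<in> corners_of \<sigma>" "j \<in> corners_of \<sigma>"
  shows "dist (c i) (c j) \<le> D\<^sup>2"
proof -
  obtain n where "n \<le> D\<^sup>2" "(i, j) \<in> E ^^ n"
    using linked_path[OF corners_linked[OF \<sigma> ij]] card_corners_of[OF facial_degree_le[OF \<sigma>]] by blast
  then show ?thesis using path_dist[of i j n] by (meson of_nat_le_iff order_trans)
qed

lemma frontier_near_corner:
  assumes \<sigma>: "\<sigma> \<in> penny_faces c" and i: "i \<in> corners_of \<sigma>"
  shows "frontier \<sigma> \<subseteq> cball (c i) face_radius"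
proof
  fix p assume "p \<in> frontier \<sigma>"
  from frontier_point_cases[OF \<sigma> this] show "p \<in> cball (c i) face_radius"
  proof (elim disjE bexE conjE)
    fix k assume "k \<in> corners_of \<sigma>" "p = c k"
    then show ?thesis using corners_dist[OF \<sigma> i, of k] by (simp add: face_radius_def)
  next
    fix a b assume ab: "a \<in> corners_of \<sigma>" "(a, b) \<in> E" "p \<in> open_segment (c a) (c b)"
    have "dist (c a) p + dist p (c b) = 1" using edge_segment_length[OF ab(2)] ab(3) by (simp add: open_segment_def)
    then have "dist (c a) p \<le> 1" using zero_le_dist[of p "c b"] by linarith
    then show ?thesis using corners_dist[OF \<sigma> i ab(1)] dist_triangle[of "c i" p "c a"] by (simp add: face_radius_def)
  qed
qed

text \<open>
  Otherwise the face would contain the complement of a disc, and infinitely many vertices, at mutual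
  distance at least 1, would lie in that disc.
\<close>

lemma face_near_corner:
  assumes \<sigma>: "\<sigma> \<in> penny_faces c" and i: "i \<in> corners_of \<sigma>"
  shows "\<sigma> \<subseteq> cball (c i) face_radius"
proof (rule ccontr)
  let ?B = "cball (c i) (real face_radius)"
  assume "\<not> \<sigma> \<subseteq> ?B"
  then have "- ?B \<inter> \<sigma> \<noteq> {}" by blast
  moreover have "connected (- ?B)" by (rule connected_complement_bounded_convex) auto
  moreover have "- ?B \<inter> frontier \<sigma> = {}" using frontier_near_corner[OF \<sigma> i] by blast
  ultimately have "- ?B \<subseteq> \<sigma>" using connected_Int_frontier[of "- ?B" \<sigma>] by blast
  then have "range c \<subseteq> ?B" using face_disjoint[OF \<sigma>] vertex_in_graph by blast
  then show False using no_bounded_graph by blast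
qed

text \<open>
  Assigns to every point of the plane the vertices that bound the vertex, edge or face containing
  it. Along a segment, consecutive points share such a vertex (\<open>touches_locally\<close>), and
  the vertices assigned to one point are linked (\<open>touches_linked\<close>); so a connectedness
  argument replaces the enumeration of the faces met by the segment.
\<close>

definition touches :: "nat \<Rightarrow> complex \<Rightarrow> bool" where
  "touches i p \<longleftrightarrow> p = c i \<or> (\<exists>j. (i, j) \<in> E \<and> p \<in> seg i j) \<or>
     (\<exists>\<sigma>\<in>penny_faces c. p \<in> \<sigma> \<and> i \<in> corners_of \<sigma>)"

lemma touches_dist: "touches i p \<Longrightarrow> dist (c i) p \<le> face_radius"
proof -
  assume "touches i p"
  then consider "p = c i" | j where "(i, j) \<in> E" "p \<in> seg i j"
    | \<sigma> where "\<sigma> \<in> penny_faces c" "p \<in> \<sigma>" "i \<in> corners_of \<sigma>" unfolding touches_def by blast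
  then show ?thesis
  proof cases
    case 2
    have "dist (c i) p \<le> 1" using edge_segment_length[OF 2] zero_le_dist[of p "c j"] by linarith
    moreover have "1 \<le> real face_radius" by (simp add: face_radius_def)
    ultimately show ?thesis by linarith
  next
    case 3
    then show ?thesis using face_near_corner[OF 3(1,3)] by auto
  qed simp
qed

lemma touches_edge:
  assumes "(i, j) \<in> E" "p \<in> seg i j" shows "touches i p" "touches j p"
proof -
  show "touches i p" using assms unfolding touches_def by blast
  have "p \<in> seg j i" using assms(2) by (simp only: closed_segment_commute)
  then show "touches j p" using edge_sym[OF assms(1)] unfolding touches_def by blast
qed

lemma touches_exists: "\<exists>i. touches i p"
proof (cases "p \<in> G")
  case True
  then show ?thesis unfolding in_graph_iff touches_def by blast
next
  case False
  then obtain \<sigma> where "\<sigma> \<in> penny_faces c" "p \<in> \<sigma>" using point_in_face by blast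
  then show ?thesis using corners_nonempty unfolding touches_def by blast
qed

lemma touches_linked:
  assumes "touches i p" "touches j p"
  shows "(i, j) \<in> (E \<inter> {k. touches k p} \<times> {k. touches k p})\<^sup>*" (is "_ \<in> ?R\<^sup>*")
proof (cases "p \<in> G")
  case False
  obtain \<sigma> where \<sigma>: "\<sigma> \<in> penny_faces c" "p \<in> \<sigma>" using point_in_face[OF False] by blast
  have corner: "k \<in> corners_of \<sigma>" if k: "touches k p" for k
  proof -
    have "p \<noteq> c k" "\<not> (\<exists>j. (k, j) \<in> E \<and> p \<in> seg k j)" using False in_graph_iff by blast+
    then obtain \<tau> where \<tau>: "\<tau> \<in> penny_faces c" "p \<in> \<tau>" "k \<in> corners_of \<tau>" using k unfolding touches_def by blast
    have "\<tau> = \<sigma>" using \<sigma> \<tau> components_eq[of \<tau> "- G" \<sigma>] unfolding penny_faces_def by blast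
    then show ?thesis using \<tau> by simp
  qed
  have "E \<inter> corners_of \<sigma> \<times> corners_of \<sigma> \<subseteq> ?R" using \<sigma> unfolding touches_def by blast
  then show ?thesis using corners_linked[OF \<sigma>(1) corner[OF assms(1)] corner[OF assms(2)]] rtrancl_mono by blast
next
  case True
  have noface: "\<not> (\<exists>\<sigma>\<in>penny_faces c. p \<in> \<sigma> \<and> k \<in> corners_of \<sigma>)" for k using face_disjoint True by blast
  have refl: "(k, k) \<in> ?R\<^sup>*" for k by simp
  show ?thesis
  proof (cases "\<exists>v. p = c v")
    case True
    then obtain v where v: "p = c v" by blast
    have tv: "touches v p" using v by (simp add: touches_def)
    have star: "k = v \<or> ((k, v) \<in> ?R \<and> (v, k) \<in> ?R)" if k: "touches k p" for k
    proof (cases "k = v")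
      case False
      then obtain l where l: "(k, l) \<in> E" "p \<in> seg k l"
        using k noface v inj_c unfolding touches_def by metis
      then have "l = v" using vertex_on_edge[OF l(1), of v] v False by simp
      then show ?thesis using l(1) edge_sym k tv by blast
    qed simp
    have "(i, v) \<in> ?R\<^sup>*" using star[OF assms(1)] by auto
    moreover have "(v, j) \<in> ?R\<^sup>*" using star[OF assms(2)] by auto
    ultimately show ?thesis by (rule rtrancl_trans)
  next
    case False
    obtain i' where i': "(i, i') \<in> E" "p \<in> seg i i'" using assms(1) noface False unfolding touches_def by blast
    obtain j' where j': "(j, j') \<in> E" "p \<in> seg j j'" using assms(2) noface False unfolding touches_def by blast
    have "{i, i'} = {j, j'}" using edges_meet_at_vertices[OF i'(1) j'(1) i'(2) j'(2)] False by blast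
    then have "j = i \<or> j = i'" by blast
    moreover have "(i, i') \<in> ?R" using i'(1) touches_edge[OF i'] by blast
    ultimately show ?thesis by auto
  qed
qed

text \<open>
  A point \<open>q\<close> near \<open>p\<close> may lie in a face that does not contain
  \<open>p\<close>. The segment from \<open>q\<close> to \<open>p\<close> then leaves this face at a
  point of the star around \<open>p\<close>, hence at the vertex \<open>p\<close>, which serves both
  points, or on an edge through \<open>p\<close>, whose endpoints do.
\<close>

lemma touches_locally:
  "\<exists>\<epsilon>>0. \<forall>q. dist q p < \<epsilon> \<longrightarrow> (\<exists>k. touches k p \<and> touches k q)"
proof (cases "p \<in> G")
  case False
  obtain \<sigma> where \<sigma>: "\<sigma> \<in> penny_faces c" "p \<in> \<sigma>" using point_in_face[OF False] by blast
  obtain \<epsilon> where \<epsilon>: "\<epsilon> > 0" "ball p \<epsilon> \<subseteq> \<sigma>" using face_open[OF \<sigma>(1)] \<sigma>(2) by (meson openE)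
  obtain k where "k \<in> corners_of \<sigma>" using corners_nonempty[OF \<sigma>(1)] by blast
  then have "touches k p \<and> touches k q" if "dist q p < \<epsilon>" for q
    using that \<epsilon>(2) \<sigma> unfolding touches_def by (auto simp: dist_commute subset_iff)
  then show ?thesis using \<epsilon>(1) by blast
next
  case True
  obtain \<epsilon> where \<epsilon>: "\<epsilon> > 0" "\<And>k. c k \<in> ball p \<epsilon> \<Longrightarrow> c k = p"
    "\<And>i j q. (i, j) \<in> E \<Longrightarrow> q \<in> seg i j \<Longrightarrow> q \<in> ball p \<epsilon> \<Longrightarrow> p \<in> seg i j"
    using star_neighbourhood[of p] by metis
  have "\<exists>k. touches k p \<and> touches k q" if "dist q p < \<epsilon>" for q
  proof -
    have qb: "q \<in> ball p \<epsilon>" using that by (simp add: dist_commute)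
    show ?thesis
    proof (cases "q \<in> G")
      case True
      then consider k where "q = c k" | k l where "(k, l) \<in> E" "q \<in> seg k l" using in_graph_iff by blast
      then show ?thesis
      proof cases
        case 1
        then have "p = c k" using \<epsilon>(2) qb by metis
        then show ?thesis using 1 unfolding touches_def by blast
      next
        case 2
        then show ?thesis using \<epsilon>(3)[OF 2 qb] touches_edge by blast
      qed
    next
      case False
      obtain \<sigma> where \<sigma>: "\<sigma> \<in> penny_faces c" "q \<in> \<sigma>" using point_in_face[OF False] by blast
      have "p \<notin> \<sigma>" using face_disjoint[OF \<sigma>(1)] \<open>p \<in> G\<close> by blast
      then have "closed_segment q p \<inter> frontier \<sigma> \<noteq> {}"
        using \<sigma>(2) by (intro connected_Int_frontier) auto
      then obtain p' where p': "p' \<in> closed_segment q p" "p' \<in> frontier \<sigma>" by blast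
      have "closed_segment q p \<subseteq> ball p \<epsilon>" using qb \<epsilon>(1) by (intro closed_segment_subset convex_ball) auto
      then have pb: "p' \<in> ball p \<epsilon>" using p'(1) by blast
      have tq: "touches k q" if "k \<in> corners_of \<sigma>" for k using that \<sigma> unfolding touches_def by blast
      from frontier_point_cases[OF \<sigma>(1) p'(2)] show ?thesis
      proof (elim disjE bexE conjE)
        fix k assume k: "k \<in> corners_of \<sigma>" "p' = c k"
        then have "p = c k" using \<epsilon>(2) pb by metis
        then show ?thesis using tq[OF k(1)] unfolding touches_def by blast
      next
        fix a b assume ab: "a \<in> corners_of \<sigma>" "(a, b) \<in> E" "p' \<in> open_segment (c a) (c b)"
        then have "p \<in> seg a b" using \<epsilon>(3)[OF ab(2) _ pb] by (simp add: open_segment_def)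
        then show ?thesis using tq[OF ab(1)] touches_edge(1)[OF ab(2)] by blast
      qed
    qed
  qed
  then show ?thesis using \<epsilon>(1) by blast
qed

text \<open>
  The path found along the segment stays among the vertices near the segment, whose number is
  bounded, and a path without repeated edges cannot be longer than the square of this number.
\<close>

lemma near_vertices_linked:
  assumes r: "dist (c x) (c y) \<le> real r"
  shows "\<exists>n\<le>((4 * (r + face_radius) + 1)\<^sup>2)\<^sup>2. (x, y) \<in> E ^^ n"
proof -
  define N where "N = {k. dist (c k) (c x) \<le> real (r + face_radius)}"
  define Rel where "Rel p q \<longleftrightarrow> (\<forall>i j. touches i p \<longrightarrow> touches j q \<longrightarrow> (i, j) \<in> (E \<inter> N \<times> N)\<^sup>*)" for p q
  let ?S = "seg x y"
  have inN: "k \<in> N" if "p \<in> ?S" "touches k p" for p k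
  proof -
    have "dist (c x) p \<le> r"
      using dist_in_closed_segment(1)[OF that(1)] r by (simp add: dist_commute)
    then show ?thesis using touches_dist[OF that(2)] dist_triangle[of "c k" "c x" p] by (simp add: N_def dist_commute)
  qed
  have linkN: "(i, j) \<in> (E \<inter> N \<times> N)\<^sup>*" if "p \<in> ?S" "touches i p" "touches j p" for i j p
  proof -
    have "E \<inter> {k. touches k p} \<times> {k. touches k p} \<subseteq> E \<inter> N \<times> N" using inN[OF that(1)] by blast
    then show ?thesis using touches_linked[OF that(2,3)] rtrancl_mono by blast
  qed
  have "sym (E \<inter> N \<times> N)" using edge_sym by (auto simp: sym_def)
  then have symr: "sym ((E \<inter> N \<times> N)\<^sup>*)" by (rule sym_rtrancl)
  have "Rel (c x) (c y)"
  proof (rule connected_equivalence_relation[of ?S])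
    show "Rel q p" if "Rel p q" for p q using that symr unfolding Rel_def sym_def by blast
    show "Rel p s" if "Rel p q" "Rel q s" for p q s
    proof -
      obtain k where "touches k q" using touches_exists by blast
      then show ?thesis using that unfolding Rel_def by (meson rtrancl_trans)
    qed
    show "\<exists>T. openin (top_of_set ?S) T \<and> a \<in> T \<and> (\<forall>q\<in>T. Rel a q)" if a: "a \<in> ?S" for a
    proof -
      obtain \<epsilon> where \<epsilon>: "\<epsilon> > 0" "\<And>q. dist q a < \<epsilon> \<Longrightarrow> \<exists>k. touches k a \<and> touches k q"
        using touches_locally[of a] by blast
      have "Rel a q" if q: "q \<in> ?S" "q \<in> ball a \<epsilon>" for q
      proof -
        obtain k where k: "touches k a" "touches k q" using \<epsilon>(2)[of q] q(2) by (auto simp: dist_commute)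
        show ?thesis unfolding Rel_def
          using linkN[OF a _ k(1)] linkN[OF q(1) k(2)] by (meson rtrancl_trans)
      qed
      then show ?thesis using a \<epsilon>(1) by (intro exI[of _ "?S \<inter> ball a \<epsilon>"]) (auto simp: openin_open_Int)
    qed
  qed auto
  then have "(x, y) \<in> (E \<inter> N \<times> N)\<^sup>*" unfolding Rel_def touches_def by blast
  moreover have "finite N" unfolding N_def by (rule finite_vertices_near)
  moreover have "card N \<le> (4 * (r + face_radius) + 1)\<^sup>2" unfolding N_def by (rule card_vertices_near)
  ultimately show ?thesis by (rule linked_path)
qed

lemma vertex_near: "\<exists>i. dist (c i) p \<le> face_radius"
  using touches_exists touches_dist by blast

end

lemma floor_quotient_close:
  fixes a b :: real
  assumes "\<bar>a - b\<bar> \<le> l" "l > 0"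
  shows "\<bar>\<lfloor>a / l\<rfloor> - \<lfloor>b / l\<rfloor>\<bar> \<le> 1"
proof -
  have "\<bar>a / l - b / l\<bar> \<le> 1" using assms by (simp add: diff_divide_distrib[symmetric])
  then show ?thesis by linarith
qed

lemma close_of_floor_quotient:
  fixes a b :: real
  assumes "\<bar>\<lfloor>a / l\<rfloor> - \<lfloor>b / l\<rfloor>\<bar> \<le> 1" "l > 0"
  shows "\<bar>a - b\<bar> \<le> 2 * l"
proof -
  have "\<bar>a / l - b / l\<bar> \<le> 2" using assms(1) by linarith
  then have "\<bar>a - b\<bar> / l \<le> 2" using assms(2) by (simp add: diff_divide_distrib[symmetric])
  then show ?thesis using assms(2) by (simp add: field_simps)
qed

lemma close_of_floor_quotient_eq:
  fixes a :: real
  assumes "\<lfloor>a / l\<rfloor> = z" "l > 0"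
  shows "\<bar>a - z * l\<bar> \<le> l"
proof -
  have "z \<le> a / l" "a / l \<le> z + 1" using assms(1) by linarith+
  then have "z * l \<le> a" "a \<le> (z + 1) * l" using assms(2) by (simp_all add: field_simps)
  then show ?thesis using assms(2) by (simp add: abs_le_iff distrib_right)
qed

text \<open>
  The mesh exceeds twice the radius \<open>D\<^sup>2 + 1\<close> within which every point of the
  plane has a vertex, so that the vertex near the centre of a cell lies in that cell.
\<close>

definition cell_side :: "nat \<Rightarrow> nat" where "cell_side D = 2 * (D\<^sup>2 + 1) + 1"

definition cell_vertices :: "nat \<Rightarrow> nat" where "cell_vertices D = (4 * cell_side D + 1)\<^sup>2"

definition cell_path_length :: "nat \<Rightarrow> nat" where
  "cell_path_length D = ((4 * (4 * cell_side D + (D\<^sup>2 + 1)) + 1)\<^sup>2)\<^sup>2"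

context penny_bounded_faces begin

definition penny_cell :: "nat \<Rightarrow> int \<times> int" where
  "penny_cell i = (\<lfloor>Re (c i) / cell_side D\<rfloor>, \<lfloor>Im (c i) / cell_side D\<rfloor>)"

lemma penny_rough_lattice: "rough_lattice E penny_cell (cell_vertices D) (cell_path_length D)"
proof
  let ?l = "real (cell_side D)"
  have l1: "?l \<ge> 1" by (simp add: cell_side_def)
  then have l0: "?l > 0" by linarith
  have l2: "2 * real face_radius + 1 = ?l" by (simp add: cell_side_def face_radius_def)
  show "(y, x) \<in> E" if "(x, y) \<in> E" for x y using that by (rule edge_sym)
  show "sup_norm (penny_cell x - penny_cell y) \<le> 1" if "(x, y) \<in> E" for x y
  proof -
    have "dist (c x) (c y) \<le> 1" using edge_dist[OF that] by simp
    from dist_box[OF this] have "\<bar>Re (c x) - Re (c y)\<bar> \<le> ?l" "\<bar>Im (c x) - Im (c y)\<bar> \<le> ?l" using l1 by linarith+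
    from this[THEN floor_quotient_close[OF _ l0]] show ?thesis by (simp add: penny_cell_def sup_norm_def)
  qed
  have sub: "{x. penny_cell x = p} \<subseteq> {i. \<bar>Re (c i) - fst p * ?l\<bar> \<le> ?l \<and> \<bar>Im (c i) - snd p * ?l\<bar> \<le> ?l}" for p
    using close_of_floor_quotient_eq[OF _ l0] by (auto simp: penny_cell_def)
  show "finite {x. penny_cell x = p}" for p using sub finite_vertices_box by (rule finite_subset)
  show "card {x. penny_cell x = p} \<le> cell_vertices D" for p
    using card_mono[OF finite_vertices_box sub] card_vertices_box unfolding cell_vertices_def by (meson order_trans)
  show "\<exists>x. penny_cell x = p" for p
  proof -
    define z where "z = Complex ((fst p + 1/2) * ?l) ((snd p + 1/2) * ?l)"
    obtain i where "dist (c i) z \<le> face_radius" using vertex_near by blast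
    from dist_box[OF this] have d: "\<bar>Re (c i) - (fst p + 1/2) * ?l\<bar> < ?l / 2" "\<bar>Im (c i) - (snd p + 1/2) * ?l\<bar> < ?l / 2"
      using l2 by (auto simp: z_def)
    have fl: "\<lfloor>a / ?l\<rfloor> = k" if "\<bar>a - (k + 1/2) * ?l\<bar> < ?l / 2" for a and k :: int
    proof -
      have e: "(k + 1/2) * ?l - ?l / 2 = k * ?l" "(k + 1/2) * ?l + ?l / 2 = (k + 1) * ?l"
        by (simp_all add: algebra_simps)
      have "k * ?l < a \<and> a < (k + 1) * ?l" using that unfolding abs_diff_less_iff e .
      then have "k * ?l \<le> a" "a < (k + 1) * ?l" by simp_all
      then have "k \<le> a / ?l" "a / ?l < k + 1" using l0 by (simp_all add: field_simps)
      then show ?thesis by linarith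
    qed
    show ?thesis using fl[OF d(1)] fl[OF d(2)] by (intro exI[of _ i]) (simp add: penny_cell_def)
  qed
  show "\<exists>n\<le>cell_path_length D. (x, y) \<in> E ^^ n" if "sup_norm (penny_cell x - penny_cell y) \<le> 1" for x y
  proof -
    have "\<bar>\<lfloor>Re (c x) / ?l\<rfloor> - \<lfloor>Re (c y) / ?l\<rfloor>\<bar> \<le> 1" "\<bar>\<lfloor>Im (c x) / ?l\<rfloor> - \<lfloor>Im (c y) / ?l\<rfloor>\<bar> \<le> 1"
      using that by (auto simp: penny_cell_def sup_norm_def)
    from this[THEN close_of_floor_quotient[OF _ l0]]
    have "\<bar>Re (c x - c y)\<bar> \<le> 2 * ?l" "\<bar>Im (c x - c y)\<bar> \<le> 2 * ?l" by auto
    then have "dist (c x) (c y) \<le> real (4 * cell_side D)" using cmod_le[of "c x - c y"] by (simp add: dist_norm)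
    from near_vertices_linked[OF this] show ?thesis by (simp add: cell_path_length_def face_radius_def)
  qed
qed

interpretation rough_lattice E penny_cell "cell_vertices D" "cell_path_length D"
  by (rule penny_rough_lattice)

lemma laplacian_eq: "laplacian c = lap"
  by (simp add: laplacian_def graph_laplacian_def fun_eq_iff)

text \<open>
  The growth condition is formulated with the graph distance and must be translated to the distance
  of cells.
\<close>

lemma graph_dist_le: "real (graph_dist c x x0) \<le> cell_path_length D * (real_of_int (sup_norm (penny_cell x - penny_cell x0)) + 1)"
proof -
  obtain n where n: "n \<le> cell_path_length D * (nat (sup_norm (penny_cell x - penny_cell x0)) + 1)" "(x, x0) \<in> E ^^ n"
    using path_length_le[of x x0 "nat (sup_norm (penny_cell x - penny_cell x0))"] by auto
  have "graph_dist c x x0 \<le> n" unfolding graph_dist_def using n(2) by (rule Least_le)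
  then have "real (graph_dist c x x0) \<le> real (cell_path_length D * (nat (sup_norm (penny_cell x - penny_cell x0)) + 1))"
    using n(1) by (simp only: of_nat_le_iff)
  also have "\<dots> = cell_path_length D * (real_of_int (sup_norm (penny_cell x - penny_cell x0)) + 1)"
    by (simp add: algebra_simps)
  finally show ?thesis .
qed

lemma ancient_poly_subset:
  assumes k: "k \<ge> 1"
  shows "ancient_poly c x0 k \<subseteq> polynomial_ancient (nat \<lceil>k\<rceil>)"
proof
  fix u assume u: "u \<in> ancient_poly c x0 k"
  let ?K = "nat \<lceil>k\<rceil>" and ?M = "real (cell_path_length D)"
  obtain C where C: "\<And>x t. t \<le> 0 \<Longrightarrow> \<bar>u x t\<bar> \<le> C * (1 + real (graph_dist c x x0) + sqrt \<bar>t\<bar>) powr k"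
    using u by (auto simp: ancient_poly_def)
  have h: "heat u" using u by (auto simp: ancient_poly_def ancient_solution_def heat_def laplacian_eq)
  have z: "\<forall>x. \<forall>t>0. u x t = 0" using u by (auto simp: ancient_poly_def)
  define s where "s = real_of_int (sup_norm (penny_cell x0))"
  define B where "B = (?M + 1) * (s + 2)"
  have s0: "s \<ge> 0" by (simp add: s_def)
  have M0: "?M \<ge> 0" by simp
  have "\<bar>u x t\<bar> \<le> (\<bar>C\<bar> * B ^ ?K) * (1 + real_of_int (sup_norm (penny_cell x)) + sqrt \<bar>t\<bar>) ^ ?K" if t: "t \<le> 0" for x t
  proof -
    define a where "a = real_of_int (sup_norm (penny_cell x))"
    define d where "d = real (graph_dist c x x0)"
    define r where "r = sqrt \<bar>t\<bar>"
    have a0: "a \<ge> 0" and r0: "r \<ge> 0" and d0: "d \<ge> 0" by (simp_all add: a_def r_def d_def)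
    have "sup_norm (penny_cell x - penny_cell x0) \<le> sup_norm (penny_cell x) + sup_norm (penny_cell x0)"
      using sup_norm_triangle[of "penny_cell x" "penny_cell x0" 0] sup_norm_commute[of 0 "penny_cell x0"] by simp
    then have "real_of_int (sup_norm (penny_cell x - penny_cell x0)) + 1 \<le> a + s + 1" by (simp add: a_def s_def)
    then have "d \<le> ?M * (a + s + 1)"
      unfolding d_def using graph_dist_le[of x x0] M0 by (meson mult_left_mono order_trans)
    then have "1 + d + r \<le> (?M + 1) * (a + s + 1) + r" using a0 s0 by (simp add: distrib_right)
    also have "\<dots> \<le> (?M + 1) * (a + s + 1 + r)" using r0 M0 mult_nonneg_nonneg[OF M0 r0] by (simp add: algebra_simps)
    also have "\<dots> \<le> (?M + 1) * ((s + 2) * (1 + a + r))"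
      using a0 s0 r0 mult_nonneg_nonneg[OF s0 a0] mult_nonneg_nonneg[OF s0 r0] by (intro mult_left_mono) (simp_all add: algebra_simps)
    finally have le: "1 + d + r \<le> B * (1 + a + r)" by (simp add: B_def mult.assoc)
    \<comment> \<open>the base is at least 1, so the exponent may be rounded up\<close>
    have "(1 + d + r) powr k \<le> (1 + d + r) powr real ?K"
      using d0 r0 by (intro powr_mono) (auto simp: real_nat_ceiling_ge)
    also have "\<dots> = (1 + d + r) ^ ?K" using d0 r0 by (intro powr_realpow) linarith
    also have "\<dots> \<le> (B * (1 + a + r)) ^ ?K" using le d0 r0 by (intro power_mono) linarith+
    finally have p: "(1 + d + r) powr k \<le> B ^ ?K * (1 + a + r) ^ ?K" by (simp add: power_mult_distrib)
    have "\<bar>u x t\<bar> \<le> C * (1 + d + r) powr k" using C[OF t, of x] by (simp add: d_def r_def)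
    also have "\<dots> \<le> \<bar>C\<bar> * (1 + d + r) powr k" by (intro mult_right_mono) auto
    also have "\<dots> \<le> \<bar>C\<bar> * (B ^ ?K * (1 + a + r) ^ ?K)" using p by (intro mult_left_mono) auto
    finally show ?thesis by (simp add: a_def r_def mult.assoc)
  qed
  then show "u \<in> polynomial_ancient ?K" unfolding polynomial_ancient_def using h z by blast
qed

lemma ancient_poly_spanned:
  assumes "k \<ge> 1"
  shows "spanned_by (4 * (harmonic_constant + 1) * (nat \<lceil>k\<rceil>)\<^sup>2) (ancient_poly c x0 k)"
proof -
  have "nat \<lceil>k\<rceil> \<ge> 1" using assms by linarith
  from ancient_spanned[OF this] show ?thesis using ancient_poly_subset[OF assms] by (rule spanned_by_mono) simp
qed

end

definition dimension_constant :: "nat \<Rightarrow> nat" where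
  "dimension_constant D = 4 * (rough_lattice.harmonic_constant (cell_vertices D) (cell_path_length D) + 1)"

lemma dim_le_of_spanned_by: "spanned_by n W \<Longrightarrow> (\<exists>B. finite B \<and> W \<subseteq> span B) \<and> dim W \<le> n"
  unfolding spanned_by_def using dim_le_card order_trans by blast

theorem corollary4p8:
  shows "\<forall>D::nat. \<exists>C::real. \<forall>c :: nat \<Rightarrow> complex.
    penny_configuration c \<and> penny_connected c \<and>
    (SUP \<sigma>\<in>penny_faces c. facial_degree c \<sigma>) = enat D \<longrightarrow>
    (\<forall>(k::real) x0. k \<ge> 1 \<longrightarrow>
      (\<exists>B. finite B \<and> ancient_poly c x0 k \<subseteq> span B) \<and>
      real (dim (ancient_poly c x0 k)) \<le> C * k\<^sup>2)"
proof (intro allI exI[of _ "real (4 * dimension_constant D)" for D] impI)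
  fix D :: nat and c :: "nat \<Rightarrow> complex" and k :: real and x0 :: nat
  assume hyp: "penny_configuration c \<and> penny_connected c \<and> (SUP \<sigma>\<in>penny_faces c. facial_degree c \<sigma>) = enat D"
    and k: "k \<ge> 1"
  have "facial_degree c \<sigma> \<le> enat D" if "\<sigma> \<in> penny_faces c" for \<sigma>
    using hyp SUP_upper[OF that, of "facial_degree c"] by simp
  then interpret penny_bounded_faces c D using hyp by unfold_locales auto
  have "spanned_by (dimension_constant D * (nat \<lceil>k\<rceil>)\<^sup>2) (ancient_poly c x0 k)"
    unfolding dimension_constant_def using ancient_poly_spanned[OF k] .
  from dim_le_of_spanned_by[OF this]
  have B: "\<exists>B. finite B \<and> ancient_poly c x0 k \<subseteq> span B"
    and "dim (ancient_poly c x0 k) \<le> dimension_constant D * (nat \<lceil>k\<rceil>)\<^sup>2" by auto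
  then have "real (dim (ancient_poly c x0 k)) \<le> real (dimension_constant D * (nat \<lceil>k\<rceil>)\<^sup>2)" by (simp only: of_nat_le_iff)
  also have "\<dots> = dimension_constant D * (real (nat \<lceil>k\<rceil>))\<^sup>2" by simp
  also have "\<dots> \<le> dimension_constant D * (2 * k)\<^sup>2"
  proof (intro mult_left_mono power_mono)
    show "real (nat \<lceil>k\<rceil>) \<le> 2 * k" using k by linarith
  qed auto
  finally show "(\<exists>B. finite B \<and> ancient_poly c x0 k \<subseteq> span B) \<and>
      real (dim (ancient_poly c x0 k)) \<le> real (4 * dimension_constant D) * k\<^sup>2"
    using B by (simp add: power_mult_distrib)
qed

end
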